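(* Let $D\in\mathcal{B}(\mathbb{R}^k)$ have non-empty interior and be convex, let $f\in BC_\mu^{1-}([0,T]\times S\times D,\mathbb{R}^k)$, and let $g\in B_b(S,D)$ be consistent and bounded away from $\partial D$, i.e. there is $\varepsilon>0$ with $\mathrm{dist}(g(x),\partial D)\ge\varepsilon$ for all $x\in S$. Then there is a unique non-extendible admissible solution $u_g$ to (M), on a maximal interval of existence $I_g$ that is open in $[0,T]$. With $t_g^-:=\inf I_g$, either $I_g=[0,T]$ or $$\lim_{t\downarrow t_g^-}\ \inf_{x\in S}\min\left\{\mathrm{dist}(u_g(t,x),\partial D),\frac{1}{1+|u_g(t,x)|}\right\}=0.$$ Moreover, if $\mathcal{X}$ is Feller (respectively right-hand Feller), $f(s,\cdot,\cdot)$ is continuous on $S\times D$ for $\mu$-a.e. $s\in[0,T]$, and $g$ is continuous, then $u_g$ is continuous (respectively right-continuous).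
   Context: **Spaces.** $S$ is a separable metrizable topological space, $T>0$, $\mu$ is an atomless Borel measure on $[0,T]$, $k\in\mathbb{N}$, $|\cdot|$ is the Euclidean norm. $[0,T]\times S$ carries a pseudometric $d_S$ whose topology is coarser than or equal to the product topology; $\mathcal{B}(I\times S)$, Borel measurability and continuity on $I\times S$ ($I\subset[0,T]$ an interval) refer to $d_S$. A map $u$ on $I\times S$ with values in a normed space $(E,\|\cdot\|)$ is consistent if $u(r,x)=u(s,y)$ whenever $d_S((r,x),(s,y))=0$, and right-continuous if for all $(r,x)\in I\times S$ and $\varepsilon>0$ there is $\delta>0$ with $\|u(s,y)-u(r,x)\|<\varepsilon$ for all $(s,y)\in I\times S$ with $s\ge r$ and $d_S((s,y),(r,x))<\delta$. A map $g$ on $S$ is consistent if $g(x)=g(y)$ whenever $d_S((T,x),(T,y))=0$. $B(S,D)$, $B(I\times S,D)$ are the sets of $D$-valued Borel measurable maps; $B_b$ denotes the bounded ones. $\mathrm{dist}(w,\emptyset):=\infty$. **Markov process.** $\mathcal{X}=(X,(\mathcal{F}_t)_{t\in[0,T]},\mathbb{P})$ is a fixed consistent progressive Markov process on a measurable space $(\Omega,\mathcal{F})$ with state space $S$ and Borel measurable transition probabilities: $X:[0,T]\times\Omega\to S$ is a process adapted to the filtration $(\mathcal{F}_t)$, $\mathbb{P}=\{P_{r,x}\mid(r,x)\in[0,T]\times S\}$ is a set of probability measures on $(\Omega,\mathcal{F})$ (expectations $E_{r,x}$), and: (1) for each $(s,y)$, $P_{s,y}$-a.s. $d_S((r,X_r),(r,y))=0$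 for all $r\in[0,s]$; (2) $[0,t]\times S\to[0,1]$, $(s,x)\mapsto P_{s,x}(X_t\in B)$ is consistent and Borel measurable for all $t\in[0,T]$, $B\in\mathcal{B}(S)$; (3) $P_{r,x}(X_t\in B\mid\mathcal{F}_s)=P_{s,X_s}(X_t\in B)$ $P_{r,x}$-a.s. for all $r\le s\le t$, $x\in S$, $B\in\mathcal{B}(S)$; (4) $X$ is progressively measurable with respect to its natural filtration and its natural backward filtration. $\mathcal{X}$ is Feller (resp. right-hand Feller) if $[0,t]\times S\to\mathbb{R}$, $(r,x)\mapsto E_{r,x}[\varphi(X_t)]$ is continuous (resp. right-continuous) for all $t\in[0,T]$ and all bounded continuous $\varphi:S\to\mathbb{R}$. **Regularity with respect to $\mu$.** $a\in B([0,T]\times S,E)$ is $\mu$-dominated if there is a $\mu$-integrable $\overline a\in B([0,T],\mathbb{R}_+)$ such that, outside a $\mu$-null set of $s$, $\|a(s,y)\|\le\overline a(s)$ for all $y\in S$. A $\mathcal{B}([0,T]\times S)\otimes\mathcal{B}(D)$-measurable $f:[0,T]\times S\times D\to\mathbb{R}^k$ is locally $\mu$-bounded (resp. locally Lipschitz $\mu$-continuous) if each $\hat w\in D$ has a neighborhood $W$ in $\overline D$ and a $\mu$-dominated $\lambda\in B([0,T]\times S,\mathbb{R}_+)$ such that $|f(t,x,w)|\le\lambda(t,x)$ (resp. $|f(t,x,w)-f(t,x,w')|\le\lambda(t,x)|w-w'|$) for all $(t,x)\in[0,T]\times S$ and $w,w'\in W\cap D$. $BC_\mu^{1-}([0,T]\times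 S\times D,\mathbb{R}^k)$ is the set of all $\mathcal{B}([0,T]\times S)\otimes\mathcal{B}(D)$-measurable maps that are locally $\mu$-bounded and locally Lipschitz $\mu$-continuous. **Problem (M).** An interval $I$ is admissible if $I=(t,T]$ or $I=[t,T]$ for some $t\in[0,T)$. A solution to (M) (with data $f,g$) on an admissible interval $I$ is a consistent $u\in B(I\times S,D)$ such that for all $r\le t$ in $I$ and $x\in S$, $|u(t,X_t)|$ and $\int_r^t|f(s,X_s,u(s,X_s))|\,\mu(ds)$ are finite and $P_{r,x}$-integrable, $E_{r,x}[u(t,X_t)]=u(r,x)+E_{r,x}[\int_r^tf(s,X_s,u(s,X_s))\,\mu(ds)]$, and $u(T,x)=g(x)$. A solution $u$ on $I$ is admissible if $u([r,T]\times S)$ is relatively compact in $D^\circ$ (its closure is a compact subset of $D^\circ$) for all $r\in I$. An admissible solution $u$ on $I$ is extendible if there is an admissible solution $\tilde u$ on an admissible interval $\tilde I\supsetneq I$ with $u=\tilde u$ on $I\times S$; otherwise it is non-extendible and $I$ is a maximal interval of existence.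
   Formalization: The pseudometric d_S is additionally assumed to make the time projection (r,x) ↦ r continuous; without this the claim fails, e.g. for one-point S, d_S = 0, Lebesgue μ, D = ℝ, f = 1, g = 0, where consistent maps are constant but (M) forces u(t) = t − T. *)

theory Defs
  imports "HOL-Probability.Probability"
begin

section \<open>Pseudometrics\<close>

definition pseudometric_on :: "'a set \<Rightarrow> ('a \<Rightarrow> 'a \<Rightarrow> real) \<Rightarrow> bool" where
  "pseudometric_on M d \<longleftrightarrow>
     (\<forall>p\<in>M. d p p = 0) \<and> (\<forall>p\<in>M. \<forall>q\<in>M. 0 \<le> d p q \<and> d p q = d q p) \<and>
     (\<forall>p\<in>M. \<forall>q\<in>M. \<forall>r\<in>M. d p r \<le> d p q + d q r)"

definition pm_topology :: "'a set \<Rightarrow> ('a \<Rightarrow> 'a \<Rightarrow> real) \<Rightarrow> 'a topology" where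
  "pm_topology M d =
     topology (\<lambda>U. U \<subseteq> M \<and> (\<forall>p\<in>U. \<exists>\<delta>>0. \<forall>q\<in>M. d p q < \<delta> \<longrightarrow> q \<in> U))"

lemma openin_pm_topology:
  "openin (pm_topology M d) U \<longleftrightarrow>
     U \<subseteq> M \<and> (\<forall>p\<in>U. \<exists>\<delta>>0. \<forall>q\<in>M. d p q < \<delta> \<longrightarrow> q \<in> U)"
proof -
  let ?L = "\<lambda>U. U \<subseteq> M \<and> (\<forall>p\<in>U. \<exists>\<delta>>0. \<forall>q\<in>M. d p q < \<delta> \<longrightarrow> q \<in> U)"
  have inter: "?L (U \<inter> V)" if U: "?L U" and V: "?L V" for U V
  proof (intro conjI ballI)
    show "U \<inter> V \<subseteq> M" using U by blast
    fix p assume p: "p \<in> U \<inter> V"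
    obtain a where "a > 0" "\<forall>q\<in>M. d p q < a \<longrightarrow> q \<in> U" using U p by blast
    moreover obtain b where "b > 0" "\<forall>q\<in>M. d p q < b \<longrightarrow> q \<in> V" using V p by blast
    ultimately show "\<exists>\<delta>>0. \<forall>q\<in>M. d p q < \<delta> \<longrightarrow> q \<in> U \<inter> V"
      by (intro exI[of _ "min a b"]) auto
  qed
  have union: "?L (\<Union>K)" if K: "\<forall>U\<in>K. ?L U" for K
  proof (intro conjI ballI)
    show "\<Union>K \<subseteq> M" using K by blast
    fix p assume "p \<in> \<Union>K"
    then obtain U where U: "U \<in> K" "p \<in> U" by blast
    then obtain a where "a > 0" "\<forall>q\<in>M. d p q < a \<longrightarrow> q \<in> U" using K by blast
    then show "\<exists>\<delta>>0. \<forall>q\<in>M. d p q < \<delta> \<longrightarrow> q \<in> \<Union>K" using U by blast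
  qed
  have "istopology ?L"
    unfolding istopology_def
  proof (rule conjI)
    show "\<forall>U V. ?L U \<longrightarrow> ?L V \<longrightarrow> ?L (U \<inter> V)"
      by (rule allI, rule allI, rule impI, rule impI, rule inter)
    show "\<forall>K. (\<forall>U\<in>K. ?L U) \<longrightarrow> ?L (\<Union>K)"
      by (rule allI, rule impI, rule union)
  qed
  then show ?thesis by (simp add: pm_topology_def topology_inverse')
qed

definition pm_borel :: "'a set \<Rightarrow> ('a \<Rightarrow> 'a \<Rightarrow> real) \<Rightarrow> 'a measure" where
  "pm_borel M d = sigma M {U. openin (pm_topology M d) U}"

section \<open>Maps on time intervals times the state space\<close>

text \<open>The state space is the type \<open>'s\<close>. A map on \<open>I \<times> S\<close> is represented by a total function on
  pairs; only its values on \<open>I \<times> UNIV\<close> are relevant.\<close>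

definition coarser_than_product :: "real \<Rightarrow> (real \<times> 's::topological_space \<Rightarrow> real \<times> 's \<Rightarrow> real) \<Rightarrow> bool" where
  "coarser_than_product T d \<longleftrightarrow>
     (\<forall>U. openin (pm_topology ({0..T} \<times> UNIV) d) U \<longrightarrow> openin (top_of_set ({0..T} \<times> UNIV)) U)"

text \<open>The pseudometric has to see the time coordinate. If it does not, Problem (M) can have no solution:
  for \<open>d = 0\<close> on \<open>[0,T] \<times> S\<close> with a one-point \<open>S\<close>, every consistent map is constant, although
  for Lebesgue measure, \<open>f = 1\<close> and \<open>g = 0\<close> the equation forces \<open>u (t, x) = t - T\<close>.
  The condition holds whenever \<open>\<bar>r - s\<bar> \<le> d (r, x) (s, y)\<close>.\<close>

definition time_continuous :: "real \<Rightarrow> (real \<times> 's \<Rightarrow> real \<times> 's \<Rightarrow> real) \<Rightarrow> bool" where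
  "time_continuous T d \<longleftrightarrow> continuous_map (pm_topology ({0..T} \<times> UNIV) d) euclideanreal fst"

definition consistent_on :: "(real \<times> 's \<Rightarrow> real \<times> 's \<Rightarrow> real) \<Rightarrow> real set \<Rightarrow> (real \<times> 's \<Rightarrow> 'e) \<Rightarrow> bool" where
  "consistent_on d I u \<longleftrightarrow> (\<forall>p\<in>I \<times> UNIV. \<forall>q\<in>I \<times> UNIV. d p q = 0 \<longrightarrow> u p = u q)"

definition consistent_terminal :: "real \<Rightarrow> (real \<times> 's \<Rightarrow> real \<times> 's \<Rightarrow> real) \<Rightarrow> ('s \<Rightarrow> 'e) \<Rightarrow> bool" where
  "consistent_terminal T d g \<longleftrightarrow> (\<forall>x y. d (T, x) (T, y) = 0 \<longrightarrow> g x = g y)"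

definition pm_measurable ::
  "(real \<times> 's \<Rightarrow> real \<times> 's \<Rightarrow> real) \<Rightarrow> real set \<Rightarrow> (real \<times> 's \<Rightarrow> 'e::topological_space) \<Rightarrow> bool" where
  "pm_measurable d I u \<longleftrightarrow> u \<in> borel_measurable (pm_borel (I \<times> UNIV) d)"

definition pm_continuous ::
  "(real \<times> 's \<Rightarrow> real \<times> 's \<Rightarrow> real) \<Rightarrow> real set \<Rightarrow> (real \<times> 's \<Rightarrow> 'e::topological_space) \<Rightarrow> bool" where
  "pm_continuous d I u \<longleftrightarrow> continuous_map (pm_topology (I \<times> UNIV) d) euclidean u"

definition right_continuous ::
  "(real \<times> 's \<Rightarrow> real \<times> 's \<Rightarrow> real) \<Rightarrow> real set \<Rightarrow> (real \<times> 's \<Rightarrow> 'e::real_normed_vector) \<Rightarrow> bool" where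
  "right_continuous d I u \<longleftrightarrow>
     (\<forall>r\<in>I. \<forall>x. \<forall>\<epsilon>>0. \<exists>\<delta>>0. \<forall>s\<in>I. \<forall>y.
        r \<le> s \<longrightarrow> d (s, y) (r, x) < \<delta> \<longrightarrow> norm (u (s, y) - u (r, x)) < \<epsilon>)"

text \<open>Unlike \<^const>\<open>infdist\<close>, this has value \<open>\<infinity>\<close> for the empty set.\<close>

definition edist :: "'a::metric_space \<Rightarrow> 'a set \<Rightarrow> ereal" where
  "edist w A = (INF a\<in>A. ereal (dist w a))"

section \<open>Markov processes\<close>

definition generated_sigma ::
  "'w measure \<Rightarrow> (real \<Rightarrow> 'w \<Rightarrow> 's::topological_space) \<Rightarrow> real set \<Rightarrow> 'w measure" where
  "generated_sigma \<Omega> X J =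
     sigma (space \<Omega>) {X s -` B \<inter> space \<Omega> | s B. s \<in> J \<and> B \<in> sets borel}"

text \<open>Only the space and the sets of \<open>\<Omega>\<close> and of \<open>F t\<close> matter.\<close>

definition markov_process ::
  "real \<Rightarrow> (real \<times> 's::topological_space \<Rightarrow> real \<times> 's \<Rightarrow> real) \<Rightarrow> 'w measure \<Rightarrow> (real \<Rightarrow> 'w measure) \<Rightarrow>
   (real \<Rightarrow> 'w \<Rightarrow> 's) \<Rightarrow> (real \<Rightarrow> 's \<Rightarrow> 'w measure) \<Rightarrow> bool" where
  "markov_process T d \<Omega> F X P \<longleftrightarrow>
     (\<forall>t\<in>{0..T}. subalgebra \<Omega> (F t)) \<and>
     (\<forall>s\<in>{0..T}. \<forall>t\<in>{0..T}. s \<le> t \<longrightarrow> sets (F s) \<subseteq> sets (F t)) \<and>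
     (\<forall>t\<in>{0..T}. X t \<in> F t \<rightarrow>\<^sub>M borel) \<and>
     (\<forall>r\<in>{0..T}. \<forall>x. prob_space (P r x) \<and> sets (P r x) = sets \<Omega>) \<and>
     (\<forall>s\<in>{0..T}. \<forall>y. AE \<omega> in P s y. \<forall>r\<in>{0..s}. d (r, X r \<omega>) (r, y) = 0) \<and>
     (\<forall>t\<in>{0..T}. \<forall>B\<in>sets borel.
        consistent_on d {0..t} (\<lambda>(s, x). measure (P s x) (X t -` B \<inter> space \<Omega>)) \<and>
        pm_measurable d {0..t} (\<lambda>(s, x). measure (P s x) (X t -` B \<inter> space \<Omega>))) \<and>
     (\<forall>r s t. 0 \<le> r \<longrightarrow> r \<le> s \<longrightarrow> s \<le> t \<longrightarrow> t \<le> T \<longrightarrow> (\<forall>x. \<forall>B\<in>sets borel.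
        AE \<omega> in P r x. real_cond_exp (P r x) (F s) (indicator (X t -` B \<inter> space \<Omega>)) \<omega>
                      = measure (P s (X s \<omega>)) (X t -` B \<inter> space \<Omega>))) \<and>
     (\<forall>t\<in>{0..T}. (\<lambda>(s, \<omega>). X s \<omega>) \<in>
        restrict_space borel {0..t} \<Otimes>\<^sub>M generated_sigma \<Omega> X {0..t} \<rightarrow>\<^sub>M borel) \<and>
     (\<forall>t\<in>{0..T}. (\<lambda>(s, \<omega>). X s \<omega>) \<in>
        restrict_space borel {t..T} \<Otimes>\<^sub>M generated_sigma \<Omega> X {t..T} \<rightarrow>\<^sub>M borel)"

definition feller ::
  "real \<Rightarrow> (real \<times> 's::topological_space \<Rightarrow> real \<times> 's \<Rightarrow> real) \<Rightarrow>
   (real \<Rightarrow> 'w \<Rightarrow> 's) \<Rightarrow> (real \<Rightarrow> 's \<Rightarrow> 'w measure) \<Rightarrow> bool" where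
  "feller T d X P \<longleftrightarrow>
     (\<forall>t\<in>{0..T}. \<forall>\<phi>::'s \<Rightarrow> real. continuous_on UNIV \<phi> \<longrightarrow> bounded (range \<phi>) \<longrightarrow>
        pm_continuous d {0..t} (\<lambda>(r, x). \<integral>\<omega>. \<phi> (X t \<omega>) \<partial>P r x))"

definition right_feller ::
  "real \<Rightarrow> (real \<times> 's::topological_space \<Rightarrow> real \<times> 's \<Rightarrow> real) \<Rightarrow>
   (real \<Rightarrow> 'w \<Rightarrow> 's) \<Rightarrow> (real \<Rightarrow> 's \<Rightarrow> 'w measure) \<Rightarrow> bool" where
  "right_feller T d X P \<longleftrightarrow>
     (\<forall>t\<in>{0..T}. \<forall>\<phi>::'s \<Rightarrow> real. continuous_on UNIV \<phi> \<longrightarrow> bounded (range \<phi>) \<longrightarrow>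
        right_continuous d {0..t} (\<lambda>(r, x). \<integral>\<omega>. \<phi> (X t \<omega>) \<partial>P r x))"

section \<open>Regularity with respect to a measure on the time interval\<close>

definition atomless :: "'a measure \<Rightarrow> bool" where
  "atomless M \<longleftrightarrow>
     (\<forall>A\<in>sets M. 0 < emeasure M A \<longrightarrow>
        (\<exists>B\<in>sets M. B \<subseteq> A \<and> 0 < emeasure M B \<and> 0 < emeasure M (A - B)))"

definition dominated ::
  "real \<Rightarrow> (real \<times> 's \<Rightarrow> real \<times> 's \<Rightarrow> real) \<Rightarrow> real measure \<Rightarrow>
   (real \<times> 's \<Rightarrow> 'e::real_normed_vector) \<Rightarrow> bool" where
  "dominated T d \<mu> a \<longleftrightarrow>
     pm_measurable d {0..T} a \<and>
     (\<exists>b. integrable \<mu> b \<and> (\<forall>s\<in>{0..T}. 0 \<le> (b s :: real)) \<and>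
          (AE s in \<mu>. \<forall>y. norm (a (s, y)) \<le> b s))"

definition nbhd_in :: "'a::topological_space set \<Rightarrow> 'a \<Rightarrow> 'a set \<Rightarrow> bool" where
  "nbhd_in Y w W \<longleftrightarrow> W \<subseteq> Y \<and> (\<exists>U. openin (top_of_set Y) U \<and> w \<in> U \<and> U \<subseteq> W)"

definition locally_bounded ::
  "real \<Rightarrow> (real \<times> 's \<Rightarrow> real \<times> 's \<Rightarrow> real) \<Rightarrow> real measure \<Rightarrow> (real^'k) set \<Rightarrow>
   (real \<times> 's \<Rightarrow> real^'k \<Rightarrow> real^'k) \<Rightarrow> bool" where
  "locally_bounded T d \<mu> D f \<longleftrightarrow>
     (\<forall>w0\<in>D. \<exists>W \<Lambda>. nbhd_in (closure D) w0 W \<and> dominated T d \<mu> \<Lambda> \<and>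
        (\<forall>p\<in>{0..T} \<times> UNIV. 0 \<le> (\<Lambda> p :: real)) \<and>
        (\<forall>p\<in>{0..T} \<times> UNIV. \<forall>w\<in>W \<inter> D. norm (f p w) \<le> \<Lambda> p))"

definition locally_Lipschitz ::
  "real \<Rightarrow> (real \<times> 's \<Rightarrow> real \<times> 's \<Rightarrow> real) \<Rightarrow> real measure \<Rightarrow> (real^'k) set \<Rightarrow>
   (real \<times> 's \<Rightarrow> real^'k \<Rightarrow> real^'k) \<Rightarrow> bool" where
  "locally_Lipschitz T d \<mu> D f \<longleftrightarrow>
     (\<forall>w0\<in>D. \<exists>W \<Lambda>. nbhd_in (closure D) w0 W \<and> dominated T d \<mu> \<Lambda> \<and>
        (\<forall>p\<in>{0..T} \<times> UNIV. 0 \<le> (\<Lambda> p :: real)) \<and>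
        (\<forall>p\<in>{0..T} \<times> UNIV. \<forall>w\<in>W \<inter> D. \<forall>w'\<in>W \<inter> D.
           norm (f p w - f p w') \<le> \<Lambda> p * norm (w - w')))"

text \<open>The class written \<open>BC\<close> with superscript \<open>1-\<close> and subscript \<open>\<mu>\<close>, of maps into the same
  Euclidean space in which \<open>D\<close> lies.\<close>

definition BC1m ::
  "real \<Rightarrow> (real \<times> 's \<Rightarrow> real \<times> 's \<Rightarrow> real) \<Rightarrow> real measure \<Rightarrow> (real^'k) set \<Rightarrow>
   (real \<times> 's \<Rightarrow> real^'k \<Rightarrow> real^'k) set" where
  "BC1m T d \<mu> D =
     {f. (\<lambda>(p, w). f p w) \<in>
           borel_measurable (pm_borel ({0..T} \<times> UNIV) d \<Otimes>\<^sub>M restrict_space borel D) \<and>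
         locally_bounded T d \<mu> D f \<and> locally_Lipschitz T d \<mu> D f}"

section \<open>Problem (M)\<close>

definition admissible_interval :: "real \<Rightarrow> real set \<Rightarrow> bool" where
  "admissible_interval T I \<longleftrightarrow> (\<exists>t. 0 \<le> t \<and> t < T \<and> (I = {t<..T} \<or> I = {t..T}))"

text \<open>The finiteness of the integral of \<open>|f|\<close> along every path is expressed by
  \<^const>\<open>set_integrable\<close>; measurability in \<open>s\<close> is automatic for a progressively measurable process.\<close>

definition solution ::
  "real \<Rightarrow> (real \<times> 's::topological_space \<Rightarrow> real \<times> 's \<Rightarrow> real) \<Rightarrow> real measure \<Rightarrow> 'w measure \<Rightarrow>
   (real \<Rightarrow> 'w \<Rightarrow> 's) \<Rightarrow> (real \<Rightarrow> 's \<Rightarrow> 'w measure) \<Rightarrow> (real^'k) set \<Rightarrow>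
   (real \<times> 's \<Rightarrow> real^'k \<Rightarrow> real^'k) \<Rightarrow> ('s \<Rightarrow> real^'k) \<Rightarrow> real set \<Rightarrow> (real \<times> 's \<Rightarrow> real^'k) \<Rightarrow> bool" where
  "solution T d \<mu> \<Omega> X P D f g I u \<longleftrightarrow>
     admissible_interval T I \<and>
     pm_measurable d I u \<and> u ` (I \<times> UNIV) \<subseteq> D \<and> consistent_on d I u \<and>
     (\<forall>r\<in>I. \<forall>t\<in>I. \<forall>x. r \<le> t \<longrightarrow>
        integrable (P r x) (\<lambda>\<omega>. norm (u (t, X t \<omega>))) \<and>
        (\<forall>\<omega>\<in>space \<Omega>. set_integrable \<mu> {r..t} (\<lambda>s. f (s, X s \<omega>) (u (s, X s \<omega>)))) \<and>
        integrable (P r x) (\<lambda>\<omega>. LINT s:{r..t}|\<mu>. norm (f (s, X s \<omega>) (u (s, X s \<omega>)))) \<and>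
        (\<integral>\<omega>. u (t, X t \<omega>) \<partial>P r x) =
          u (r, x) + (\<integral>\<omega>. (LINT s:{r..t}|\<mu>. f (s, X s \<omega>) (u (s, X s \<omega>))) \<partial>P r x)) \<and>
     (\<forall>x. u (T, x) = g x)"

definition admissible_solution ::
  "real \<Rightarrow> (real \<times> 's::topological_space \<Rightarrow> real \<times> 's \<Rightarrow> real) \<Rightarrow> real measure \<Rightarrow> 'w measure \<Rightarrow>
   (real \<Rightarrow> 'w \<Rightarrow> 's) \<Rightarrow> (real \<Rightarrow> 's \<Rightarrow> 'w measure) \<Rightarrow> (real^'k) set \<Rightarrow>
   (real \<times> 's \<Rightarrow> real^'k \<Rightarrow> real^'k) \<Rightarrow> ('s \<Rightarrow> real^'k) \<Rightarrow> real set \<Rightarrow> (real \<times> 's \<Rightarrow> real^'k) \<Rightarrow> bool" where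
  "admissible_solution T d \<mu> \<Omega> X P D f g I u \<longleftrightarrow>
     solution T d \<mu> \<Omega> X P D f g I u \<and>
     (\<forall>r\<in>I. compact (closure (u ` ({r..T} \<times> UNIV))) \<and> closure (u ` ({r..T} \<times> UNIV)) \<subseteq> interior D)"

definition extendible ::
  "real \<Rightarrow> (real \<times> 's::topological_space \<Rightarrow> real \<times> 's \<Rightarrow> real) \<Rightarrow> real measure \<Rightarrow> 'w measure \<Rightarrow>
   (real \<Rightarrow> 'w \<Rightarrow> 's) \<Rightarrow> (real \<Rightarrow> 's \<Rightarrow> 'w measure) \<Rightarrow> (real^'k) set \<Rightarrow>
   (real \<times> 's \<Rightarrow> real^'k \<Rightarrow> real^'k) \<Rightarrow> ('s \<Rightarrow> real^'k) \<Rightarrow> real set \<Rightarrow> (real \<times> 's \<Rightarrow> real^'k) \<Rightarrow> bool" where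
  "extendible T d \<mu> \<Omega> X P D f g I u \<longleftrightarrow>
     (\<exists>J v. I \<subset> J \<and> admissible_solution T d \<mu> \<Omega> X P D f g J v \<and> (\<forall>p\<in>I \<times> UNIV. u p = v p))"

definition nonextendible_solution ::
  "real \<Rightarrow> (real \<times> 's::topological_space \<Rightarrow> real \<times> 's \<Rightarrow> real) \<Rightarrow> real measure \<Rightarrow> 'w measure \<Rightarrow>
   (real \<Rightarrow> 'w \<Rightarrow> 's) \<Rightarrow> (real \<Rightarrow> 's \<Rightarrow> 'w measure) \<Rightarrow> (real^'k) set \<Rightarrow>
   (real \<times> 's \<Rightarrow> real^'k \<Rightarrow> real^'k) \<Rightarrow> ('s \<Rightarrow> real^'k) \<Rightarrow> real set \<Rightarrow> (real \<times> 's \<Rightarrow> real^'k) \<Rightarrow> bool" where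
  "nonextendible_solution T d \<mu> \<Omega> X P D f g I u \<longleftrightarrow>
     admissible_solution T d \<mu> \<Omega> X P D f g I u \<and> \<not> extendible T d \<mu> \<Omega> X P D f g I u"

end

theory Submission
  imports Defs
begin

text \<open>
  On a compact convex subset of \<open>D\<close> the generator \<open>f\<close> is dominated and Lipschitz. Composing it with
  the nearest-point projection onto such a set, and moving the bound \<open>b\<close> of \<open>f\<close> into the measure
  \<open>\<nu> = b \<mu>\<close>, leads to a generator that is bounded by 1 and 1-Lipschitz. For it, the map
  \<open>u \<mapsto> E[g(X_T) - \<integral> h(s, X_s, u(s, X_s)) \<nu>(ds)]\<close> is a contraction of a weighted supremum norm, which
  gives a unique global solution, continuous in the Feller case because the Picard iterates are.
  Solutions of the original problem with relatively compact range solve a truncated problem; this gives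
  uniqueness and continuity. For existence, \<open>E_{r,x}[u(t, X_t)]\<close> lies in the closed convex hull of the
  values of \<open>u(t, \<cdot>)\<close>, so a solution can be continued below \<open>t\<close> for a time that depends only on a compact
  set containing these values. Hence the maximal interval is open, and a solution that does
  not live on all of \<open>[0,T]\<close> leaves every compact convex subset of the interior of \<open>D\<close>.
\<close>

section \<open>Pseudometric topologies\<close>

text \<open>Two obstacles shape the proof. The Markov property is assumed for one future time only,
  while the integral of the generator sees the whole path from the starting time to
  \<open>T\<close>. Progressive measurability for the backward filtration makes this integral a
  functional of the sigma-algebra \<open>G t\<close> of the future, and finite-dimensional cylinders
  carry both the Markov property and measurability in the starting point over to such functionals.
  Secondly, the bound \<open>b\<close> of the generator is merely integrable and may be arbitrarily
  concentrated. Once it is the density of \<open>\<nu>\<close>, all estimates use only the finite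
  mass of \<open>\<nu>\<close> and the absence of point masses, and a step weight adapted to
  \<open>\<nu>\<close> replaces the usual exponential one. A continuation below \<open>t\<close>
  truncates to one set below \<open>t\<close> and to another above it, so that the drift below
  \<open>t\<close> is controlled by a bound that knows nothing about the solution above. Uniqueness
  precedes maximality: the maximal solution can then be chosen time by time, and its measurability
  is recovered from a sequence of starting times.\<close>

lemma topspace_pm_topology [simp]: "topspace (pm_topology M d) = M"
proof
  show "topspace (pm_topology M d) \<subseteq> M"
    by (metis openin_topspace openin_pm_topology)
  have "openin (pm_topology M d) M"
    by (auto simp: openin_pm_topology intro: exI[of _ 1])
  then show "M \<subseteq> topspace (pm_topology M d)"
    by (rule openin_subset)
qed

lemma space_pm_borel [simp]: "space (pm_borel M d) = M"
  unfolding pm_borel_def by (rule space_measure_of) (auto simp: openin_pm_topology)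

lemma sets_pm_borel: "sets (pm_borel M d) = sigma_sets M {U. openin (pm_topology M d) U}"
  unfolding pm_borel_def by (rule sets_measure_of) (auto simp: openin_pm_topology)

lemma pseudometric_on_subset: "pseudometric_on M d \<Longrightarrow> A \<subseteq> M \<Longrightarrow> pseudometric_on A d"
  unfolding pseudometric_on_def by blast

lemma openin_pm_ball:
  assumes "pseudometric_on M d" "p \<in> M"
  shows "openin (pm_topology M d) {q \<in> M. d p q < e}"
  unfolding openin_pm_topology
proof (intro conjI ballI)
  fix q assume q: "q \<in> {q \<in> M. d p q < e}"
  have "d p q' < e" if "q' \<in> M" "d q q' < e - d p q" for q'
  proof -
    have "d p q' \<le> d p q + d q q'"
      using assms q that unfolding pseudometric_on_def by blast
    then show ?thesis using that by linarith
  qed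
  then show "\<exists>\<delta>>0. \<forall>q'\<in>M. d q q' < \<delta> \<longrightarrow> q' \<in> {q \<in> M. d p q < e}"
    using q by (intro exI[of _ "e - d p q"]) auto
qed auto

text \<open>Measurability and continuity on \<open>I \<times> S\<close> are defined through the
  pseudometric restricted to that set; this lemma turns them into trace notions of those on the
  whole strip. The set \<open>V\<close> is the largest open set whose trace stays in
  \<open>U\<close>; balls of \<open>M\<close> show that it reaches every point of
  \<open>U\<close>.\<close>

lemma openin_pm_topology_subset:
  assumes "pseudometric_on M d" "A \<subseteq> M"
  shows "openin (pm_topology A d) U \<longleftrightarrow> (\<exists>V. openin (pm_topology M d) V \<and> U = V \<inter> A)"
proof
  assume U: "openin (pm_topology A d) U"
  define B where "B = {W. openin (pm_topology M d) W \<and> W \<inter> A \<subseteq> U}"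
  have "openin (pm_topology M d) (\<Union>B)"
    by (rule openin_Union) (auto simp: B_def)
  moreover have "U = \<Union>B \<inter> A"
  proof
    show "U \<subseteq> \<Union>B \<inter> A"
    proof
      fix p assume p: "p \<in> U"
      with U obtain e where e: "e > 0" "\<forall>q\<in>A. d p q < e \<longrightarrow> q \<in> U" and pA: "p \<in> A"
        unfolding openin_pm_topology by blast
      have "{q \<in> M. d p q < e} \<in> B"
        using openin_pm_ball[OF assms(1), of p e] pA assms(2) e by (auto simp: B_def)
      moreover have "p \<in> {q \<in> M. d p q < e}"
        using pA assms e unfolding pseudometric_on_def by auto
      ultimately show "p \<in> \<Union>B \<inter> A" using pA by blast
    qed
  qed (auto simp: B_def)
  ultimately show "\<exists>V. openin (pm_topology M d) V \<and> U = V \<inter> A" by blast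
next
  assume "\<exists>V. openin (pm_topology M d) V \<and> U = V \<inter> A"
  then obtain V where V: "openin (pm_topology M d) V" and U: "U = V \<inter> A" by blast
  show "openin (pm_topology A d) U"
    unfolding openin_pm_topology
  proof (intro conjI ballI)
    show "U \<subseteq> A" using U by blast
    fix p assume "p \<in> U"
    then obtain e where "e > 0" "\<forall>q\<in>M. d p q < e \<longrightarrow> q \<in> V"
      using V U unfolding openin_pm_topology by blast
    then show "\<exists>\<delta>>0. \<forall>q\<in>A. d p q < \<delta> \<longrightarrow> q \<in> U"
      using U assms(2) by (intro exI[of _ e]) auto
  qed
qed

text \<open>Generating a sigma-algebra commutes with preimages, here under the inclusion of
  \<open>A\<close> into \<open>M\<close>.\<close>

lemma sets_pm_borel_subset:
  assumes "pseudometric_on M d" "A \<subseteq> M"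
  shows "sets (pm_borel A d) = sets (restrict_space (pm_borel M d) A)"
proof -
  have "{id -` V \<inter> A |V. V \<in> sigma_sets M {U. openin (pm_topology M d) U}}
      = sigma_sets A {id -` V \<inter> A |V. V \<in> {U. openin (pm_topology M d) U}}"
    by (rule sigma_sets_vimage_commute) (use assms(2) in auto)
  also have "{id -` V \<inter> A |V. V \<in> {U. openin (pm_topology M d) U}} = {U. openin (pm_topology A d) U}"
    using openin_pm_topology_subset[OF assms] by auto
  finally have "sigma_sets A {U. openin (pm_topology A d) U}
      = {V \<inter> A |V. V \<in> sigma_sets M {U. openin (pm_topology M d) U}}" by simp
  also have "\<dots> = (\<inter>) A ` sigma_sets M {U. openin (pm_topology M d) U}"
    by (auto simp: image_iff Int_commute)
  finally show ?thesis
    unfolding sets_restrict_space sets_pm_borel .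
qed

lemma measurable_pm_borel_subset:
  assumes "pseudometric_on M d" "A \<subseteq> M"
  shows "measurable (pm_borel A d) N = measurable (restrict_space (pm_borel M d) A) N"
  by (rule measurable_cong_sets) (simp_all add: sets_pm_borel_subset[OF assms])

text \<open>Consistency comes for free: Borel sets do not separate points at distance 0.\<close>

lemma pm_borel_measurable_consistent:
  fixes f :: "'a \<Rightarrow> 'b::t1_space"
  assumes "pseudometric_on M d" "f \<in> borel_measurable (pm_borel M d)"
    and pq: "p \<in> M" "q \<in> M" "d p q = 0"
  shows "f p = f q"
proof -
  have qp: "d q p = 0" using assms unfolding pseudometric_on_def by metis
  have *: "p \<in> A \<longleftrightarrow> q \<in> A" if "A \<in> sigma_sets M {U. openin (pm_topology M d) U}" for A
    using that
  proof induct
    case (Basic U)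
    then have U: "\<exists>\<delta>>0. \<forall>q\<in>M. d x q < \<delta> \<longrightarrow> q \<in> U" if "x \<in> U" for x
      using that unfolding openin_pm_topology by blast
    show ?case
    proof
      assume "p \<in> U"
      from U[OF this] show "q \<in> U" using pq by auto
    next
      assume "q \<in> U"
      from U[OF this] show "p \<in> U" using pq qp by auto
    qed
  qed (use pq in auto)
  have "f -` {f q} \<inter> M \<in> sets (pm_borel M d)"
    using measurable_sets[OF assms(2), of "{f q}"] by simp
  from *[OF this[unfolded sets_pm_borel]] show ?thesis using pq by auto
qed

lemma pm_continuous_iff:
  fixes u :: "real \<times> 's \<Rightarrow> 'e::metric_space"
  assumes "pseudometric_on (I \<times> UNIV) d"
  shows "pm_continuous d I u \<longleftrightarrow>
    (\<forall>p\<in>I \<times> UNIV. \<forall>e>0. \<exists>\<delta>>0. \<forall>q\<in>I \<times> UNIV. d q p < \<delta> \<longrightarrow> dist (u q) (u p) < e)"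
    (is "_ \<longleftrightarrow> ?R")
proof
  have sym: "d p q = d q p" if "p \<in> I \<times> UNIV" "q \<in> I \<times> UNIV" for p q
    using assms that unfolding pseudometric_on_def by blast
  assume c: "pm_continuous d I u"
  show ?R
  proof (intro ballI allI impI)
    fix p :: "real \<times> 's" and e :: real assume p: "p \<in> I \<times> UNIV" and e: "0 < e"
    have "openin (pm_topology (I \<times> UNIV) d) {x \<in> topspace (pm_topology (I \<times> UNIV) d). u x \<in> ball (u p) e}"
      using c[unfolded pm_continuous_def continuous_map_def, THEN conjunct2, rule_format, of "ball
        (u p) e"] by auto
    then obtain \<delta> where "\<delta> > 0" "\<forall>q\<in>I \<times> UNIV. d p q < \<delta> \<longrightarrow> q \<in> {x \<in> I \<times> UNIV. u x \<in> ball (u p) e}"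
      using p e unfolding openin_pm_topology by force
    then show "\<exists>\<delta>>0. \<forall>q\<in>I \<times> UNIV. d q p < \<delta> \<longrightarrow> dist (u q) (u p) < e"
      using sym p by (intro exI[of _ \<delta>]) (auto simp: dist_commute)
  qed
next
  have sym: "d p q = d q p" if "p \<in> I \<times> UNIV" "q \<in> I \<times> UNIV" for p q
    using assms that unfolding pseudometric_on_def by blast
  assume R: ?R
  show "pm_continuous d I u"
    unfolding pm_continuous_def continuous_map_def
  proof (intro conjI allI impI)
    fix U :: "'e set" assume "openin euclidean U"
    then have U: "open U" by simp
    show "openin (pm_topology (I \<times> UNIV) d) {x \<in> topspace (pm_topology (I \<times> UNIV) d). u x \<in> U}"
      unfolding openin_pm_topology
    proof (intro conjI ballI)
      fix p assume p: "p \<in> {x \<in> topspace (pm_topology (I \<times> UNIV) d). u x \<in> U}"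
      then obtain e where e: "e > 0" "ball (u p) e \<subseteq> U"
        using U open_contains_ball by blast
      from R p e(1) obtain \<delta> where "\<delta> > 0" "\<forall>q\<in>I \<times> UNIV. d q p < \<delta> \<longrightarrow> dist (u q) (u p) < e"
        by (metis (no_types, lifting) mem_Collect_eq topspace_pm_topology)
      then show "\<exists>\<delta>>0. \<forall>q\<in>I \<times> UNIV. d p q < \<delta> \<longrightarrow> q \<in> {x \<in> topspace (pm_topology (I \<times> UNIV) d). u x \<in> U}"
        using sym p e by (intro exI[of _ \<delta>]) (force simp: dist_commute subset_eq)
    qed auto
  qed auto
qed

text \<open>With \<open>R = (\<lambda>_ _. True)\<close> this is continuity, with \<open>R = (\<le>)\<close> it is right-continuity.\<close>

definition rel_continuous ::
  "(real \<Rightarrow> real \<Rightarrow> bool) \<Rightarrow> (real \<times> 's \<Rightarrow> real \<times> 's \<Rightarrow> real) \<Rightarrow> real set \<Rightarrow>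
   (real \<times> 's \<Rightarrow> 'e::real_normed_vector) \<Rightarrow> bool" where
  "rel_continuous R d I u \<longleftrightarrow>
     (\<forall>p\<in>I \<times> UNIV. \<forall>q. (\<forall>n::nat. q n \<in> I \<times> UNIV \<and> R (fst p) (fst (q n))) \<longrightarrow>
        (\<lambda>n. d (q n) p) \<longlonglongrightarrow> 0 \<longrightarrow> (\<lambda>n. u (q n)) \<longlonglongrightarrow> u p)"

text \<open>Balls of radius \<open>1 / Suc n\<close> turn a failure of the epsilon-delta condition
  into a sequence. The sequential form suits dominated convergence, the other one is the link to
  \<open>pm_continuous\<close> and \<open>right_continuous\<close>.\<close>

lemma rel_continuous_iff:
  assumes "pseudometric_on (I \<times> UNIV) d"
  shows "rel_continuous R d I u \<longleftrightarrow>
    (\<forall>p\<in>I \<times> UNIV. \<forall>e>0. \<exists>\<delta>>0. \<forall>q\<in>I \<times> UNIV. R (fst p) (fst q) \<longrightarrow> d q p < \<delta> \<longrightarrow> norm (u q - u p) < e)"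
    (is "?L \<longleftrightarrow> ?R")
proof
  assume L: ?L
  show ?R
  proof (intro ballI allI impI, rule ccontr)
    fix p and e :: real assume p: "p \<in> I \<times> UNIV" and e: "0 < e"
      and "\<not> (\<exists>\<delta>>0. \<forall>q\<in>I \<times> UNIV. R (fst p) (fst q) \<longrightarrow> d q p < \<delta> \<longrightarrow> norm (u q - u p) < e)"
    then have neg: "\<exists>q\<in>I \<times> UNIV. R (fst p) (fst q) \<and> d q p < \<delta> \<and> \<not> norm (u q - u p) < e"
      if "\<delta> > 0" for \<delta> using that by meson
    have "\<exists>q. q \<in> I \<times> UNIV \<and> R (fst p) (fst q) \<and> d q p < 1 / real (Suc n) \<and> \<not> norm (u q - u p) < e" for n
      using neg[of "1 / real (Suc n)"] by auto
    then obtain q where q: "\<And>n. q n \<in> I \<times> UNIV \<and> R (fst p) (fst (q n)) \<and> d (q n) p < 1 / real (Suc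
      n) \<and> \<not> norm (u (q n) - u p) < e"
      by metis
    have "(\<lambda>n. d (q n) p) \<longlonglongrightarrow> 0"
    proof (rule tendsto_sandwich)
      show "\<forall>\<^sub>F n in sequentially. 0 \<le> d (q n) p"
        using assms q p unfolding pseudometric_on_def by (intro always_eventually allI) blast
      show "\<forall>\<^sub>F n in sequentially. d (q n) p \<le> 1 / real (Suc n)"
        using q by (auto intro!: always_eventually less_imp_le)
      show "(\<lambda>n. 1 / real (Suc n)) \<longlonglongrightarrow> 0"
        using LIMSEQ_inverse_real_of_nat by (simp add: inverse_eq_divide)
    qed auto
    then have "(\<lambda>n. u (q n)) \<longlonglongrightarrow> u p"
      using L p q unfolding rel_continuous_def by blast
    then have "\<forall>\<^sub>F n in sequentially. dist (u (q n)) (u p) < e"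
      using e by (rule tendstoD)
    then obtain n where "dist (u (q n)) (u p) < e"
      by (meson eventually_sequentially order_refl)
    then show False
      using q[of n] by (simp add: dist_norm)
  qed
next
  assume R: ?R
  show ?L
    unfolding rel_continuous_def
  proof (intro ballI allI impI)
    fix p q assume p: "p \<in> I \<times> UNIV" and q: "\<forall>n. q n \<in> I \<times> UNIV \<and> R (fst p) (fst (q n))"
      and l: "(\<lambda>n. d (q n) p) \<longlonglongrightarrow> 0"
    show "(\<lambda>n. u (q n)) \<longlonglongrightarrow> u p"
    proof (rule tendstoI)
      fix e :: real assume "e > 0"
      then obtain \<delta> where "\<delta> > 0" and \<delta>: "\<forall>q\<in>I \<times> UNIV. R (fst p) (fst q) \<longrightarrow> d q p < \<delta> \<longrightarrow> norm (u q - u p) < e"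
        using R p by blast
      have "\<forall>\<^sub>F n in sequentially. d (q n) p < \<delta>"
        using l \<open>\<delta> > 0\<close> by (rule order_tendstoD)
      then show "\<forall>\<^sub>F n in sequentially. dist (u (q n)) (u p) < e"
      proof (rule eventually_mono)
        fix n assume "d (q n) p < \<delta>"
        with \<delta> q show "dist (u (q n)) (u p) < e" unfolding dist_norm by blast
      qed
    qed
  qed
qed

lemma rel_continuous_True:
  "pseudometric_on (I \<times> UNIV) d \<Longrightarrow> rel_continuous (\<lambda>_ _. True) d I u \<longleftrightarrow> pm_continuous d I u"
  by (simp add: rel_continuous_iff pm_continuous_iff dist_norm)

lemma rel_continuous_le:
  "pseudometric_on (I \<times> UNIV) d \<Longrightarrow> rel_continuous (\<le>) d I u \<longleftrightarrow> right_continuous d I u"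
  by (simp add: rel_continuous_iff right_continuous_def Ball_def)

lemma rel_continuous_uniform_limit:
  assumes p: "pseudometric_on (I \<times> UNIV) d"
    and c: "\<And>n. rel_continuous R d I (v n)"
    and b: "\<And>n p. p \<in> I \<times> UNIV \<Longrightarrow> norm (v n p - u p) \<le> B n" and B: "B \<longlonglongrightarrow> (0::real)"
  shows "rel_continuous R d I u"
  unfolding rel_continuous_iff[OF p]
proof (intro ballI allI impI)
  fix p :: "real \<times> 'a" and e :: real assume p: "p \<in> I \<times> UNIV" and e: "0 < e"
  have "\<forall>\<^sub>F n in sequentially. B n < e / 3"
    using B e by (intro order_tendstoD) auto
  then obtain n where n: "B n < e / 3" by (auto simp: eventually_sequentially)
  have "e / 3 > 0" using e by simp
  with c[of n] p obtain \<delta> where \<delta>: "\<delta> > 0"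
    "\<forall>q\<in>I \<times> UNIV. R (fst p) (fst q) \<longrightarrow> d q p < \<delta> \<longrightarrow> norm (v n q - v n p) < e / 3"
    unfolding rel_continuous_iff[OF assms(1)] by blast
  have "norm (u q - u p) < e" if "q \<in> I \<times> UNIV" "R (fst p) (fst q)" "d q p < \<delta>" for q
  proof -
    have "u q - u p = (v n q - v n p) - (v n q - u q) + (v n p - u p)" by simp
    then have "norm (u q - u p) \<le> norm (v n q - v n p) + norm (v n q - u q) + norm (v n p - u p)"
      by (metis add_right_mono norm_triangle_ineq norm_triangle_ineq4 order_trans)
    moreover have "norm (v n q - v n p) < e / 3" using \<delta> that by blast
    ultimately show ?thesis
      using b[OF p, of n] b[OF that(1), of n] n by linarith
  qed
  then show "\<exists>\<delta>>0. \<forall>q\<in>I \<times> UNIV. R (fst p) (fst q) \<longrightarrow> d q p < \<delta> \<longrightarrow> norm (u q - u p) < e"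
    using \<delta>(1) by blast
qed

section \<open>Functionals of the future of a Markov process\<close>

lemma space_generated_sigma [simp]: "space (generated_sigma \<Omega> X J) = space \<Omega>"
  unfolding generated_sigma_def by (rule space_measure_of) auto

lemma sets_generated_sigma:
  "sets (generated_sigma \<Omega> X J)
    = sigma_sets (space \<Omega>) {X s -` B \<inter> space \<Omega> | s B. s \<in> J \<and> B \<in> sets borel}"
  unfolding generated_sigma_def by (rule sets_measure_of) auto

section \<open>Cylinder events as an intersection-stable generator\<close>

definition cylinders ::
  "'w measure \<Rightarrow> (real \<Rightarrow> 'w \<Rightarrow> 's::topological_space) \<Rightarrow> real set \<Rightarrow> 'w set set" where
  "cylinders \<Omega> X J = {{\<omega> \<in> space \<Omega>. \<forall>s\<in>K. X s \<omega> \<in> B s} | K B.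
     finite K \<and> K \<subseteq> J \<and> (\<forall>s. B s \<in> sets borel)}"

lemma Int_stable_cylinders: "Int_stable (cylinders \<Omega> X J)"
proof (rule Int_stableI)
  fix a b assume "a \<in> cylinders \<Omega> X J" "b \<in> cylinders \<Omega> X J"
  then obtain K B K' B' where a: "a = {\<omega> \<in> space \<Omega>. \<forall>s\<in>K. X s \<omega> \<in> B s}" "finite K" "K \<subseteq> J" "\<forall>s. B s
    \<in> sets borel"
    and b: "b = {\<omega> \<in> space \<Omega>. \<forall>s\<in>K'. X s \<omega> \<in> B' s}" "finite K'" "K' \<subseteq> J" "\<forall>s. B' s \<in> sets borel"
    unfolding cylinders_def by blast
  \<comment> \<open>A time constrained by only one of the two cylinders receives the trivial
    constraint \<open>UNIV\<close> from the other.\<close>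
  define C where "C s = (if s \<in> K then B s else UNIV) \<inter> (if s \<in> K' then B' s else UNIV)" for s
  have "a \<inter> b = {\<omega> \<in> space \<Omega>. \<forall>s\<in>K \<union> K'. X s \<omega> \<in> C s}"
    unfolding a b C_def by auto
  moreover have "\<forall>s. C s \<in> sets borel" using a b by (auto simp: C_def)
  ultimately show "a \<inter> b \<in> cylinders \<Omega> X J"
    unfolding cylinders_def using a b by (intro CollectI exI[of _ "K \<union> K'"] exI[of _ C]) auto
qed

lemma sets_generated_sigma_cylinders:
  "sets (generated_sigma \<Omega> X J) = sigma_sets (space \<Omega>) (cylinders \<Omega> X J)"
  unfolding sets_generated_sigma
proof (rule sigma_sets_eqI)
  fix a assume "a \<in> {X s -` B \<inter> space \<Omega> | s B. s \<in> J \<and> B \<in> sets borel}"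
  then obtain s B where "a = {\<omega> \<in> space \<Omega>. \<forall>s\<in>{s}. X s \<omega> \<in> B}" "s \<in> J" "B \<in> sets borel" by auto
  then have "a \<in> cylinders \<Omega> X J"
    unfolding cylinders_def by (intro CollectI exI[of _ "{s}"] exI[of _ "\<lambda>_. B"]) auto
  then show "a \<in> sigma_sets (space \<Omega>) (cylinders \<Omega> X J)" ..
next
  let ?S = "{X s -` B \<inter> space \<Omega> | s B. s \<in> J \<and> B \<in> sets borel}"
  fix b assume "b \<in> cylinders \<Omega> X J"
  then obtain K B where b: "b = {\<omega> \<in> space \<Omega>. \<forall>s\<in>K. X s \<omega> \<in> B s}" "finite K" "K \<subseteq> J" "\<forall>s. B s \<in> sets borel"
    unfolding cylinders_def by blast
  interpret sigma_algebra "space \<Omega>" "sigma_sets (space \<Omega>) ?S"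
    by (rule sigma_algebra_sigma_sets) auto
  have *: "{\<omega> \<in> space \<Omega>. X s \<omega> \<in> B s} \<in> sigma_sets (space \<Omega>) ?S" if "s \<in> K" for s
  proof (rule sigma_sets.Basic)
    have "{\<omega> \<in> space \<Omega>. X s \<omega> \<in> B s} = X s -` B s \<inter> space \<Omega>" by blast
    then show "{\<omega> \<in> space \<Omega>. X s \<omega> \<in> B s} \<in> ?S" using that b by blast
  qed
  show "b \<in> sigma_sets (space \<Omega>) ?S"
    unfolding b(1) by (rule sets_Collect_finite_All[OF * b(2)])
qed

section \<open>The Markov setting and the single-time Markov property\<close>

locale markov_setting =
  fixes T :: real
    and d :: "real \<times> 's::{metric_space, second_countable_topology} \<Rightarrow> real \<times> 's \<Rightarrow> real"
    and \<Omega> :: "'w measure" and F :: "real \<Rightarrow> 'w measure"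
    and X :: "real \<Rightarrow> 'w \<Rightarrow> 's" and P :: "real \<Rightarrow> 's \<Rightarrow> 'w measure"
  assumes T_pos: "0 < T"
    and pseudometric: "pseudometric_on ({0..T} \<times> UNIV) d"
    and coarser: "coarser_than_product T d"
    and time_cont: "time_continuous T d"
    and markov: "markov_process T d \<Omega> F X P"
begin

abbreviation "MT \<equiv> pm_borel ({0..T} \<times> UNIV) d"

abbreviation "slab t \<equiv> restrict_space MT ({0..t} \<times> UNIV)"

lemma pseudometric_slab: "I \<subseteq> {0..T} \<Longrightarrow> pseudometric_on (I \<times> UNIV) d"
  using pseudometric by (rule pseudometric_on_subset) auto

text \<open>This rests on \<open>time_continuous\<close>: for a pseudometric blind to time the
  strips \<open>{0..t} \<times> UNIV\<close> need not be measurable.\<close>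

lemma measurable_fst_MT [measurable]: "fst \<in> borel_measurable MT"
  using time_cont unfolding time_continuous_def continuous_map_def
  by (intro borel_measurableI) (auto simp: sets_pm_borel vimage_def Int_def conj_commute)

lemma slab_sets: "A \<in> sets borel \<Longrightarrow> A \<inter> {0..T} = A' \<Longrightarrow> A' \<times> UNIV \<in> sets MT"
proof -
  assume "A \<in> sets borel" "A \<inter> {0..T} = A'"
  moreover from this have "fst -` A \<inter> space MT \<in> sets MT"
    using measurable_fst_MT by (intro measurable_sets) auto
  moreover have "fst -` A \<inter> space MT = (A \<inter> {0..T}) \<times> UNIV" by auto
  ultimately show ?thesis by simp
qed

lemma slab_Int: "({0..t} \<times> UNIV) \<inter> space MT \<in> sets MT"
proof -
  have "({0..t} \<times> UNIV) \<inter> space MT = ({0..t} \<inter> {0..T}) \<times> UNIV" by auto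
  then show ?thesis using slab_sets[of "{0..t}"] by simp
qed

lemma consistent:
  fixes u :: "real \<times> 's \<Rightarrow> 'b::t1_space"
  assumes "u \<in> borel_measurable MT" "p \<in> {0..T} \<times> UNIV" "q \<in> {0..T} \<times> UNIV" "d p q = 0"
  shows "u p = u q"
  using pm_borel_measurable_consistent[OF pseudometric assms] .

text \<open>Sets open for \<open>d\<close> are open in the product topology, and second countability
  of the state space makes a pair of Borel maps Borel for that topology. This is how the process
  enters the sigma-algebra of \<open>d\<close>.\<close>

lemma measurable_Pair_MT:
  assumes [measurable]: "Y \<in> borel_measurable N" "Z \<in> borel_measurable N"
    and Y: "\<And>\<omega>. \<omega> \<in> space N \<Longrightarrow> Y \<omega> \<in> {0..T}"
  shows "(\<lambda>\<omega>. (Y \<omega>, Z \<omega>)) \<in> N \<rightarrow>\<^sub>M MT"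
  unfolding pm_borel_def
proof (rule measurable_measure_of)
  fix U assume "U \<in> {U. openin (pm_topology ({0..T} \<times> UNIV) d) U}"
  then have "openin (top_of_set ({0..T} \<times> UNIV)) U"
    using coarser unfolding coarser_than_product_def by blast
  then obtain V where V: "open V" "U = ({0..T} \<times> UNIV) \<inter> V"
    by (auto simp: openin_open)
  have "(\<lambda>\<omega>. (Y \<omega>, Z \<omega>)) \<in> borel_measurable N" by measurable
  then have "(\<lambda>\<omega>. (Y \<omega>, Z \<omega>)) -` V \<inter> space N \<in> sets N"
    by (rule measurable_sets) (use V in auto)
  moreover have "(\<lambda>\<omega>. (Y \<omega>, Z \<omega>)) -` U \<inter> space N = (\<lambda>\<omega>. (Y \<omega>, Z \<omega>)) -` V \<inter> space N"
    using Y V by auto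
  ultimately show "(\<lambda>\<omega>. (Y \<omega>, Z \<omega>)) -` U \<inter> space N \<in> sets N" by simp
next
  show "(\<lambda>\<omega>. (Y \<omega>, Z \<omega>)) \<in> space N \<rightarrow> {0..T} \<times> UNIV" using Y by auto
  show "{U. openin (pm_topology ({0..T} \<times> UNIV) d) U} \<subseteq> Pow ({0..T} \<times> UNIV)"
    unfolding openin_pm_topology by blast
qed

lemma measurable_section: "s \<in> {0..T} \<Longrightarrow> (\<lambda>y. (s, y)) \<in> borel \<rightarrow>\<^sub>M MT"
  by (rule measurable_Pair_MT) auto

lemma subalgebra_F: "t \<in> {0..T} \<Longrightarrow> subalgebra \<Omega> (F t)"
  using markov unfolding markov_process_def by blast

lemma sets_F_mono: "s \<in> {0..T} \<Longrightarrow> t \<in> {0..T} \<Longrightarrow> s \<le> t \<Longrightarrow> sets (F s) \<subseteq> sets (F t)"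
  using markov unfolding markov_process_def by blast

lemma measurable_X_F: "t \<in> {0..T} \<Longrightarrow> X t \<in> F t \<rightarrow>\<^sub>M borel"
  using markov unfolding markov_process_def by blast

lemma measurable_X: "t \<in> {0..T} \<Longrightarrow> X t \<in> \<Omega> \<rightarrow>\<^sub>M borel"
  using measurable_X_F subalgebra_F measurable_from_subalg by blast

lemma prob_space_P: "r \<in> {0..T} \<Longrightarrow> prob_space (P r x)"
  and sets_P: "r \<in> {0..T} \<Longrightarrow> sets (P r x) = sets \<Omega>"
  using markov unfolding markov_process_def by blast+

lemma space_P: "r \<in> {0..T} \<Longrightarrow> space (P r x) = space \<Omega>"
  using sets_P by (rule sets_eq_imp_space_eq)

lemma measurable_P: "r \<in> {0..T} \<Longrightarrow> measurable (P r x) N = measurable \<Omega> N"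
  using sets_P by (intro measurable_cong_sets) auto

lemma initial: "s \<in> {0..T} \<Longrightarrow> AE \<omega> in P s y. d (s, X s \<omega>) (s, y) = 0"
proof -
  assume s: "s \<in> {0..T}"
  then have "AE \<omega> in P s y. \<forall>r\<in>{0..s}. d (r, X r \<omega>) (r, y) = 0"
    using markov unfolding markov_process_def by blast
  then show ?thesis by eventually_elim (use s in auto)
qed

lemma measurable_transition:
  assumes "t \<in> {0..T}" "B \<in> sets borel"
  shows "(\<lambda>p. measure (P (fst p) (snd p)) (X t -` B \<inter> space \<Omega>)) \<in> borel_measurable (slab t)"
proof -
  have "pm_measurable d {0..t} (\<lambda>(s, x). measure (P s x) (X t -` B \<inter> space \<Omega>))"
    using markov assms unfolding markov_process_def by blast
  then show ?thesis
    unfolding pm_measurable_def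
    by (subst (asm) measurable_pm_borel_subset[OF pseudometric]) (use assms in \<open>auto simp: case_prod_beta'\<close>)
qed

lemma markov_property:
  assumes "0 \<le> r" "r \<le> s" "s \<le> t" "t \<le> T" "B \<in> sets borel"
  shows "AE \<omega> in P r x. real_cond_exp (P r x) (F s) (indicator (X t -` B \<inter> space \<Omega>)) \<omega>
      = measure (P s (X s \<omega>)) (X t -` B \<inter> space \<Omega>)"
  using markov assms unfolding markov_process_def by blast

lemma progressive_backward:
  assumes "t \<in> {0..T}"
  shows "(\<lambda>(s, \<omega>). X s \<omega>) \<in>
    restrict_space borel {t..T} \<Otimes>\<^sub>M generated_sigma \<Omega> X {t..T} \<rightarrow>\<^sub>M borel"
  using markov assms unfolding markov_process_def by blast

lemma space_slab: "t \<in> {0..T} \<Longrightarrow> space (slab t) = {0..t} \<times> UNIV"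
  by (auto simp: space_restrict_space)

lemma measurable_slab_mono:
  assumes "f \<in> measurable (slab t) N" "s \<le> t"
  shows "f \<in> measurable (slab s) N"
proof -
  have "restrict_space (slab t) ({0..s} \<times> UNIV) = slab s"
  proof -
    have "({0..t} \<times> UNIV) \<inter> ({0..s} \<times> (UNIV::'s set)) = {0..s} \<times> UNIV" using assms(2) by auto
    then show ?thesis
      using restrict_restrict_space[of "{0..t} \<times> UNIV" MT "{0..s} \<times> UNIV", OF slab_Int slab_Int] by simp
  qed
  then show ?thesis using measurable_restrict_space1[OF assms(1), of "{0..s} \<times> UNIV"] by simp
qed

text \<open>In kernel form, measurability in the starting point passes from the probabilities of
  single events to integrals of arbitrary nonnegative Borel functions.\<close>

lemma measurable_transition_kernel:
  assumes "t \<in> {0..T}"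
  shows "(\<lambda>p. distr (P (fst p) (snd p)) borel (X t)) \<in> slab t \<rightarrow>\<^sub>M prob_algebra borel"
proof (rule measurable_prob_algebra_generated[of borel UNIV "sets borel"])
  show "sets borel = sigma_sets UNIV (sets borel :: 's set set)"
    using sets.sigma_sets_eq[of "borel :: 's measure"] by simp
  show "Int_stable (sets borel :: 's set set)" by (rule sets.Int_stable)
  fix p assume p: "p \<in> space (slab t)"
  then have r: "fst p \<in> {0..T}" using assms by (auto simp: space_slab)
  interpret prob_space "P (fst p) (snd p)" using r by (rule prob_space_P)
  show "prob_space (distr (P (fst p) (snd p)) borel (X t))"
    by (rule prob_space_distr) (simp add: measurable_P[OF r] measurable_X[OF assms])
next
  fix A :: "'s set" assume A: "A \<in> sets borel"
  have "(\<lambda>p. ennreal (measure (P (fst p) (snd p)) (X t -` A \<inter> space \<Omega>))) \<in> borel_measurable (slab t)"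
    using measurable_transition[OF assms A] by measurable
  moreover have "emeasure (distr (P (fst p) (snd p)) borel (X t)) A
    = ennreal (measure (P (fst p) (snd p)) (X t -` A \<inter> space \<Omega>))"
    if "p \<in> {0..t} \<times> UNIV" for p
  proof -
    have r: "fst p \<in> {0..T}" using that assms by auto
    interpret prob_space "P (fst p) (snd p)" using r by (rule prob_space_P)
    show ?thesis
      by (subst emeasure_distr)
         (auto simp: measurable_P[OF r] measurable_X[OF assms] A space_P[OF r] emeasure_eq_measure)
  qed
  ultimately show "(\<lambda>p. emeasure (distr (P (fst p) (snd p)) borel (X t)) A) \<in> borel_measurable (slab t)"
    by (subst measurable_cong) (auto simp: space_slab[OF assms])
qed auto

lemma measurable_nn_transition:
  assumes "t \<in> {0..T}" "\<phi> \<in> borel_measurable borel"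
  shows "(\<lambda>p. \<integral>\<^sup>+\<omega>. \<phi> (X t \<omega>) \<partial>P (fst p) (snd p)) \<in> borel_measurable (slab t)"
proof -
  have "(\<lambda>p. \<integral>\<^sup>+y. \<phi> y \<partial>distr (P (fst p) (snd p)) borel (X t)) \<in> borel_measurable (slab t)"
    using measurable_compose[OF measurable_prob_algebraD[OF measurable_transition_kernel[OF
      assms(1)]] nn_integral_measurable_subprob_algebra[OF assms(2)]] .
  then show ?thesis
    by (rule measurable_cong[THEN iffD1, rotated])
       (use assms in \<open>auto simp: space_slab nn_integral_distr measurable_P measurable_X\<close>)
qed

lemma measurable_nn_transition_section:
  assumes "s \<in> {0..T}" "t \<in> {0..T}" "s \<le> t" "\<phi> \<in> borel_measurable borel"
  shows "(\<lambda>y. \<integral>\<^sup>+\<omega>. \<phi> (X t \<omega>) \<partial>P s y) \<in> borel_measurable borel"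
proof -
  have "(\<lambda>y. (s, y)) \<in> borel \<rightarrow>\<^sub>M slab t"
    by (rule measurable_restrict_space2) (use assms measurable_section in auto)
  from measurable_compose[OF this measurable_nn_transition[OF assms(2,4)]] show ?thesis by simp
qed

text \<open>For an indicator this is the assumed Markov property integrated over \<open>A\<close>;
  sums, multiples and monotone limits do the rest. Conditional expectations have disappeared, so the
  identity can be iterated over several times.\<close>

lemma markov_nn_integral:
  assumes rst: "0 \<le> r" "r \<le> s" "s \<le> t" "t \<le> T" and A: "A \<in> sets (F s)"
    and \<phi>: "\<phi> \<in> borel_measurable (borel :: 's measure)"
  shows "(\<integral>\<^sup>+\<omega>. indicator A \<omega> * \<phi> (X t \<omega>) \<partial>P r x)
    = (\<integral>\<^sup>+\<omega>. indicator A \<omega> * (\<integral>\<^sup>+\<omega>'. \<phi> (X t \<omega>') \<partial>P s (X s \<omega>)) \<partial>P r x)"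
proof -
  have in0: "r \<in> {0..T}" "s \<in> {0..T}" "t \<in> {0..T}" using rst by auto
  interpret prob_space "P r x" using in0(1) by (rule prob_space_P)
  have sub: "subalgebra (P r x) (F s)"
    using subalgebra_F[OF in0(2)] sets_P[OF in0(1)] space_P[OF in0(1)] by (auto simp: subalgebra_def)
  have Xt: "X t \<in> P r x \<rightarrow>\<^sub>M borel" and Xs: "X s \<in> P r x \<rightarrow>\<^sub>M borel"
    using in0 by (auto simp: measurable_P measurable_X)
  note Xt[measurable] Xs[measurable]
  have A'[measurable]: "A \<in> sets (P r x)" using A sub by (auto simp: subalgebra_def)
  have m1: "(\<lambda>\<omega>. \<psi> (X t \<omega>)) \<in> borel_measurable (P s y)" if "\<psi> \<in> borel_measurable borel"
    for \<psi> :: "'s \<Rightarrow> ennreal" and y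
    using measurable_compose[OF measurable_X[OF in0(3)] that] by (simp add: measurable_P[OF in0(2)])
  have m2: "(\<lambda>\<omega>. \<integral>\<^sup>+\<omega>'. \<psi> (X t \<omega>') \<partial>P s (X s \<omega>)) \<in> borel_measurable (P r x)" if "\<psi>
    \<in> borel_measurable borel" for \<psi> :: "'s \<Rightarrow> ennreal"
    using measurable_compose[OF Xs measurable_nn_transition_section[OF in0(2,3) rst(3) that]] .
  show ?thesis
    using \<phi>
  proof induct
    case (cong f g)
    then show ?case by auto
  next
    case (set B)
    then have B[measurable]: "B \<in> sets borel" by simp
    let ?E = "X t -` B \<inter> space \<Omega>"
    have E: "?E \<in> sets (P r x)"
      using measurable_sets[OF Xt B] by (simp add: space_P[OF in0(1)])
    interpret sg: sigma_finite_subalgebra "P r x" "F s"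
      using sub by (intro finite_measure_subalgebra_is_sigma_finite) (unfold_locales, auto)
    have iA: "indicator A \<in> borel_measurable (F s)" using A by simp
    have int: "integrable (P r x) (\<lambda>\<omega>. indicator A \<omega> * indicator ?E \<omega> :: real)"
    proof (rule integrable_const_bound[of _ 1])
      show "AE \<omega> in P r x. norm (indicator A \<omega> * indicator ?E \<omega> :: real) \<le> 1"
        by (auto simp: indicator_def)
      show "(\<lambda>\<omega>. indicator A \<omega> * indicator ?E \<omega> :: real) \<in> borel_measurable (P r x)"
        using E by measurable
    qed
    have i1: "integrable (P r x) (\<lambda>\<omega>. indicator A \<omega> * real_cond_exp (P r x) (F s) (indicator ?E) \<omega>)"
      and i2: "(\<integral>\<omega>. indicator A \<omega> * real_cond_exp (P r x) (F s) (indicator ?E) \<omega> \<partial>P r x)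
        = (\<integral>\<omega>. indicator A \<omega> * indicator ?E \<omega> \<partial>P r x)"
      using sg.real_cond_exp_intg[OF int iA] E by auto
    have ae: "AE \<omega> in P r x. indicator A \<omega> * real_cond_exp (P r x) (F s) (indicator ?E) \<omega>
        = indicator A \<omega> * measure (P s (X s \<omega>)) ?E"
      using markov_property[OF rst B, of x] by eventually_elim simp
    have "(\<integral>\<^sup>+\<omega>. indicator A \<omega> * indicator B (X t \<omega>) \<partial>P r x)
        = (\<integral>\<^sup>+\<omega>. ennreal (indicator A \<omega> * indicator ?E \<omega>) \<partial>P r x)"
      by (rule nn_integral_cong) (auto simp: indicator_def space_P[OF in0(1)])
    also have "\<dots> = ennreal (\<integral>\<omega>. indicator A \<omega> * indicator ?E \<omega> \<partial>P r x)"
      by (rule nn_integral_eq_integral[OF int]) auto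
    also have "\<dots> = ennreal (\<integral>\<omega>. indicator A \<omega> * real_cond_exp (P r x) (F s) (indicator ?E) \<omega> \<partial>P r x)"
      by (simp add: i2)
    also have "\<dots> = (\<integral>\<^sup>+\<omega>. ennreal (indicator A \<omega> * real_cond_exp (P r x) (F s) (indicator ?E) \<omega>) \<partial>P r x)"
    proof (rule nn_integral_eq_integral[OF i1, symmetric])
      show "AE \<omega> in P r x. 0 \<le> indicator A \<omega> * real_cond_exp (P r x) (F s) (indicator ?E) \<omega>"
        using ae
      proof eventually_elim
        case (elim \<omega>)
        show ?case unfolding elim by simp
      qed
    qed
    also have "\<dots> = (\<integral>\<^sup>+\<omega>. ennreal (indicator A \<omega> * measure (P s (X s \<omega>)) ?E) \<partial>P r x)"
      by (rule nn_integral_cong_AE) (use ae in eventually_elim, simp only:)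
    also have "\<dots> = (\<integral>\<^sup>+\<omega>. indicator A \<omega> * (\<integral>\<^sup>+\<omega>'. indicator B (X t \<omega>') \<partial>P s (X s \<omega>)) \<partial>P r x)"
    proof (rule nn_integral_cong)
      fix \<omega>
      interpret Q: prob_space "P s (X s \<omega>)" using in0(2) by (rule prob_space_P)
      have "(\<integral>\<^sup>+\<omega>'. indicator B (X t \<omega>') \<partial>P s (X s \<omega>)) = (\<integral>\<^sup>+\<omega>'. indicator ?E \<omega>' \<partial>P s (X s \<omega>))"
        by (rule nn_integral_cong) (auto simp: indicator_def space_P[OF in0(2)])
      also have "\<dots> = ennreal (measure (P s (X s \<omega>)) ?E)"
        using E by (subst nn_integral_indicator) (auto simp: sets_P[OF in0(1)] sets_P[OF in0(2)]
          Q.emeasure_eq_measure)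
      finally show "ennreal (indicator A \<omega> * measure (P s (X s \<omega>)) ?E)
        = indicator A \<omega> * (\<integral>\<^sup>+\<omega>'. indicator B (X t \<omega>') \<partial>P s (X s \<omega>))"
        by (auto simp: indicator_def)
    qed
    finally show ?case .
  next
    case (mult \<psi> c)
    note [measurable] = mult(2)
    show ?case
      using mult(4) m1[OF mult(2)] m2[OF mult(2)]
      by (simp add: nn_integral_cmult mult.left_commute[of _ c])
  next
    case (add \<psi>1 \<psi>2)
    note [measurable] = add(1) add(4) m2[OF add(1)] m2[OF add(4)]
    show ?case
      using add(3,7) m1[OF add(1)] m1[OF add(4)]
      by (simp add: nn_integral_add distrib_left)
  next
    case (seq U)
    note [measurable] = seq(1) m2[OF seq(1)]
    have inc: "incseq (\<lambda>i \<omega>. U i (X t \<omega>))"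
      using seq(4) by (auto simp: incseq_def le_fun_def)
    have inc2: "incseq (\<lambda>i \<omega>. indicator A \<omega> * U i (X t \<omega>))"
      using seq(4) by (auto simp: incseq_def le_fun_def intro!: mult_left_mono)
    have inc3: "incseq (\<lambda>i \<omega>. indicator A \<omega> * (\<integral>\<^sup>+\<omega>'. U i (X t \<omega>') \<partial>P s (X s \<omega>)))"
      using seq(4) by (auto simp: incseq_def le_fun_def intro!: mult_left_mono nn_integral_mono)
    have "(\<integral>\<^sup>+\<omega>. indicator A \<omega> * (SUP i. U i) (X t \<omega>) \<partial>P r x)
        = (\<integral>\<^sup>+\<omega>. (SUP i. indicator A \<omega> * U i (X t \<omega>)) \<partial>P r x)"
      by (simp add: SUP_mult_left_ennreal image_comp)
    also have "\<dots> = (SUP i. \<integral>\<^sup>+\<omega>. indicator A \<omega> * U i (X t \<omega>) \<partial>P r x)"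
      using inc2 by (intro nn_integral_monotone_convergence_SUP) auto
    also have "\<dots> = (SUP i. \<integral>\<^sup>+\<omega>. indicator A \<omega> * (\<integral>\<^sup>+\<omega>'. U i (X t \<omega>') \<partial>P s (X s \<omega>)) \<partial>P r x)"
      using seq(3) by simp
    also have "\<dots> = (\<integral>\<^sup>+\<omega>. (SUP i. indicator A \<omega> * (\<integral>\<^sup>+\<omega>'. U i (X t \<omega>') \<partial>P s (X s \<omega>))) \<partial>P r x)"
      using inc3 by (intro nn_integral_monotone_convergence_SUP[symmetric]) auto
    also have "\<dots> = (\<integral>\<^sup>+\<omega>. indicator A \<omega> * (\<integral>\<^sup>+\<omega>'. (SUP i. U i) (X t \<omega>') \<partial>P s (X s \<omega>)) \<partial>P r x)"
    proof (rule nn_integral_cong)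
      fix \<omega>
      have "(\<integral>\<^sup>+\<omega>'. (SUP i. U i) (X t \<omega>') \<partial>P s (X s \<omega>)) = (SUP i. \<integral>\<^sup>+\<omega>'. U i (X t \<omega>') \<partial>P s (X s \<omega>))"
        unfolding SUP_apply using inc m1[OF seq(1)] by (intro nn_integral_monotone_convergence_SUP) auto
      then show "(SUP i. indicator A \<omega> * (\<integral>\<^sup>+\<omega>'. U i (X t \<omega>') \<partial>P s (X s \<omega>)))
        = indicator A \<omega> * (\<integral>\<^sup>+\<omega>'. (SUP i. U i) (X t \<omega>') \<partial>P s (X s \<omega>))"
        by (simp add: SUP_mult_left_ennreal)
    qed
    finally show ?case .
  qed
qed

text \<open>Seen from times before \<open>t\<close>, a finite-dimensional cylinder after \<open>t\<close> reduces to one time.\<close>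

lemma cylinder_reduction:
  assumes t: "0 \<le> t" and K: "finite K" and B: "\<And>s. B s \<in> sets borel"
    and "K \<subseteq> {t..T}" "v \<in> {t..T}" "\<And>s. s \<in> K \<Longrightarrow> s \<le> v" "\<phi> \<in> borel_measurable borel"
  shows "\<exists>\<tau>\<in>{t..T}. \<exists>\<psi>\<in>borel_measurable (borel :: 's measure). \<forall>r\<in>{0..t}. \<forall>x.
    (\<integral>\<^sup>+\<omega>. indicator {\<omega>\<in>space \<Omega>. \<forall>s\<in>K. X s \<omega> \<in> B s} \<omega> * \<phi> (X v \<omega>) \<partial>P r x) = (\<integral>\<^sup>+\<omega>. \<psi> (X \<tau> \<omega>) \<partial>P r x)"
  using K assms(4-)
proof (induct K arbitrary: v \<phi> rule: finite_linorder_max_induct)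
  case empty
  have "(\<integral>\<^sup>+\<omega>. indicator {\<omega>\<in>space \<Omega>. \<forall>s\<in>{}. X s \<omega> \<in> B s} \<omega> * \<phi> (X v \<omega>) \<partial>P r x) = (\<integral>\<^sup>+\<omega>. \<phi> (X v \<omega>) \<partial>P r x)"
    if "r \<in> {0..t}" for r x
    by (rule nn_integral_cong) (use that empty t in \<open>auto simp: space_P\<close>)
  then show ?case using empty by blast
next
  case (insert b A)
  \<comment> \<open>Conditioning at the latest time \<open>b\<close> turns everything from
    \<open>b\<close> on into one function of \<open>X b\<close>; what remains is a cylinder with
    fewer times, all of them before \<open>b\<close>.\<close>
  define \<psi> where "\<psi> y = indicator (B b) y * (\<integral>\<^sup>+\<omega>. \<phi> (X v \<omega>) \<partial>P b y)" for y
  have b: "b \<in> {t..T}" "b \<le> v" "v \<in> {t..T}" using insert by auto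
  have "\<psi> \<in> borel_measurable borel"
  proof -
    have "(\<lambda>y. \<integral>\<^sup>+\<omega>. \<phi> (X v \<omega>) \<partial>P b y) \<in> borel_measurable borel"
      by (rule measurable_nn_transition_section) (use b t insert(7) in auto)
    then show ?thesis unfolding \<psi>_def using B[of b] by measurable
  qed
  moreover have "A \<subseteq> {t..T}" "\<And>s. s \<in> A \<Longrightarrow> s \<le> b" using insert(2,4) by auto
  ultimately have "\<exists>\<tau>\<in>{t..T}. \<exists>\<psi>'\<in>borel_measurable (borel :: 's measure). \<forall>r\<in>{0..t}. \<forall>x.
    (\<integral>\<^sup>+\<omega>. indicator {\<omega>\<in>space \<Omega>. \<forall>s\<in>A. X s \<omega> \<in> B s} \<omega> * \<psi> (X b \<omega>) \<partial>P r x) = (\<integral>\<^sup>+\<omega>. \<psi>' (X \<tau> \<omega>) \<partial>P r x)"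
    by (intro insert(3) b(1))
  then obtain \<tau> \<psi>' where \<tau>: "\<tau>\<in>{t..T}" "\<psi>'\<in>borel_measurable borel"
    and eq: "\<And>r x. r \<in> {0..t} \<Longrightarrow> (\<integral>\<^sup>+\<omega>. indicator {\<omega>\<in>space \<Omega>. \<forall>s\<in>A. X s \<omega>
      \<in> B s} \<omega> * \<psi> (X b \<omega>) \<partial>P r x) = (\<integral>\<^sup>+\<omega>. \<psi>' (X \<tau> \<omega>) \<partial>P r x)"
    by blast
  let ?C = "{\<omega>\<in>space \<Omega>. \<forall>s\<in>insert b A. X s \<omega> \<in> B s}"
  have "(\<integral>\<^sup>+\<omega>. indicator ?C \<omega> * \<phi> (X v \<omega>) \<partial>P r x) = (\<integral>\<^sup>+\<omega>. \<psi>' (X \<tau> \<omega>) \<partial>P r x)" if r: "r \<in> {0..t}" for r x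
  proof -
    have FX: "{\<omega>\<in>space (F b). X s \<omega> \<in> B s} \<in> sets (F b)" if "s \<in> insert b A" for s
    proof -
      have s: "s \<in> {0..T}" "b \<in> {0..T}" "s \<le> b" using that insert t b by auto
      have "X s -` B s \<inter> space (F s) \<in> sets (F s)"
        using measurable_sets[OF measurable_X_F[OF s(1)] B] .
      moreover have "space (F s) = space (F b)" using s subalgebra_F by (auto simp: subalgebra_def)
      ultimately show ?thesis using sets_F_mono[OF s] by (auto simp: vimage_def Int_def conj_commute)
    qed
    have "{\<omega>\<in>space (F b). \<forall>s\<in>insert b A. X s \<omega> \<in> B s} \<in> sets (F b)"
      by (rule sets.sets_Collect_finite_All) (use FX insert(1) in auto)
    then have C: "?C \<in> sets (F b)"
      using subalgebra_F[of b] b t by (auto simp: subalgebra_def)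
    have "(\<integral>\<^sup>+\<omega>. indicator ?C \<omega> * \<phi> (X v \<omega>) \<partial>P r x)
      = (\<integral>\<^sup>+\<omega>. indicator ?C \<omega> * (\<integral>\<^sup>+\<omega>'. \<phi> (X v \<omega>') \<partial>P b (X b \<omega>)) \<partial>P r x)"
      by (rule markov_nn_integral) (use r b t C insert in auto)
    also have "\<dots> = (\<integral>\<^sup>+\<omega>. indicator {\<omega>\<in>space \<Omega>. \<forall>s\<in>A. X s \<omega> \<in> B s} \<omega> * \<psi> (X b \<omega>) \<partial>P r x)"
      by (rule nn_integral_cong) (auto simp: \<psi>_def indicator_def)
    finally show ?thesis using eq[OF r] by simp
  qed
  then show ?case using \<tau> by blast
qed

section \<open>Laws of the whole future after a fixed time\<close>

abbreviation "G t \<equiv> generated_sigma \<Omega> X {t..T}"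

text \<open>The restriction of \<open>P r x\<close> to the future. Taking the image under the
  identity produces a measure whose sigma-algebra is exactly \<open>G t\<close>, as the spaces of
  kernels demand.\<close>

abbreviation "law r x t \<equiv> distr (P r x) (G t) (\<lambda>\<omega>. \<omega>)"

lemma sets_G_subset: "t \<in> {0..T} \<Longrightarrow> sets (G t) \<subseteq> sets \<Omega>"
  unfolding sets_generated_sigma
  by (rule sets.sigma_sets_subset) (use measurable_X in \<open>auto intro!: measurable_sets\<close>)

lemma measurable_G_\<Omega>: "t \<in> {0..T} \<Longrightarrow> f \<in> measurable (G t) N \<Longrightarrow> f \<in> measurable \<Omega> N"
  using measurable_mono[of N N "G t" \<Omega>] sets_G_subset by auto

lemma measurable_X_G: "s \<in> {t..T} \<Longrightarrow> t \<in> {0..T} \<Longrightarrow> X s \<in> G t \<rightarrow>\<^sub>M borel"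
  unfolding measurable_def sets_generated_sigma by (auto intro!: sigma_sets.Basic)

lemma cylinder_single_time:
  assumes "t \<in> {0..T}" "C \<in> cylinders \<Omega> X {t..T}"
  obtains \<tau> \<psi> where "\<tau> \<in> {t..T}" "\<psi>\<in>borel_measurable (borel :: 's measure)"
    "\<And>r x. r \<in> {0..t} \<Longrightarrow> emeasure (P r x) C = (\<integral>\<^sup>+\<omega>. \<psi> (X \<tau> \<omega>) \<partial>P r x)"
proof -
  obtain K B where C: "C = {\<omega> \<in> space \<Omega>. \<forall>s\<in>K. X s \<omega> \<in> B s}" "finite K" "K \<subseteq> {t..T}" "\<And>s. B s \<in> sets borel"
    using assms unfolding cylinders_def by blast
  have "\<exists>\<tau>\<in>{t..T}. \<exists>\<psi>\<in>borel_measurable (borel :: 's measure). \<forall>r\<in>{0..t}. \<forall>x.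
    (\<integral>\<^sup>+\<omega>. indicator C \<omega> * 1 \<partial>P r x) = (\<integral>\<^sup>+\<omega>. \<psi> (X \<tau> \<omega>) \<partial>P r x)"
    unfolding C(1) by (rule cylinder_reduction[where v = T]) (use C assms in auto)
  moreover have "C \<in> sets \<Omega>"
    using assms sets_G_subset[OF assms(1)] unfolding sets_generated_sigma_cylinders by auto
  then have "(\<integral>\<^sup>+\<omega>. indicator C \<omega> * 1 \<partial>P r x) = emeasure (P r x) C" if "r \<in> {0..t}" for r x
    using that assms by (subst mult_1_right, subst nn_integral_indicator) (auto simp: sets_P)
  ultimately show ?thesis using that by (metis (no_types, lifting))
qed

lemma distr_G: "r \<in> {0..t} \<Longrightarrow> t \<in> {0..T} \<Longrightarrow> (\<lambda>\<omega>. \<omega>) \<in> P r x \<rightarrow>\<^sub>M G t"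
  using sets_G_subset[of t] by (subst measurable_P) (auto simp: measurable_def Int_absorb2 dest:
    sets.sets_into_space)

text \<open>The mass of a cylinder is an expectation at one single time, by
  \<open>cylinder_single_time\<close>, hence measurable in the starting point. Cylinders are stable
  under intersection and generate \<open>G t\<close>, so this is enough for the whole
  kernel.\<close>

lemma measurable_kernel_G:
  assumes t: "t \<in> {0..T}"
  shows "(\<lambda>p. law (fst p) (snd p) t) \<in> slab t \<rightarrow>\<^sub>M prob_algebra (G t)"
proof (rule measurable_prob_algebra_generated[OF sets_generated_sigma_cylinders Int_stable_cylinders])
  show "cylinders \<Omega> X {t..T} \<subseteq> Pow (space \<Omega>)" by (auto simp: cylinders_def)
  fix p assume p: "p \<in> space (slab t)"
  then have r: "fst p \<in> {0..t}" using assms by (auto simp: space_slab)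
  then interpret prob_space "P (fst p) (snd p)" using t by (intro prob_space_P) auto
  show "prob_space (law (fst p) (snd p) t)"
    using distr_G[OF r t] by (rule prob_space_distr)
next
  fix C assume C: "C \<in> cylinders \<Omega> X {t..T}"
  then have CG: "C \<in> sets (G t)" unfolding sets_generated_sigma_cylinders by auto
  obtain \<tau> \<psi> where \<tau>: "\<tau> \<in> {t..T}" "\<psi>\<in>borel_measurable (borel :: 's measure)"
    and eq: "\<And>r x. r \<in> {0..t} \<Longrightarrow> emeasure (P r x) C = (\<integral>\<^sup>+\<omega>. \<psi> (X \<tau> \<omega>) \<partial>P r x)"
    using cylinder_single_time[OF t C] by blast
  have "(\<lambda>p. \<integral>\<^sup>+\<omega>. \<psi> (X \<tau> \<omega>) \<partial>P (fst p) (snd p)) \<in> borel_measurable (slab t)"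
    by (rule measurable_slab_mono[OF measurable_nn_transition]) (use \<tau> t in auto)
  moreover have "emeasure (law (fst p) (snd p) t) C = (\<integral>\<^sup>+\<omega>. \<psi> (X \<tau> \<omega>) \<partial>P (fst p) (snd p))"
    if "p \<in> {0..t} \<times> UNIV" for p
  proof -
    have r: "fst p \<in> {0..t}" using that by auto
    have "C \<inter> space (P (fst p) (snd p)) = C"
      using sets.sets_into_space[OF CG] space_P[of "fst p" "snd p"] r t by auto
    then have "emeasure (law (fst p) (snd p) t) C = emeasure (P (fst p) (snd p)) C"
      by (subst emeasure_distr[OF distr_G[OF r t] CG]) simp
    then show ?thesis using eq[OF r] by simp
  qed
  ultimately show "(\<lambda>p. emeasure (law (fst p) (snd p) t) C) \<in> borel_measurable (slab t)"
    by (subst measurable_cong) (auto simp: space_slab[OF t])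
qed auto

lemma measurable_expectation_G:
  fixes Y :: "'w \<Rightarrow> 'b::{banach, second_countable_topology}"
  assumes t: "t \<in> {0..T}" and Y: "Y \<in> borel_measurable (G t)"
  shows "(\<lambda>p. \<integral>\<omega>. Y \<omega> \<partial>P (fst p) (snd p)) \<in> borel_measurable (slab t)"
proof -
  have "(\<lambda>p. \<integral>\<omega>. Y \<omega> \<partial>law (fst p) (snd p) t) \<in> borel_measurable (slab t)"
    using measurable_compose[OF measurable_prob_algebraD[OF measurable_kernel_G[OF t]]
      integral_measurable_subprob_algebra[OF Y]] .
  then show ?thesis
    by (rule measurable_cong[THEN iffD1, rotated])
       (use t in \<open>auto simp: space_slab integral_distr[OF distr_G Y]\<close>)
qed

lemma measurable_X_slab:
  assumes "r \<in> {0..T}" "t \<in> {0..T}"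
  shows "(\<lambda>\<omega>. (t, X t \<omega>)) \<in> P r x \<rightarrow>\<^sub>M slab t"
proof (rule measurable_restrict_space2)
  show "(\<lambda>\<omega>. (t, X t \<omega>)) \<in> P r x \<rightarrow>\<^sub>M MT"
    by (rule measurable_Pair_MT) (use assms in \<open>auto simp: measurable_P measurable_X\<close>)
qed (use assms in auto)

lemma measurable_law_X:
  assumes "r \<in> {0..T}" "t \<in> {0..T}"
  shows "(\<lambda>\<omega>. law t (X t \<omega>) t) \<in> P r x \<rightarrow>\<^sub>M subprob_algebra (G t)"
  using measurable_compose[OF measurable_X_slab[OF assms] measurable_prob_algebraD[OF
    measurable_kernel_G[OF assms(2)]]]
  by simp

text \<open>This is the Markov property for the entire future. Both sides are finite measures on
  \<open>G t\<close>. On a cylinder both reduce to an expectation of the same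
  \<open>\<psi> (X \<tau>)\<close>, where the single-time property applies with the whole space as
  conditioning event.\<close>

lemma markov_kernel_G:
  assumes "0 \<le> r" "r \<le> t" "t \<le> T"
  shows "law r x t = P r x \<bind> (\<lambda>\<omega>. law t (X t \<omega>) t)"
proof -
  have t: "t \<in> {0..T}" and r: "r \<in> {0..T}" and rt: "r \<in> {0..t}" using assms by auto
  note k = measurable_law_X[OF r t]
  interpret prob_space "P r x" using r by (rule prob_space_P)
  have CP: "cylinders \<Omega> X {t..T} \<subseteq> Pow (space \<Omega>)" by (auto simp: cylinders_def)
  have sb: "sets (P r x \<bind> (\<lambda>\<omega>. law t (X t \<omega>) t)) = sets (G t)"
    by (rule sets_bind) (use not_empty in auto)
  have em: "emeasure (law s y t) C = emeasure (P s y) C"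
    if "s \<in> {0..t}" and CG: "C \<in> sets (G t)" for s y C
  proof -
    have "C \<inter> space (P s y) = C"
      using sets.sets_into_space[OF CG] space_P[of s y] that t by auto
    then show ?thesis by (subst emeasure_distr[OF distr_G[OF that(1) t] CG]) simp
  qed
  show ?thesis
  proof (rule measure_eqI_generator_eq[OF Int_stable_cylinders CP, where A = "\<lambda>_. space \<Omega>"])
    fix C assume C: "C \<in> cylinders \<Omega> X {t..T}"
    then have CG: "C \<in> sets (G t)" unfolding sets_generated_sigma_cylinders by auto
    obtain \<tau> \<psi> where \<tau>: "\<tau> \<in> {t..T}" "\<psi>\<in>borel_measurable (borel :: 's measure)"
      and eq: "\<And>r x. r \<in> {0..t} \<Longrightarrow> emeasure (P r x) C = (\<integral>\<^sup>+\<omega>. \<psi> (X \<tau> \<omega>) \<partial>P r x)"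
      using cylinder_single_time[OF t C] by blast
    have "emeasure (P r x \<bind> (\<lambda>\<omega>. law t (X t \<omega>) t)) C
        = (\<integral>\<^sup>+\<omega>. emeasure (law t (X t \<omega>) t) C \<partial>P r x)"
      by (rule emeasure_bind[OF not_empty k CG])
    also have "\<dots> = (\<integral>\<^sup>+\<omega>. indicator (space \<Omega>) \<omega> * (\<integral>\<^sup>+\<omega>'. \<psi> (X \<tau> \<omega>') \<partial>P t (X t \<omega>)) \<partial>P r x)"
      by (rule nn_integral_cong) (use t em CG eq in \<open>auto simp: space_P[OF r]\<close>)
    also have "\<dots> = (\<integral>\<^sup>+\<omega>. indicator (space \<Omega>) \<omega> * \<psi> (X \<tau> \<omega>) \<partial>P r x)"
    proof (rule markov_nn_integral[symmetric])
      show "space \<Omega> \<in> sets (F t)" using subalgebra_F[OF t] sets.top[of "F t"] by (auto simp: subalgebra_def)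
    qed (use assms \<tau> in auto)
    also have "\<dots> = emeasure (P r x) C"
      unfolding eq[OF rt] by (rule nn_integral_cong) (auto simp: space_P[OF r])
    finally show "emeasure (law r x t) C = emeasure (P r x \<bind> (\<lambda>\<omega>. law t (X t \<omega>) t)) C"
      using em[OF rt CG] by simp
  next
    show "range (\<lambda>_. space \<Omega>) \<subseteq> cylinders \<Omega> X {t..T}"
      unfolding cylinders_def by (auto intro!: exI[of _ "{}"] exI[of _ "\<lambda>_. {}"])
    show "emeasure (law r x t) (space \<Omega>) \<noteq> \<infinity>"
      using em[OF rt, of "space \<Omega>"] sets.top[of "G t"] emeasure_finite by simp
  qed (simp_all add: sb sets_generated_sigma_cylinders)
qed

lemma markov_expectation_G:
  fixes Y :: "'w \<Rightarrow> real"
  assumes rt: "0 \<le> r" "r \<le> t" "t \<le> T" and Y: "Y \<in> borel_measurable (G t)"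
    and bd: "\<And>\<omega>. \<omega> \<in> space \<Omega> \<Longrightarrow> \<bar>Y \<omega>\<bar> \<le> c"
  shows "(\<integral>\<omega>. Y \<omega> \<partial>P r x) = (\<integral>\<omega>. (\<integral>\<omega>'. Y \<omega>' \<partial>P t (X t \<omega>)) \<partial>P r x)"
proof -
  have t: "t \<in> {0..T}" and r: "r \<in> {0..T}" and r': "r \<in> {0..t}" "t \<in> {0..t}" using rt by auto
  interpret prob_space "P r x" using r by (rule prob_space_P)
  note k = measurable_law_X[OF r t]
  have "(\<integral>\<omega>. Y \<omega> \<partial>P r x) = (\<integral>\<omega>. Y \<omega> \<partial>law r x t)"
    by (rule integral_distr[OF distr_G[OF r'(1) t] Y, symmetric])
  also have "\<dots> = (\<integral>\<omega>. (\<integral>\<omega>'. Y \<omega>' \<partial>law t (X t \<omega>) t) \<partial>P r x)"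
    unfolding markov_kernel_G[OF rt]
  proof (rule integral_bind[OF Y _ k, where B' = 1])
    show "finite_measure (P r x)" by unfold_locales
    show "AE \<omega> in P r x. emeasure (law t (X t \<omega>) t) (space (law t (X t \<omega>) t)) \<le> ennreal 1"
    proof (rule AE_I2)
      fix \<omega>
      interpret Q: prob_space "law t (X t \<omega>) t"
        using prob_space_P[OF t] distr_G[OF r'(2) t] by (rule prob_space.prob_space_distr)
      show "emeasure (law t (X t \<omega>) t) (space (law t (X t \<omega>) t)) \<le> ennreal 1"
        using Q.emeasure_space_1 by simp
    qed
  qed (use bd in auto)
  also have "\<dots> = (\<integral>\<omega>. (\<integral>\<omega>'. Y \<omega>' \<partial>P t (X t \<omega>)) \<partial>P r x)"
    by (simp add: integral_distr[OF distr_G[OF r'(2) t] Y])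
  finally show ?thesis .
qed

lemma measurable_expectation_G_X:
  fixes Y :: "'w \<Rightarrow> 'b::{banach, second_countable_topology}"
  assumes "r \<in> {0..T}" "t \<in> {0..T}" "Y \<in> borel_measurable (G t)"
  shows "(\<lambda>\<omega>. \<integral>\<omega>'. Y \<omega>' \<partial>P t (X t \<omega>)) \<in> borel_measurable (P r x)"
proof -
  from measurable_compose[OF measurable_X_slab[OF assms(1,2)] measurable_expectation_G[OF assms(2,3)]]
  show ?thesis by simp
qed

lemma integrable_P_bounded:
  fixes Y :: "'w \<Rightarrow> 'b::{banach, second_countable_topology}"
  assumes "r \<in> {0..T}" "Y \<in> borel_measurable \<Omega>" "\<And>\<omega>. \<omega> \<in> space \<Omega> \<Longrightarrow> norm (Y \<omega>) \<le> c"
  shows "integrable (P r x) Y"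
proof -
  interpret prob_space "P r x" using assms(1) by (rule prob_space_P)
  show ?thesis
    by (rule integrable_const_bound[of _ c]) (use assms in \<open>auto simp: measurable_P space_P\<close>)
qed

lemma expectation_bound:
  fixes Y :: "'w \<Rightarrow> 'b::{banach, second_countable_topology}"
  assumes r: "r \<in> {0..T}" and bd: "\<And>\<omega>. \<omega> \<in> space \<Omega> \<Longrightarrow> norm (Y \<omega>) \<le> c" and c: "0 \<le> c"
  shows "norm (\<integral>\<omega>. Y \<omega> \<partial>P r x) \<le> c"
proof -
  interpret prob_space "P r x" using r by (rule prob_space_P)
  show ?thesis
  proof (cases "integrable (P r x) Y")
    case True
    have "norm (\<integral>\<omega>. Y \<omega> \<partial>P r x) \<le> (\<integral>\<omega>. norm (Y \<omega>) \<partial>P r x)" by (rule integral_norm_bound)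
    also have "\<dots> \<le> c"
      by (rule integral_le_const) (use True bd in \<open>auto simp: space_P[OF r]\<close>)
    finally show ?thesis .
  \<comment> \<open>The integral of a non-integrable function is 0 by convention; therefore
    \<open>c\<close> is assumed nonnegative and no measurability of \<open>Y\<close> is asked
    for.\<close>
  qed (simp add: not_integrable_integral_eq c)
qed

text \<open>Coordinates commute with integrals of bounded measurable maps, so the scalar case
  applies to each of them.\<close>

lemma markov_expectation_G_vec:
  fixes Y :: "'w \<Rightarrow> real^'k"
  assumes rt: "0 \<le> r" "r \<le> t" "t \<le> T" and Y: "Y \<in> borel_measurable (G t)"
    and bd: "\<And>\<omega>. \<omega> \<in> space \<Omega> \<Longrightarrow> norm (Y \<omega>) \<le> c" and c: "0 \<le> c"
  shows "(\<integral>\<omega>. Y \<omega> \<partial>P r x) = (\<integral>\<omega>. (\<integral>\<omega>'. Y \<omega>' \<partial>P t (X t \<omega>)) \<partial>P r x)"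
proof (rule vec_eq_iff[THEN iffD2], rule allI)
  fix i
  have t: "t \<in> {0..T}" and r: "r \<in> {0..T}" using rt by auto
  have Y\<Omega>: "Y \<in> borel_measurable \<Omega>" using measurable_G_\<Omega>[OF t Y] .
  have 1: "(\<integral>\<omega>. Y \<omega> \<partial>P s y) $ i = (\<integral>\<omega>. Y \<omega> $ i \<partial>P s y)" if "s \<in> {0..T}" for s y
    by (rule integral_bounded_linear[OF bounded_linear_vec_nth, symmetric]) (rule
      integrable_P_bounded[OF that Y\<Omega> bd])
  have "(\<integral>\<omega>. Y \<omega> $ i \<partial>P r x) = (\<integral>\<omega>. (\<integral>\<omega>'. Y \<omega>' $ i \<partial>P t (X t \<omega>)) \<partial>P r x)"
  proof (rule markov_expectation_G[OF rt])
    show "(\<lambda>\<omega>. Y \<omega> $ i) \<in> borel_measurable (G t)"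
      using borel_measurable_continuous_onI[OF continuous_on_component[OF continuous_on_id]]
        measurable_compose[OF Y] by blast
    show "\<bar>Y \<omega> $ i\<bar> \<le> c" if "\<omega> \<in> space \<Omega>" for \<omega>
      using bd[OF that] component_le_norm_cart[of "Y \<omega>" i] by linarith
  qed
  also have "\<dots> = (\<integral>\<omega>. (\<integral>\<omega>'. Y \<omega>' \<partial>P t (X t \<omega>)) $ i \<partial>P r x)" using 1[OF t] by simp
  also have "\<dots> = (\<integral>\<omega>. (\<integral>\<omega>'. Y \<omega>' \<partial>P t (X t \<omega>)) \<partial>P r x) $ i"
  proof (rule integral_bounded_linear[OF bounded_linear_vec_nth])
    show "integrable (P r x) (\<lambda>\<omega>. \<integral>\<omega>'. Y \<omega>' \<partial>P t (X t \<omega>))"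
      by (rule integrable_P_bounded[OF r, of _ c])
         (use measurable_expectation_G_X[OF r t Y] expectation_bound[OF t bd c] in \<open>auto simp:
           measurable_P[OF r]\<close>)
  qed
  finally show "(\<integral>\<omega>. Y \<omega> \<partial>P r x) $ i = (\<integral>\<omega>. (\<integral>\<omega>'. Y \<omega>' \<partial>P t (X t \<omega>)) \<partial>P r x) $ i"
    using 1[OF r] by simp
qed

end

section \<open>Global solutions for bounded Lipschitz generators\<close>

lemma geometric_increments_convergent:
  fixes a :: "nat \<Rightarrow> 'a::banach"
  assumes "\<And>n. norm (a (Suc n) - a n) \<le> K / 2 ^ n"
  obtains l where "a \<longlonglongrightarrow> l" "\<And>n. norm (a n - l) \<le> 2 * K / 2 ^ n"
proof -
  have K: "0 \<le> K" using order_trans[OF norm_ge_zero assms[of 0]] by simp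
  \<comment> \<open>Keeping the exact remainder of the geometric sum lets the induction close;
    dropping the subtracted term afterwards gives the error bound.\<close>
  have tel: "norm (a (n + k) - a n) \<le> 2 * K / 2 ^ n - 2 * K / 2 ^ (n + k)" for n k
  proof (induct k)
    case (Suc k)
    have "norm (a (n + Suc k) - a n) \<le> norm (a (Suc (n + k)) - a (n + k)) + norm (a (n + k) - a n)"
      using norm_triangle_ineq[of "a (Suc (n + k)) - a (n + k)" "a (n + k) - a n"] by simp
    also have "\<dots> \<le> K / 2 ^ (n + k) + (2 * K / 2 ^ n - 2 * K / 2 ^ (n + k))"
      using assms[of "n + k"] Suc by linarith
    also have "\<dots> = 2 * K / 2 ^ n - 2 * K / 2 ^ (n + Suc k)" by simp
    finally show ?case .
  qed simp
  have le: "norm (a m - a n) \<le> 2 * K / 2 ^ n" if "n \<le> m" for m n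
  proof -
    have "0 \<le> 2 * K / 2 ^ m" using K by simp
    then show ?thesis using tel[of n "m - n"] that by simp
  qed
  have z: "(\<lambda>n. 2 * K / 2 ^ n) \<longlonglongrightarrow> 0"
    using tendsto_mult_left[OF LIMSEQ_power_zero[of "1/2::real"], of "2 * K"] by (simp add: power_divide)
  have "Cauchy a"
  proof (rule CauchyI')
    fix e :: real assume "0 < e"
    with z have "\<forall>\<^sub>F n in sequentially. 2 * K / 2 ^ n < e" by (intro order_tendstoD) auto
    then obtain M where M: "\<And>n. n \<ge> M \<Longrightarrow> 2 * K / 2 ^ n < e" by (auto simp: eventually_sequentially)
    have "norm (a m - a n) < e" if "M \<le> m" "m < n" for m n
      using le[of m n] M[of m] that by (simp add: norm_minus_commute)
    then show "\<exists>M. \<forall>m\<ge>M. \<forall>n>m. dist (a m) (a n) < e" unfolding dist_norm by blast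
  qed
  then obtain l where l: "a \<longlonglongrightarrow> l" using Cauchy_convergent_iff convergent_def by blast
  have "norm (a n - l) \<le> 2 * K / 2 ^ n" for n
  proof (rule LIMSEQ_le_const2)
    show "(\<lambda>m. norm (a n - a m)) \<longlonglongrightarrow> norm (a n - l)"
      using l by (intro tendsto_intros)
    show "\<exists>N. \<forall>m\<ge>N. norm (a n - a m) \<le> 2 * K / 2 ^ n"
      using le by (metis norm_minus_commute)
  qed
  then show ?thesis using that l by blast
qed

text \<open>The set \<open>D\<close> is absent here: \<open>h\<close> is defined for every
  \<open>w\<close>, so an iteration has no domain to leave. All information on the size of the
  original generator sits in \<open>\<nu>\<close>.\<close>

locale truncated_problem = markov_setting T d \<Omega> F X P
  for T :: real
    and d :: "real \<times> 's::{metric_space, second_countable_topology} \<Rightarrow> real \<times> 's \<Rightarrow> real"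
    and \<Omega> :: "'w measure" and F X P +
  fixes \<nu> :: "real measure" and g :: "'s \<Rightarrow> real^'k" and Bg :: real
    and h :: "real \<times> 's \<Rightarrow> real^'k \<Rightarrow> real^'k"
  assumes sets_\<nu>: "sets \<nu> = sets (restrict_space borel {0..T})"
    and finite_\<nu>: "finite_measure \<nu>"
    and null_points: "s \<in> {0..T} \<Longrightarrow> emeasure \<nu> {s} = 0"
    and g_measurable [measurable]: "g \<in> borel_measurable borel"
    and g_bound: "norm (g x) \<le> Bg"
    and h_measurable: "(\<lambda>(p, w). h p w) \<in> borel_measurable (MT \<Otimes>\<^sub>M borel)"
    and h_bound: "p \<in> {0..T} \<times> UNIV \<Longrightarrow> norm (h p w) \<le> 1"
    and h_Lipschitz: "p \<in> {0..T} \<times> UNIV \<Longrightarrow> norm (h p w - h p w') \<le> norm (w - w')"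
begin

sublocale N: finite_measure \<nu> by (rule finite_\<nu>)

lemma space_\<nu> [simp]: "space \<nu> = {0..T}"
  using sets_eq_imp_space_eq[OF sets_\<nu>] by (simp add: space_restrict_space)

lemma measurable_\<nu>: "measurable \<nu> N = measurable (restrict_space borel {0..T}) N"
  using sets_\<nu> by (rule measurable_cong_sets) simp

lemma Icc_sets: "{a..T} \<inter> {0..T} \<in> sets \<nu>"
  by (auto simp: sets_\<nu> sets_restrict_space)

lemma tail_sets: "t \<in> {0..T} \<Longrightarrow> {t..T} \<in> sets \<nu>"
proof -
  assume "t \<in> {0..T}"
  then have "{t..T} \<inter> {0..T} = {t..T}" by auto
  then show ?thesis using Icc_sets[of t] by argo
qed

lemma sets_\<nu>_Int: "A \<in> sets borel \<Longrightarrow> A \<inter> {0..T} \<in> sets \<nu>"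
  by (auto simp: sets_\<nu> sets_restrict_space)

lemma integrable_bounded:
  fixes \<phi> :: "real \<Rightarrow> 'b::{banach, second_countable_topology}"
  assumes "\<phi> \<in> borel_measurable \<nu>" "\<And>s. s \<in> {0..T} \<Longrightarrow> norm (\<phi> s) \<le> c"
  shows "integrable \<nu> \<phi>"
  by (rule N.integrable_const_bound[of _ c]) (use assms in auto)

lemma set_integrable_sub:
  fixes \<phi> :: "real \<Rightarrow> 'b::{banach, second_countable_topology}"
  assumes "integrable \<nu> \<phi>" "A \<in> sets borel"
  shows "set_integrable \<nu> A \<phi>"
proof -
  have "set_integrable \<nu> (A \<inter> {0..T}) \<phi>"
    unfolding set_integrable_def
    by (rule integrable_mult_indicator) (use assms sets_\<nu>_Int in auto)
  then show ?thesis
    unfolding set_integrable_def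
    by (rule Bochner_Integration.integrable_cong[THEN iffD1, rotated 2]) (auto simp: indicator_def)
qed

text \<open>For \<open>s\<close> different from \<open>t0\<close> the indicators are eventually
  constant, and the remaining point is discarded because \<open>\<nu>\<close> has no point
  masses.\<close>

lemma tail_integral_tendsto:
  fixes \<phi> :: "real \<Rightarrow> 'b::{banach, second_countable_topology}"
  assumes "integrable \<nu> \<phi>" and "t \<longlonglongrightarrow> t0" "t0 \<in> {0..T}"
  shows "(\<lambda>n. LINT s:{t n..T}|\<nu>. \<phi> s) \<longlonglongrightarrow> (LINT s:{t0..T}|\<nu>. \<phi> s)"
  unfolding set_lebesgue_integral_def
proof (rule integral_dominated_convergence[where w = "\<lambda>s. norm (\<phi> s)"])
  have "{t0} \<in> null_sets \<nu>"
    using assms null_points sets_\<nu>_Int[of "{t0}"] by (auto simp: null_sets_def)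
  then have "AE s in \<nu>. s \<notin> {t0}" by (rule AE_not_in)
  then show "AE s in \<nu>. (\<lambda>n. indicator {t n..T} s *\<^sub>R \<phi> s) \<longlonglongrightarrow> indicator {t0..T} s *\<^sub>R \<phi> s"
  proof eventually_elim
    case (elim s)
    have "\<forall>\<^sub>F n in sequentially. (t n \<le> s) = (t0 \<le> s)"
    proof (cases "t0 < s")
      case True
      with assms(2) have "\<forall>\<^sub>F n in sequentially. t n < s" by (intro order_tendstoD)
      then show ?thesis by eventually_elim (use True in auto)
    next
      case False
      then have "s < t0" using elim by auto
      with assms(2) have "\<forall>\<^sub>F n in sequentially. s < t n" by (intro order_tendstoD)
      then show ?thesis by eventually_elim (use False elim in auto)
    qed
    then have "\<forall>\<^sub>F n in sequentially. indicator {t n..T} s *\<^sub>R \<phi> s = indicator {t0..T} s *\<^sub>R \<phi> s"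
      by eventually_elim (auto simp: indicator_def)
    then show ?case by (rule tendsto_eventually)
  qed
  show "integrable \<nu> (\<lambda>s. norm (\<phi> s))" using assms(1) by simp
  show "(\<lambda>s. indicator {t0..T} s *\<^sub>R \<phi> s) \<in> borel_measurable \<nu>"
    using set_integrable_sub[OF assms(1), of "{t0..T}"] by (auto simp: set_integrable_def)
  show "(\<lambda>s. indicator {t n..T} s *\<^sub>R \<phi> s) \<in> borel_measurable \<nu>" for n
    using set_integrable_sub[OF assms(1), of "{t n..T}"] by (auto simp: set_integrable_def)
qed (auto simp: indicator_def)

text \<open>Progressive measurability with respect to the backward filtration leaves only
  \<open>G t\<close> on the sample space. Hence integrals along the path from \<open>t\<close> on
  are functionals of the future.\<close>

lemma measurable_joint_path:
  assumes t: "t \<in> {0..T}" and H: "H \<in> borel_measurable MT"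
  shows "(\<lambda>(\<omega>, s). H (s, X s \<omega>)) \<in> borel_measurable (G t \<Otimes>\<^sub>M restrict_space \<nu> {t..T})"
proof -
  have s: "sets (restrict_space \<nu> {t..T}) = sets (restrict_space borel {t..T})"
  proof -
    have "sets (restrict_space \<nu> {t..T}) = sets (restrict_space (restrict_space borel {0..T}) {t..T})"
      unfolding sets_restrict_space sets_\<nu> ..
    also have "\<dots> = sets (restrict_space borel ({0..T} \<inter> {t..T}))"
      by (subst restrict_restrict_space) auto
    also have "{0..T} \<inter> {t..T} = {t..T}" using t by auto
    finally show ?thesis .
  qed
  have sw: "(\<lambda>q. (snd q, fst q)) \<in> G t \<Otimes>\<^sub>M restrict_space borel {t..T} \<rightarrow>\<^sub>M restrict_space borel
    {t..T} \<Otimes>\<^sub>M G t"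
    by measurable
  have m2: "(\<lambda>q. X (snd q) (fst q)) \<in> G t \<Otimes>\<^sub>M restrict_space borel {t..T} \<rightarrow>\<^sub>M borel"
    using measurable_compose[OF sw progressive_backward[OF t]] by simp
  have m1: "snd \<in> borel_measurable (G t \<Otimes>\<^sub>M restrict_space borel {t..T})"
    by (rule measurable_compose[OF measurable_snd measurable_restrict_space1]) auto
  have "(\<lambda>q. (snd q, X (snd q) (fst q))) \<in> G t \<Otimes>\<^sub>M restrict_space borel {t..T} \<rightarrow>\<^sub>M MT"
    by (rule measurable_Pair_MT[OF m1 m2]) (use t in \<open>auto simp: space_pair_measure space_restrict_space\<close>)
  from measurable_compose[OF this H]
  have "(\<lambda>(\<omega>, s). H (s, X s \<omega>)) \<in> borel_measurable (G t \<Otimes>\<^sub>M restrict_space borel {t..T})"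
    by (simp add: case_prod_beta')
  also have "borel_measurable (G t \<Otimes>\<^sub>M restrict_space borel {t..T})
    = borel_measurable (G t \<Otimes>\<^sub>M restrict_space \<nu> {t..T})"
    by (intro measurable_cong_sets sets_pair_measure_cong) (simp_all add: s)
  finally show ?thesis .
qed

lemma measurable_joint_path_\<Omega>:
  assumes H: "H \<in> borel_measurable MT"
  shows "(\<lambda>(\<omega>, s). H (s, X s \<omega>)) \<in> borel_measurable (\<Omega> \<Otimes>\<^sub>M \<nu>)"
proof -
  have 0: "0 \<in> {0..T}" using T_pos by simp
  have "(\<lambda>q. q) \<in> \<Omega> \<Otimes>\<^sub>M \<nu> \<rightarrow>\<^sub>M G 0 \<Otimes>\<^sub>M restrict_space \<nu> {0..T}"
  proof -
    have "(\<lambda>\<omega>. \<omega>) \<in> \<Omega> \<rightarrow>\<^sub>M G 0" by (rule measurable_G_\<Omega>[OF 0]) simp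
    moreover have "(\<lambda>s. s) \<in> \<nu> \<rightarrow>\<^sub>M restrict_space \<nu> {0..T}"
      by (rule measurable_restrict_space2) auto
    ultimately have "(\<lambda>q. (fst q, snd q)) \<in> \<Omega> \<Otimes>\<^sub>M \<nu> \<rightarrow>\<^sub>M G 0 \<Otimes>\<^sub>M restrict_space \<nu> {0..T}"
      by (intro measurable_Pair measurable_compose[OF measurable_fst] measurable_compose[OF measurable_snd])
    then show ?thesis by simp
  qed
  from measurable_compose[OF this measurable_joint_path[OF 0 H]] show ?thesis by simp
qed

lemma measurable_path:
  assumes "H \<in> borel_measurable MT" "\<omega> \<in> space \<Omega>"
  shows "(\<lambda>s. H (s, X s \<omega>)) \<in> borel_measurable \<nu>"
  using measurable_compose[OF measurable_Pair1'[OF assms(2), of \<nu>] measurable_joint_path_\<Omega>[OF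
    assms(1)]] by simp

section \<open>The integral operator of the terminal equation\<close>

definition path_integral :: "(real \<times> 's \<Rightarrow> real^'k) \<Rightarrow> real \<Rightarrow> 'w \<Rightarrow> real^'k" where
  "path_integral H t \<omega> = (LINT s:{t..T}|\<nu>. H (s, X s \<omega>))"

lemma measurable_path_integral:
  assumes "t \<in> {0..T}" "H \<in> borel_measurable MT"
  shows "path_integral H t \<in> borel_measurable (G t)"
proof -
  interpret R: finite_measure "restrict_space \<nu> {t..T}"
    by (rule finite_measure_restrict_space[OF finite_\<nu> tail_sets[OF assms(1)]])
  have t: "{t..T} \<inter> space \<nu> \<in> sets \<nu>" using tail_sets[OF assms(1)] by (intro sets.Int sets.top)
  have "(\<lambda>\<omega>. \<integral>s. H (s, X s \<omega>) \<partial>restrict_space \<nu> {t..T}) \<in> borel_measurable (G t)"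
    by (rule R.borel_measurable_lebesgue_integral) (rule measurable_joint_path[OF assms])
  then show ?thesis
    unfolding path_integral_def set_lebesgue_integral_def
    by (subst (asm) integral_restrict_space[OF t])
qed

lemma path_integral_bound:
  assumes H: "H \<in> borel_measurable MT" and \<omega>: "\<omega> \<in> space \<Omega>" and r: "0 \<le> r"
    and \<phi>: "integrable \<nu> \<phi>" and bd: "\<And>s y. s \<in> {r..T} \<Longrightarrow> norm (H (s, y)) \<le> \<phi> s"
  shows "norm (path_integral H r \<omega>) \<le> (LINT s:{r..T}|\<nu>. \<phi> s)"
proof -
  have int\<phi>: "integrable \<nu> (\<lambda>s. indicator {r..T} s *\<^sub>R \<phi> s)"
    using set_integrable_sub[OF \<phi>, of "{r..T}"] by (simp add: set_integrable_def)
  have "norm (path_integral H r \<omega>) \<le> (\<integral>s. norm (indicator {r..T} s *\<^sub>R H (s, X s \<omega>)) \<partial>\<nu>)"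
    unfolding path_integral_def set_lebesgue_integral_def by (rule integral_norm_bound)
  also have "\<dots> \<le> (\<integral>s. indicator {r..T} s *\<^sub>R \<phi> s \<partial>\<nu>)"
  proof (rule integral_mono'[OF int\<phi>])
    fix s
    show "norm (indicator {r..T} s *\<^sub>R H (s, X s \<omega>)) \<le> indicator {r..T} s *\<^sub>R \<phi> s"
      using bd[of s "X s \<omega>"] by (auto simp: indicator_def)
    show "0 \<le> indicator {r..T} s *\<^sub>R \<phi> s"
      using order_trans[OF norm_ge_zero bd[of s undefined]] by (auto simp: indicator_def)
  qed
  finally show ?thesis by (simp add: set_lebesgue_integral_def)
qed

lemma path_integral_bound_1:
  assumes H: "H \<in> borel_measurable MT" and \<omega>: "\<omega> \<in> space \<Omega>" and r: "0 \<le> r"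
    and bd: "\<And>p. p \<in> {0..T} \<times> UNIV \<Longrightarrow> norm (H p) \<le> 1"
  shows "norm (path_integral H r \<omega>) \<le> measure \<nu> {0..T}"
proof -
  have "norm (path_integral H r \<omega>) \<le> (LINT s:{r..T}|\<nu>. 1)"
    by (rule path_integral_bound[OF H \<omega> r]) (use bd r in auto)
  also have "\<dots> = measure \<nu> ({r..T} \<inter> {0..T})"
    by (simp add: set_lebesgue_integral_def)
  also have "\<dots> \<le> measure \<nu> {0..T}"
    by (rule N.finite_measure_mono) (use sets_\<nu>_Int[of UNIV] in auto)
  finally show ?thesis .
qed

text \<open>With \<open>H = gen u\<close> this is the right-hand side of the truncated equation.
  Keeping \<open>H\<close> as argument separates measurability, the Markov property and continuity
  from the nonlinearity.\<close>

definition Psi :: "(real \<times> 's \<Rightarrow> real^'k) \<Rightarrow> real \<times> 's \<Rightarrow> real^'k" where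
  "Psi H p = (\<integral>\<omega>. g (X T \<omega>) - path_integral H (fst p) \<omega> \<partial>P (fst p) (snd p))"

lemma Bg_nonneg: "0 \<le> Bg"
  using g_bound norm_ge_zero order_trans by blast

lemma measurable_Psi_integrand:
  assumes "t \<in> {0..T}" "H \<in> borel_measurable MT"
  shows "(\<lambda>\<omega>. g (X T \<omega>) - path_integral H t \<omega>) \<in> borel_measurable (G t)"
  using measurable_path_integral[OF assms] measurable_compose[OF measurable_X_G g_measurable, of T
    t] assms by auto

lemma Psi_integrand_bound:
  assumes "H \<in> borel_measurable MT" "\<omega> \<in> space \<Omega>" "0 \<le> r" "\<And>p. p \<in> {0..T} \<times> UNIV \<Longrightarrow> norm (H p) \<le> 1"
  shows "norm (g (X T \<omega>) - path_integral H r \<omega>) \<le> Bg + measure \<nu> {0..T}"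
  using norm_triangle_ineq4[of "g (X T \<omega>)" "path_integral H r \<omega>"] g_bound[of "X T \<omega>"]
    path_integral_bound_1[OF assms] by linarith

lemma Psi_bound:
  assumes "H \<in> borel_measurable MT" "\<And>p. p \<in> {0..T} \<times> UNIV \<Longrightarrow> norm (H p) \<le> 1" "p \<in> {0..T} \<times> UNIV"
  shows "norm (Psi H p) \<le> Bg + measure \<nu> {0..T}"
  unfolding Psi_def
  by (rule expectation_bound) (use assms Psi_integrand_bound[OF assms(1) _ _ assms(2)] Bg_nonneg in auto)

lemma integrable_Psi_integrand:
  assumes "H \<in> borel_measurable MT" "\<And>p. p \<in> {0..T} \<times> UNIV \<Longrightarrow> norm (H p) \<le> 1"
    "r \<in> {0..T}" "t \<in> {0..T}"
  shows "integrable (P r x) (\<lambda>\<omega>. g (X T \<omega>) - path_integral H t \<omega>)"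
  by (rule integrable_P_bounded[OF _ _ Psi_integrand_bound[OF assms(1) _ _ assms(2)]])
     (use assms measurable_G_\<Omega>[OF _ measurable_Psi_integrand] in auto)

text \<open>The lower limit \<open>r\<close> of the integral depends on the point; rounding it up to a dyadic
  number reduces measurability in \<open>(r, x)\<close> to the case of a fixed lower limit.\<close>

lemma measurable_Psi:
  assumes H: "H \<in> borel_measurable MT" and bd: "\<And>p. p \<in> {0..T} \<times> UNIV \<Longrightarrow> norm (H p) \<le> 1"
  shows "Psi H \<in> borel_measurable MT"
proof (rule borel_measurable_LIMSEQ_metric)
  \<comment> \<open>Dyadic numbers capped at \<open>T\<close>; \<open>up\<close> selects the index
    of the first multiple of \<open>1 / 2 ^ n\<close> that is at least \<open>s\<close>.\<close>
  define \<tau> where "\<tau> n j = min T (real j / 2 ^ n)" for n j :: nat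
  define up where "up n s = nat \<lceil>s * 2 ^ n\<rceil>" for n and s :: real
  \<comment> \<open>Measurability with a fixed lower limit \<open>\<tau> n j\<close> is available
    only for starting times up to \<open>\<tau> n j\<close>, hence the indicator. Since times are
    rounded up, it equals 1 at the index that is used.\<close>
  define U where "U n j p = indicator ({0..\<tau> n j} \<times> UNIV) p *\<^sub>R
    (\<integral>\<omega>. g (X T \<omega>) - path_integral H (\<tau> n j) \<omega> \<partial>P (fst p) (snd p))" for n j p
  have \<tau>: "\<tau> n j \<in> {0..T}" for n j using T_pos by (auto simp: \<tau>_def)
  have "U n j \<in> borel_measurable MT" for n j
    unfolding U_def
    using measurable_expectation_G[OF \<tau> measurable_Psi_integrand[OF \<tau> H], of n j]
    by (subst (asm) borel_measurable_restrict_space_iff) (use slab_Int in auto)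
  \<comment> \<open>The index takes countably many values and is a measurable function of
    \<open>fst p\<close>.\<close>
  then show "(\<lambda>p. U n (up n (fst p)) p) \<in> borel_measurable MT" for n
    by (rule measurable_compose_countable) (unfold up_def, measurable)
  fix p assume "p \<in> space MT"
  then have r: "fst p \<in> {0..T}" by auto
  have le: "fst p \<le> \<tau> n (up n (fst p))" for n
  proof -
    have "fst p * 2 ^ n \<le> real (up n (fst p))"
      using r unfolding up_def by (simp add: of_nat_nat real_nat_ceiling_ge)
    then have "fst p \<le> real (up n (fst p)) / 2 ^ n" by (simp add: field_simps)
    then show ?thesis using r by (auto simp: \<tau>_def)
  qed
  have ge: "\<tau> n (up n (fst p)) \<le> fst p + (1/2) ^ n" for n
  proof -
    have "0 \<le> fst p * 2 ^ n" using r by simp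
    then have "real (up n (fst p)) \<le> fst p * 2 ^ n + 1"
      unfolding up_def by linarith
    then have "real (up n (fst p)) / 2 ^ n \<le> fst p + (1/2) ^ n" by (simp add: field_simps)
    then show ?thesis by (auto simp: \<tau>_def)
  qed
  have lim: "(\<lambda>n. \<tau> n (up n (fst p))) \<longlonglongrightarrow> fst p"
  proof (rule tendsto_sandwich)
    show "(\<lambda>_. fst p) \<longlonglongrightarrow> fst p" by simp
    have "(\<lambda>n. fst p + (1/2) ^ n) \<longlonglongrightarrow> fst p + 0"
      by (intro tendsto_intros LIMSEQ_power_zero) simp
    then show "(\<lambda>n. fst p + (1/2) ^ n) \<longlonglongrightarrow> fst p" by simp
  qed (use le ge in auto)
  have "(\<lambda>n. \<integral>\<omega>. g (X T \<omega>) - path_integral H (\<tau> n (up n (fst p))) \<omega> \<partial>P (fst p) (snd p)) \<longlonglongrightarrow> Psi H p"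
    unfolding Psi_def
  proof (rule integral_dominated_convergence[where w = "\<lambda>_. Bg + measure \<nu> {0..T}"])
    interpret prob_space "P (fst p) (snd p)" using r by (rule prob_space_P)
    show "integrable (P (fst p) (snd p)) (\<lambda>_. Bg + measure \<nu> {0..T})" by simp
    show "AE \<omega> in P (fst p) (snd p). (\<lambda>n. g (X T \<omega>) - path_integral H (\<tau> n (up n (fst p))) \<omega>)
      \<longlonglongrightarrow> g (X T \<omega>) - path_integral H (fst p) \<omega>"
    proof (rule AE_I2)
      fix \<omega> assume "\<omega> \<in> space (P (fst p) (snd p))"
      then have \<omega>: "\<omega> \<in> space \<Omega>" using space_P[OF r] by simp
      have "integrable \<nu> (\<lambda>s. H (s, X s \<omega>))"
        by (rule integrable_bounded[of _ 1]) (use measurable_path[OF H \<omega>] bd in auto)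
      from tail_integral_tendsto[OF this lim r]
      show "(\<lambda>n. g (X T \<omega>) - path_integral H (\<tau> n (up n (fst p))) \<omega>) \<longlonglongrightarrow> g (X T \<omega>) - path_integral H (fst p) \<omega>"
        unfolding path_integral_def by (intro tendsto_intros)
    qed
    show "AE \<omega> in P (fst p) (snd p). norm (g (X T \<omega>) - path_integral H (\<tau> n (up n (fst p))) \<omega>)
      \<le> Bg + measure \<nu> {0..T}" for n
      by (rule AE_I2) (use Psi_integrand_bound[OF H _ _ bd] \<tau> space_P[OF r] in auto)
  qed (use measurable_G_\<Omega>[OF _ measurable_Psi_integrand[OF _ H]] \<tau> r in \<open>auto simp: measurable_P[OF r]\<close>)
  moreover have "U n (up n (fst p)) p = (\<integral>\<omega>. g (X T \<omega>) - path_integral H (\<tau> n (up n (fst p))) \<omega> \<partial>P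
    (fst p) (snd p))" for n
    using le[of n] r by (cases p) (auto simp: U_def)
  ultimately show "(\<lambda>n. U n (up n (fst p)) p) \<longlonglongrightarrow> Psi H p" by simp
qed

text \<open>The integrand of \<open>Psi\<close> at time \<open>t\<close> is a functional of the
  future after \<open>t\<close>, so averaging over the position at \<open>t\<close> restarts the
  process there.\<close>

lemma Psi_markov:
  assumes H: "H \<in> borel_measurable MT" and bd: "\<And>p. p \<in> {0..T} \<times> UNIV \<Longrightarrow> norm (H p) \<le> 1"
    and rt: "0 \<le> r" "r \<le> t" "t \<le> T"
  shows "(\<integral>\<omega>. Psi H (t, X t \<omega>) \<partial>P r x) = (\<integral>\<omega>. g (X T \<omega>) - path_integral H t \<omega> \<partial>P r x)"
  unfolding Psi_def fst_conv snd_conv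
  by (rule markov_expectation_G_vec[OF rt, symmetric, where c = "Bg + measure \<nu> {0..T}"])
     (use rt measurable_Psi_integrand[OF _ H] Psi_integrand_bound[OF H _ _ bd] Bg_nonneg in auto)

lemma path_integral_split:
  assumes H: "H \<in> borel_measurable MT" and bd: "\<And>p. p \<in> {0..T} \<times> UNIV \<Longrightarrow> norm (H p) \<le> 1"
    and rt: "0 \<le> r" "r \<le> t" "t \<le> T" and \<omega>: "\<omega> \<in> space \<Omega>"
  shows "path_integral H r \<omega> = (LINT s:{r..t}|\<nu>. H (s, X s \<omega>)) + path_integral H t \<omega>"
proof -
  have int: "integrable \<nu> (\<lambda>s. H (s, X s \<omega>))"
    by (rule integrable_bounded[of _ 1]) (use measurable_path[OF H \<omega>] bd in auto)
  note si = set_integrable_sub[OF int]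
  \<comment> \<open>Both closed intervals contain \<open>t\<close>; counting it twice is harmless
    because it has no mass.\<close>
  have null: "{t} \<in> null_sets \<nu>"
    using rt null_points sets_\<nu>_Int[of "{t}"] by (auto simp: null_sets_def)
  have "path_integral H r \<omega> = (\<integral>s. indicator {r..t} s *\<^sub>R H (s, X s \<omega>) + indicator {t..T} s *\<^sub>R H
    (s, X s \<omega>) \<partial>\<nu>)"
    unfolding path_integral_def set_lebesgue_integral_def
  proof (rule integral_cong_AE)
    show "AE s in \<nu>. indicator {r..T} s *\<^sub>R H (s, X s \<omega>)
      = indicator {r..t} s *\<^sub>R H (s, X s \<omega>) + indicator {t..T} s *\<^sub>R H (s, X s \<omega>)"
      using AE_not_in[OF null] by eventually_elim (use rt in \<open>auto simp: indicator_def\<close>)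
  qed (use si[of "{r..t}"] si[of "{t..T}"] si[of "{r..T}"] in \<open>auto simp: set_integrable_def\<close>)
  also have "\<dots> = (LINT s:{r..t}|\<nu>. H (s, X s \<omega>)) + path_integral H t \<omega>"
    unfolding path_integral_def set_lebesgue_integral_def
    by (rule Bochner_Integration.integral_add) (use si[of "{r..t}"] si[of "{t..T}"] in \<open>auto simp:
      set_integrable_def\<close>)
  finally show ?thesis .
qed

text \<open>A weight for which \<open>Psi\<close> contracts by \<open>1/2\<close> on all of \<open>[0,T]\<close> at once: it jumps up by a
  large factor each time the tail mass of \<open>\<nu>\<close> has grown by \<open>1/4\<close>.\<close>

lemma weight_exists_aux:
  assumes "t \<in> {0..T}" "measure \<nu> {t..T} \<le> (real n + 1) / 4"
  shows "\<exists>\<phi> C. \<phi> \<in> borel_measurable borel \<and> (\<forall>s. 1 \<le> \<phi> s \<and> \<phi> s \<le> C) \<and>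
    (\<forall>r\<in>{t..T}. (LINT s:{r..T}|\<nu>. \<phi> s) \<le> \<phi> r / (2::real))"
  using assms
proof (induct n arbitrary: t)
  note tail = tail_sets
  have one: "(LINT s:A|\<nu>. 1) = measure \<nu> A" if "A \<in> sets \<nu>" for A
    using that sets.sets_into_space[OF that] by (simp add: set_lebesgue_integral_def Int_absorb2)
  {
    case 0
    have "(LINT s:{r..T}|\<nu>. 1) \<le> 1 / (2::real)" if "r \<in> {t..T}" for r
    proof -
      have "measure \<nu> {r..T} \<le> measure \<nu> {t..T}"
        by (rule N.finite_measure_mono) (use that tail 0 in auto)
      then show ?thesis using one[OF tail, of r] that 0 by auto
    qed
    then show ?case by (intro exI[of _ "\<lambda>_. 1"] exI[of _ 1]) auto
  next
    case (Suc n)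
    show ?case
    proof (cases "measure \<nu> {t..T} \<le> (real n + 1) / 4")
      case True
      then show ?thesis using Suc by blast
    next
      case False
      have cont: "continuous_on {t..T} (\<lambda>r. measure \<nu> {r..T})"
        unfolding continuous_on_sequentially
      proof (intro allI ballI impI)
        fix q a assume a: "a \<in> {t..T}" and q: "(\<forall>n. q n \<in> {t..T}) \<and> q \<longlonglongrightarrow> a"
        have "(\<lambda>n. LINT s:{q n..T}|\<nu>. 1::real) \<longlonglongrightarrow> (LINT s:{a..T}|\<nu>. 1)"
          by (rule tail_integral_tendsto) (use a q Suc(2) in auto)
        moreover have "q n \<in> {0..T}" for n
        proof -
          have "q n \<in> {t..T}" using q by blast
          then show ?thesis using Suc(2) by auto
        qed
        moreover have "a \<in> {0..T}" using a Suc(2) by auto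
        ultimately show "((\<lambda>r. measure \<nu> {r..T}) \<circ> q) \<longlonglongrightarrow> measure \<nu> {a..T}"
          using one[OF tail] by (simp add: comp_def)
      qed
      have "{T} \<in> null_sets \<nu>"
        using null_points[of T] T_pos sets_\<nu>_Int[of "{T}"] by (auto simp: null_sets_def)
      then have "measure \<nu> {T..T} = 0" by (simp add: measure_def null_sets_def)
      moreover have "1/4 < measure \<nu> {t..T}"
        using False by (smt (verit) divide_right_mono of_nat_0_le_iff)
      \<comment> \<open>The tail mass is continuous in its left end, vanishes at \<open>T\<close>
        and exceeds \<open>1/4\<close> at \<open>t\<close>. The intermediate value theorem yields
        the place where exactly \<open>1/4\<close> of it has been used up.\<close>
      ultimately obtain t0 where t0: "t \<le> t0" "t0 \<le> T" "measure \<nu> {t0..T} = measure \<nu> {t..T} - 1/4"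
        using IVT2'[of "\<lambda>r. measure \<nu> {r..T}" T "measure \<nu> {t..T} - 1/4" t, OF _ _ _ cont] Suc(2) by auto
      have t0T: "t0 \<in> {0..T}" using t0 Suc(2) by auto
      have "measure \<nu> {t0..T} \<le> (real n + 1) / 4"
        using t0(3) Suc(3) by (simp add: field_simps)
      from Suc(1)[OF t0T this] obtain \<phi> :: "real \<Rightarrow> real" and C where
        \<phi>: "\<phi> \<in> borel_measurable borel" "\<And>s. 1 \<le> \<phi> s" "\<And>s. \<phi> s \<le> C"
        and half: "\<And>r. r \<in> {t0..T} \<Longrightarrow> (LINT s:{r..T}|\<nu>. \<phi> s) \<le> \<phi> r / 2"
        by blast
      define A where "A = (LINT s:{t0..T}|\<nu>. \<phi> s)"
      \<comment> \<open>On \<open>{r..<t0}\<close> the new weight contributes at most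
        \<open>M / 4\<close> and the old one at most \<open>A\<close> after that;
        \<open>M / 4 + A \<le> M / 2\<close> holds as soon as \<open>4 * A \<le> M\<close>. The
        lower bound 1 keeps the weight at least 1.\<close>
      define M where "M = max 1 (4 * A)"
      define \<phi>' where "\<phi>' s = (if s < t0 then M else \<phi> s)" for s
      have \<phi>'m: "\<phi>' \<in> borel_measurable borel" unfolding \<phi>'_def using \<phi>(1) by measurable
      have int: "integrable \<nu> \<phi>'"
      proof (rule integrable_bounded[of _ "max M C"])
        show "\<phi>' \<in> borel_measurable \<nu>" unfolding measurable_\<nu> by (rule measurable_restrict_space1[OF \<phi>'m])
        show "norm (\<phi>' s) \<le> max M C" for s
          using \<phi>(2)[of s] \<phi>(3)[of s] by (auto simp: \<phi>'_def M_def)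
      qed
      have same: "(LINT s:{r..T}|\<nu>. \<phi>' s) = (LINT s:{r..T}|\<nu>. \<phi> s)" if "t0 \<le> r" for r
        unfolding set_lebesgue_integral_def
        by (rule Bochner_Integration.integral_cong) (use that in \<open>auto simp: \<phi>'_def indicator_def\<close>)
      have "(LINT s:{r..T}|\<nu>. \<phi>' s) \<le> \<phi>' r / 2" if r: "r \<in> {t..T}" for r
      proof (cases "t0 \<le> r")
        case True
        then show ?thesis using half[of r] r same by (auto simp: \<phi>'_def)
      next
        case False
        have rs: "{r..<t0} \<in> sets \<nu>" using sets_\<nu>_Int[of "{r..<t0}"] r Suc(2) t0 False
          by (auto simp: Int_absorb2 subset_eq)
        have split: "{r..T} = {r..<t0} \<union> {t0..T}" using False t0 by auto
        have "(LINT s:{r..T}|\<nu>. \<phi>' s) = (LINT s:{r..<t0}|\<nu>. \<phi>' s) + (LINT s:{t0..T}|\<nu>. \<phi>' s)"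
          unfolding split by (rule set_integral_Un) (auto intro!: set_integrable_sub int)
        also have "(LINT s:{t0..T}|\<nu>. \<phi>' s) = A" using same[of t0] by (simp add: A_def)
        also have "(LINT s:{r..<t0}|\<nu>. \<phi>' s) = (LINT s:{r..<t0}|\<nu>. M * 1)"
          unfolding set_lebesgue_integral_def
          by (rule Bochner_Integration.integral_cong) (auto simp: \<phi>'_def indicator_def)
        also have "\<dots> = M * measure \<nu> {r..<t0}"
          using one[OF rs] by (subst set_integral_mult_right) simp
        also have "measure \<nu> {r..<t0} = measure \<nu> {r..T} - measure \<nu> {t0..T}"
          unfolding split using rs tail[OF t0T] by (subst N.finite_measure_Union) auto
        also have "\<dots> \<le> 1/4"
        proof -
          have "measure \<nu> {r..T} \<le> measure \<nu> {t..T}"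
            by (rule N.finite_measure_mono) (use r tail Suc(2) in auto)
          then show ?thesis using t0(3) by simp
        qed
        finally have "(LINT s:{r..T}|\<nu>. \<phi>' s) \<le> M * (1/4) + A"
          by (simp add: M_def mult_left_mono)
        also have "\<dots> \<le> M / 2" by (simp add: M_def)
        finally show ?thesis using False by (simp add: \<phi>'_def)
      qed
      moreover have "1 \<le> \<phi>' s \<and> \<phi>' s \<le> max M C" for s
        using \<phi>(2)[of s] \<phi>(3)[of s] by (auto simp: \<phi>'_def M_def)
      ultimately show ?thesis using \<phi>'m by blast
    qed
  }
qed

lemma weight_exists:
  "\<exists>\<phi> C. integrable \<nu> \<phi> \<and> (\<forall>s. 1 \<le> \<phi> s) \<and> (\<forall>s. \<phi> s \<le> C) \<and>
    (\<forall>r\<in>{0..T}. (LINT s:{r..T}|\<nu>. \<phi> s) \<le> \<phi> r / (2::real))"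
proof -
  obtain n :: nat where "4 * measure \<nu> {0..T} \<le> real n" using real_arch_simple by blast
  then have "measure \<nu> {0..T} \<le> (real n + 1) / 4" by simp
  from weight_exists_aux[OF _ this] T_pos obtain \<phi> :: "real \<Rightarrow> real" and C where
    \<phi>: "\<phi> \<in> borel_measurable borel" "\<forall>s. 1 \<le> \<phi> s \<and> \<phi> s \<le> C"
    "\<forall>r\<in>{0..T}. (LINT s:{r..T}|\<nu>. \<phi> s) \<le> \<phi> r / 2"
    by (auto simp del: le_divide_eq_numeral1)
  have "integrable \<nu> \<phi>"
  proof (rule integrable_bounded[of _ C])
    show "\<phi> \<in> borel_measurable \<nu>" unfolding measurable_\<nu> by (rule measurable_restrict_space1[OF \<phi>(1)])
    show "norm (\<phi> s) \<le> C" for s using spec[OF \<phi>(2), of s] by simp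
  qed
  then show ?thesis using \<phi> by blast
qed

section \<open>Contraction and fixed points\<close>

abbreviation "gen v \<equiv> \<lambda>p. h p (v p)"

lemma measurable_gen: "v \<in> borel_measurable MT \<Longrightarrow> gen v \<in> borel_measurable MT"
proof -
  assume v: "v \<in> borel_measurable MT"
  have "(\<lambda>p. (p, v p)) \<in> MT \<rightarrow>\<^sub>M MT \<Otimes>\<^sub>M borel" using v by measurable
  from measurable_compose[OF this h_measurable] show ?thesis by simp
qed

text \<open>\<open>h\<close> has Lipschitz constant 1, so the integrands differ by at most
  \<open>c * \<phi> s\<close>, whose integral from the starting time on is at most half of
  \<open>c * \<phi>\<close> at that time. Only later times enter, so closeness on
  \<open>[t,T]\<close> is preserved without reference to what happens before
  \<open>t\<close>.\<close>

lemma Psi_contraction: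
  assumes u: "u \<in> borel_measurable MT" and v: "v \<in> borel_measurable MT"
    and \<phi>: "integrable \<nu> \<phi>" "\<And>s. 0 \<le> \<phi> s"
      "\<And>r. r \<in> {0..T} \<Longrightarrow> (LINT s:{r..T}|\<nu>. \<phi> s) \<le> \<phi> r / 2"
    and c: "0 \<le> c" and t: "t \<in> {0..T}"
    and uv: "\<And>p. p \<in> {t..T} \<times> UNIV \<Longrightarrow> norm (u p - v p) \<le> c * \<phi> (fst p)"
    and p: "p \<in> {t..T} \<times> UNIV"
  shows "norm (Psi (gen u) p - Psi (gen v) p) \<le> c / 2 * \<phi> (fst p)"
proof -
  have r: "fst p \<in> {0..T}" "0 \<le> fst p" "fst p \<in> {t..T}" using p t by auto
  define W where "W q = gen v q - gen u q" for q
  have W: "W \<in> borel_measurable MT" unfolding W_def using measurable_gen u v by (intro borel_measurable_diff)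
  note iu = integrable_Psi_integrand[OF measurable_gen[OF u] h_bound r(1,1)]
  note iv = integrable_Psi_integrand[OF measurable_gen[OF v] h_bound r(1,1)]
  have "Psi (gen u) p - Psi (gen v) p = (\<integral>\<omega>. path_integral W (fst p) \<omega> \<partial>P (fst p) (snd p))"
  proof -
    have "Psi (gen u) p - Psi (gen v) p = (\<integral>\<omega>. (g (X T \<omega>) - path_integral (gen u) (fst p) \<omega>) - (g (X
      T \<omega>) - path_integral (gen v) (fst p) \<omega>) \<partial>P (fst p) (snd p))"
      unfolding Psi_def by (rule Bochner_Integration.integral_diff[OF iu iv, symmetric])
    also have "\<dots> = (\<integral>\<omega>. path_integral W (fst p) \<omega> \<partial>P (fst p) (snd p))"
    proof (rule Bochner_Integration.integral_cong[OF refl])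
      fix \<omega> assume "\<omega> \<in> space (P (fst p) (snd p))"
      then have \<omega>: "\<omega> \<in> space \<Omega>" using space_P r by simp
      have "set_integrable \<nu> {fst p..T} (\<lambda>s. gen w (s, X s \<omega>))" if "w \<in> borel_measurable MT" for w
        by (rule set_integrable_sub[OF integrable_bounded[of _ 1]])
           (use measurable_path[OF measurable_gen[OF that] \<omega>] h_bound in auto)
      from set_integral_diff(2)[OF this[OF v] this[OF u]]
      show "(g (X T \<omega>) - path_integral (gen u) (fst p) \<omega>) - (g (X T \<omega>) - path_integral (gen v) (fst
        p) \<omega>) = path_integral W (fst p) \<omega>"
        by (simp add: path_integral_def W_def)
    qed
    finally show ?thesis .
  qed
  also have "norm \<dots> \<le> (LINT s:{fst p..T}|\<nu>. c * \<phi> s)"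
  proof (rule expectation_bound[OF r(1)])
    fix \<omega> assume \<omega>: "\<omega> \<in> space \<Omega>"
    show "norm (path_integral W (fst p) \<omega>) \<le> (LINT s:{fst p..T}|\<nu>. c * \<phi> s)"
    proof (rule path_integral_bound[OF W \<omega> r(2)])
      show "integrable \<nu> (\<lambda>s. c * \<phi> s)" using \<phi>(1) by simp
      fix s y assume s: "s \<in> {fst p..T}"
      then have "norm (W (s, y)) \<le> norm (u (s, y) - v (s, y))"
        using h_Lipschitz[of "(s, y)" "u (s, y)" "v (s, y)"] r by (auto simp: W_def norm_minus_commute)
      also have "\<dots> \<le> c * \<phi> s" using uv[of "(s, y)"] s r by auto
      finally show "norm (W (s, y)) \<le> c * \<phi> s" .
    qed
  next
    show "0 \<le> (LINT s:{fst p..T}|\<nu>. c * \<phi> s)"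
      unfolding set_lebesgue_integral_def using c \<phi>(2) by (intro integral_nonneg_AE) auto
  qed
  also have "\<dots> = c * (LINT s:{fst p..T}|\<nu>. \<phi> s)" by (rule set_integral_mult_right)
  also have "\<dots> \<le> c / 2 * \<phi> (fst p)" using mult_left_mono[OF \<phi>(3)[OF r(1)] c] by simp
  finally show ?thesis .
qed

text \<open>Each application of the contraction halves the weighted distance of two fixed points,
  which therefore vanishes.\<close>

lemma Psi_fixed_point_unique:
  assumes u: "u \<in> borel_measurable MT" and v: "v \<in> borel_measurable MT" and t: "t \<in> {0..T}"
    and fu: "\<And>p. p \<in> {t..T} \<times> UNIV \<Longrightarrow> u p = Psi (gen u) p"
    and fv: "\<And>p. p \<in> {t..T} \<times> UNIV \<Longrightarrow> v p = Psi (gen v) p"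
    and p: "p \<in> {t..T} \<times> UNIV"
  shows "u p = v p"
proof -
  obtain \<phi> :: "real \<Rightarrow> real" and C where \<phi>: "integrable \<nu> \<phi>" "\<And>s. 1 \<le> \<phi> s" "\<And>s. \<phi> s \<le> C"
    "\<And>r. r \<in> {0..T} \<Longrightarrow> (LINT s:{r..T}|\<nu>. \<phi> s) \<le> \<phi> r / 2" using weight_exists by blast
  have \<phi>0: "0 \<le> \<phi> s" for s using \<phi>(2)[of s] by simp
  \<comment> \<open>Twice the bound of \<open>Psi_bound\<close>, hence a bound for the difference of
    any two fixed points; since \<open>\<phi>\<close> is at least 1 it is one in the weighted norm
    too.\<close>
  define B where "B = 2 * (Bg + measure \<nu> {0..T})"
  have B: "0 \<le> B" using Bg_nonneg by (simp add: B_def)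
  have "\<forall>p\<in>{t..T} \<times> UNIV. norm (u p - v p) \<le> B / 2 ^ n * \<phi> (fst p)" for n
  proof (induct n)
    case 0
    show ?case
    proof
      fix p assume p: "p \<in> {t..T} \<times> (UNIV::'s set)"
      then have pT: "p \<in> {0..T} \<times> UNIV" using t by auto
      have "norm (u p - v p) \<le> norm (Psi (gen u) p) + norm (Psi (gen v) p)"
        using fu[OF p] fv[OF p] norm_triangle_ineq4 by metis
      also have "\<dots> \<le> B * 1"
        using Psi_bound[OF measurable_gen[OF u] h_bound pT] Psi_bound[OF measurable_gen[OF v]
          h_bound pT] by (simp add: B_def)
      also have "\<dots> \<le> B * \<phi> (fst p)" using \<phi>(2) B by (intro mult_left_mono) auto
      finally show "norm (u p - v p) \<le> B / 2 ^ 0 * \<phi> (fst p)" by simp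
    qed
  next
    case (Suc n)
    show ?case
    proof
      fix p assume p: "p \<in> {t..T} \<times> (UNIV::'s set)"
      have "norm (Psi (gen u) p - Psi (gen v) p) \<le> B / 2 ^ n / 2 * \<phi> (fst p)"
        by (rule Psi_contraction[OF u v \<phi>(1) \<phi>0 \<phi>(4) _ t _ p]) (use Suc B in auto)
      then show "norm (u p - v p) \<le> B / 2 ^ Suc n * \<phi> (fst p)"
        using fu[OF p] fv[OF p] by (simp add: field_simps)
    qed
  qed
  then have le: "norm (u p - v p) \<le> B / 2 ^ n * \<phi> (fst p)" for n using p by blast
  have "(\<lambda>n. B / 2 ^ n * \<phi> (fst p)) \<longlonglongrightarrow> 0"
    using tendsto_mult_left[OF LIMSEQ_power_zero[of "1/2::real"], of "B * \<phi> (fst p)"]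
      by (simp add: power_divide)
  then have "norm (u p - v p) \<le> 0"
    by (rule LIMSEQ_le_const) (use le in auto)
  then show ?thesis by simp
qed

primrec picard :: "nat \<Rightarrow> real \<times> 's \<Rightarrow> real^'k" where
  "picard 0 = (\<lambda>_. 0)"
| "picard (Suc n) = Psi (gen (picard n))"

lemma measurable_picard: "picard n \<in> borel_measurable MT"
  by (induct n) (auto intro!: measurable_Psi measurable_gen h_bound)

text \<open>The error \<open>B n\<close> does not depend on the point \<open>p\<close>: uniform
  convergence of the Picard iterates later carries continuity to the limit.\<close>

lemma Psi_fixed_point_exists:
  obtains v B where "v \<in> borel_measurable MT" "\<And>p. p \<in> {0..T} \<times> UNIV \<Longrightarrow> v p = Psi (gen v) p"
    "B \<longlonglongrightarrow> 0" "\<And>n p. p \<in> {0..T} \<times> UNIV \<Longrightarrow> norm (picard n p - v p) \<le> B n"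
proof -
  obtain \<phi> :: "real \<Rightarrow> real" and C where \<phi>: "integrable \<nu> \<phi>" "\<And>s. 1 \<le> \<phi> s" "\<And>s. \<phi> s \<le> C"
    "\<And>r. r \<in> {0..T} \<Longrightarrow> (LINT s:{r..T}|\<nu>. \<phi> s) \<le> \<phi> r / 2" using weight_exists by blast
  have \<phi>0: "0 \<le> \<phi> s" for s using \<phi>(2)[of s] by simp
  have T0: "0 \<in> {0..T}" using T_pos by simp
  define c where "c = Bg + measure \<nu> {0..T}"
  have c: "0 \<le> c" using Bg_nonneg by (simp add: c_def)
  have C: "0 \<le> C" using \<phi>(2,3) by (metis order_trans zero_le_one)
  have step: "norm (picard (Suc n) p - picard n p) \<le> c / 2 ^ n * \<phi> (fst p)" if "p \<in> {0..T} \<times> UNIV" for n p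
    using that
  proof (induct n arbitrary: p)
    case 0
    have "norm (Psi (gen (picard 0)) p) \<le> c * 1"
      using Psi_bound[OF measurable_gen[OF measurable_picard[of 0]] h_bound 0] by (simp add: c_def)
    also have "\<dots> \<le> c * \<phi> (fst p)" using \<phi>(2) c by (intro mult_left_mono) auto
    finally show ?case by simp
  next
    case (Suc n)
    have "norm (Psi (gen (picard (Suc n))) p - Psi (gen (picard n)) p) \<le> c / 2 ^ n / 2 * \<phi> (fst p)"
      by (rule Psi_contraction[OF measurable_picard measurable_picard \<phi>(1) \<phi>0 \<phi>(4) _ T0 _ Suc(2)])
         (use Suc(1) c in auto)
    then show ?case by (simp add: field_simps)
  qed
  have step': "norm (picard (Suc n) p - picard n p) \<le> c * C / 2 ^ n" if "p \<in> {0..T} \<times> UNIV" for n p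
    using step[OF that, of n] mult_left_mono[OF \<phi>(3)[of "fst p"], of "c / 2 ^ n"] c by (simp add: field_simps)
  have "\<exists>l. (\<lambda>n. picard n p) \<longlonglongrightarrow> l \<and> (\<forall>n. norm (picard n p - l) \<le> 2 * (c * C) / 2 ^ n)" if "p
    \<in> {0..T} \<times> UNIV" for p
    by (rule geometric_increments_convergent[of "\<lambda>n. picard n p", OF step'[OF that]]) blast
  then obtain v where lim: "\<And>p. p \<in> {0..T} \<times> UNIV \<Longrightarrow> (\<lambda>n. picard n p) \<longlonglongrightarrow> v p"
    and err: "\<And>n p. p \<in> {0..T} \<times> UNIV \<Longrightarrow> norm (picard n p - v p) \<le> 2 * (c * C) / 2 ^ n" by metis
  have v: "v \<in> borel_measurable MT"
    by (rule borel_measurable_LIMSEQ_metric[of picard, OF measurable_picard lim]) simp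
  have B0: "(\<lambda>n. 2 * (c * C) / 2 ^ n) \<longlonglongrightarrow> 0"
    using tendsto_mult_left[OF LIMSEQ_power_zero[of "1/2::real"], of "2 * (c * C)"]
      by (simp add: power_divide)
  have "v p = Psi (gen v) p" if p: "p \<in> {0..T} \<times> UNIV" for p
  proof -
    have "norm (Psi (gen (picard n)) p - Psi (gen v) p) \<le> 2 * (c * C) / 2 ^ n * C" for n
    proof -
      have "norm (Psi (gen (picard n)) p - Psi (gen v) p) \<le> 2 * (c * C) / 2 ^ n / 2 * \<phi> (fst p)"
      proof (rule Psi_contraction[OF measurable_picard v \<phi>(1) \<phi>0 \<phi>(4) _ T0 _ p])
        fix q assume q: "q \<in> {0..T} \<times> (UNIV :: 's set)"
        \<comment> \<open>As \<open>\<phi>\<close> is at least 1, an unweighted error is also a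
          weighted one; the way back costs the factor \<open>C\<close>.\<close>
        have "2 * (c * C) / 2 ^ n * 1 \<le> 2 * (c * C) / 2 ^ n * \<phi> (fst q)"
          using c C \<phi>(2) by (intro mult_left_mono) auto
        with err[OF q, of n] show "norm (picard n q - v q) \<le> 2 * (c * C) / 2 ^ n * \<phi> (fst q)" by simp
      qed (use c C in auto)
      also have "\<dots> \<le> 2 * (c * C) / 2 ^ n * C"
        using c C \<phi>(3)[of "fst p"] \<phi>0[of "fst p"] by (intro mult_mono) (auto simp: divide_right_mono)
      finally show ?thesis .
    qed
    then have "norm (picard (Suc n) p - Psi (gen v) p) \<le> 2 * (c * C) / 2 ^ n * C" for n by simp
    then have "(\<lambda>n. picard (Suc n) p - Psi (gen v) p) \<longlonglongrightarrow> 0"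
      by (rule Lim_null_comparison[OF always_eventually, rule_format])
         (use tendsto_mult_right[OF B0, of C] in simp)
    then have "(\<lambda>n. picard (Suc n) p) \<longlonglongrightarrow> Psi (gen v) p" by (rule LIM_zero_cancel)
    moreover have "(\<lambda>n. picard (Suc n) p) \<longlonglongrightarrow> v p" using lim[OF p] by (rule LIMSEQ_Suc)
    ultimately show ?thesis by (rule LIMSEQ_unique[symmetric])
  qed
  then show ?thesis using that v B0 err by blast
qed

end

section \<open>Continuity for Feller processes\<close>

context markov_setting
begin

definition rel_feller :: "(real \<Rightarrow> real \<Rightarrow> bool) \<Rightarrow> bool" where
  "rel_feller R \<longleftrightarrow> (\<forall>t\<in>{0..T}. \<forall>\<phi>::'s \<Rightarrow> real. continuous_on UNIV \<phi> \<longrightarrow> bounded (range \<phi>) \<longrightarrow>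
    rel_continuous R d {0..t} (\<lambda>p. \<integral>\<omega>. \<phi> (X t \<omega>) \<partial>P (fst p) (snd p)))"

lemma rel_feller_True: "feller T d X P \<Longrightarrow> rel_feller (\<lambda>_ _. True)"
  unfolding rel_feller_def feller_def
  by (auto simp: rel_continuous_True pseudometric_slab case_prod_beta')

lemma rel_feller_le: "right_feller T d X P \<Longrightarrow> rel_feller (\<le>)"
  unfolding rel_feller_def right_feller_def
  by (auto simp: rel_continuous_le pseudometric_slab case_prod_beta')

text \<open>Continuity of the time coordinate for \<open>d\<close>: points that converge for
  \<open>d\<close> also have converging times.\<close>

lemma fst_tendsto:
  assumes "p \<in> {0..T} \<times> UNIV" "\<And>n. q n \<in> {0..T} \<times> UNIV" "(\<lambda>n. d (q n) p) \<longlonglongrightarrow> 0"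
  shows "(\<lambda>n. fst (q n)) \<longlonglongrightarrow> fst p"
proof -
  have "pm_continuous d {0..T} fst"
    using time_cont unfolding time_continuous_def pm_continuous_def by simp
  then have "rel_continuous (\<lambda>_ _. True) d {0..T} fst"
    by (simp add: rel_continuous_True pseudometric)
  then show ?thesis using assms unfolding rel_continuous_def by blast
qed

text \<open>Balls of \<open>d\<close> are open for the product topology, so at a fixed time
  convergence in the state space implies convergence for \<open>d\<close>.\<close>

lemma section_tendsto:
  assumes s: "s \<in> {0..T}" and y: "y \<longlonglongrightarrow> y0"
  shows "(\<lambda>n. d (s, y n) (s, y0)) \<longlonglongrightarrow> 0"
proof (rule order_tendstoI)
  have in_slab: "(s, y) \<in> {0..T} \<times> UNIV" for y using s by simp
  have sym: "d (s, z) (s, y0) = d (s, y0) (s, z)" and nn: "0 \<le> d (s, z) (s, y0)" for z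
    using pseudometric[unfolded pseudometric_on_def, THEN conjunct2, THEN conjunct1, rule_format, OF
      in_slab in_slab] by auto
  show "\<forall>\<^sub>F n in sequentially. a < d (s, y n) (s, y0)" if "a < 0" for a
    using less_le_trans[OF that nn] by (intro always_eventually allI)
  fix e :: real assume e: "0 < e"
  have "openin (pm_topology ({0..T} \<times> UNIV) d) {q \<in> {0..T} \<times> UNIV. d (s, y0) q < e}"
    by (rule openin_pm_ball[OF pseudometric in_slab])
  then have "openin (top_of_set ({0..T} \<times> UNIV)) {q \<in> {0..T} \<times> UNIV. d (s, y0) q < e}"
    using coarser unfolding coarser_than_product_def by blast
  then obtain V where V: "open V" "{q \<in> {0..T} \<times> UNIV. d (s, y0) q < e} = ({0..T} \<times> UNIV) \<inter> V"
    unfolding openin_open by blast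
  have "d (s, y0) (s, y0) = 0"
    using pseudometric[unfolded pseudometric_on_def, THEN conjunct1] in_slab by (rule bspec)
  moreover have VD: "(s, z) \<in> V \<longleftrightarrow> d (s, y0) (s, z) < e" for z
  proof -
    have "((s, z) \<in> {q \<in> {0..T} \<times> UNIV. d (s, y0) q < e}) = ((s, z) \<in> ({0..T} \<times> UNIV) \<inter> V)"
      by (simp only: V(2))
    then show ?thesis using s by simp
  qed
  ultimately have "(s, y0) \<in> V" using e by simp
  moreover have "(\<lambda>n. (s, y n)) \<longlonglongrightarrow> (s, y0)" using y by (intro tendsto_intros)
  ultimately have "\<forall>\<^sub>F n in sequentially. (s, y n) \<in> V" using V(1) by (intro topological_tendstoD)
  then show "\<forall>\<^sub>F n in sequentially. d (s, y n) (s, y0) < e"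
  proof eventually_elim
    case (elim n)
    then show ?case using sym VD by simp
  qed
qed

text \<open>At a fixed time one-sidedness disappears because of \<open>R s s\<close>. Thus even a
  right-continuous function is fully continuous in the state, as needed when it is inserted into
  \<open>h (s, x) w\<close>.\<close>

lemma rel_continuous_section:
  assumes "rel_continuous R d {0..T} v" "\<And>s. R s s" "s \<in> {0..T}"
  shows "continuous_on UNIV (\<lambda>y. v (s, y))"
  unfolding continuous_on_sequentially
proof (intro allI ballI impI)
  fix y :: "nat \<Rightarrow> 's" and y0 assume "(\<forall>n. y n \<in> UNIV) \<and> y \<longlonglongrightarrow> y0"
  then have "(\<lambda>n. d (s, y n) (s, y0)) \<longlonglongrightarrow> 0"
    using section_tendsto[OF assms(3)] by simp
  moreover have "\<forall>n. (s, y n) \<in> {0..T} \<times> UNIV \<and> R (fst (s, y0)) (fst (s, y n))"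
    using assms by simp
  moreover have "(s, y0) \<in> {0..T} \<times> UNIV" using assms by simp
  ultimately have "(\<lambda>n. v (s, y n)) \<longlonglongrightarrow> v (s, y0)"
    using assms(1)[unfolded rel_continuous_def, THEN bspec, THEN spec, THEN mp, THEN mp, of "(s,
      y0)" "\<lambda>n. (s, y n)"] by simp
  then show "((\<lambda>y. v (s, y)) \<circ> y) \<longlonglongrightarrow> v (s, y0)" by (simp add: comp_def)
qed

lemma rel_feller_tendsto:
  fixes \<phi> :: "'s \<Rightarrow> real^'k"
  assumes R: "rel_feller R" and t: "t \<in> {0..T}" and \<phi>: "continuous_on UNIV \<phi>" "\<And>y. norm (\<phi> y) \<le> c"
    and p: "p \<in> {0..t} \<times> UNIV" and q: "\<And>n. q n \<in> {0..t} \<times> UNIV" "\<And>n. R (fst p) (fst (q n))"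
    and lim: "(\<lambda>n. d (q n) p) \<longlonglongrightarrow> 0"
  shows "(\<lambda>n. \<integral>\<omega>. \<phi> (X t \<omega>) \<partial>P (fst (q n)) (snd (q n))) \<longlonglongrightarrow> (\<integral>\<omega>. \<phi> (X t \<omega>) \<partial>P (fst p) (snd p))"
proof (rule vec_tendstoI)
  fix i
  have m: "(\<lambda>\<omega>. \<phi> (X t \<omega>)) \<in> borel_measurable \<Omega>"
    using measurable_compose[OF measurable_X[OF t] borel_measurable_continuous_onI[OF \<phi>(1)]] .
  have 1: "(\<integral>\<omega>. \<phi> (X t \<omega>) \<partial>P (fst p) (snd p)) $ i = (\<integral>\<omega>. \<phi> (X t \<omega>) $ i \<partial>P (fst p) (snd p))"
    if "p \<in> {0..t} \<times> UNIV" for p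
    by (rule integral_bounded_linear[OF bounded_linear_vec_nth, symmetric], rule
      integrable_P_bounded[OF _ m \<phi>(2)])
       (use that t in auto)
  have "bounded (range (\<lambda>y. \<phi> y $ i))"
  proof (rule boundedI)
    show "norm z \<le> c" if "z \<in> range (\<lambda>y. \<phi> y $ i)" for z
      using that order_trans[OF component_le_norm_cart \<phi>(2)] by auto
  qed
  moreover have "continuous_on UNIV (\<lambda>y. \<phi> y $ i)"
    using \<phi>(1) by (intro continuous_intros)
  ultimately have "rel_continuous R d {0..t} (\<lambda>p. \<integral>\<omega>. \<phi> (X t \<omega>) $ i \<partial>P (fst p) (snd p))"
    using R t unfolding rel_feller_def by blast
  then have "(\<lambda>n. \<integral>\<omega>. \<phi> (X t \<omega>) $ i \<partial>P (fst (q n)) (snd (q n))) \<longlonglongrightarrow> (\<integral>\<omega>. \<phi> (X t \<omega>) $ i \<partial>P (fst p) (snd p))"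
    using p q lim unfolding rel_continuous_def by blast
  then show "(\<lambda>n. (\<integral>\<omega>. \<phi> (X t \<omega>) \<partial>P (fst (q n)) (snd (q n))) $ i) \<longlonglongrightarrow> (\<integral>\<omega>. \<phi> (X t \<omega>) \<partial>P (fst p) (snd p)) $ i"
    using 1 p q by simp
qed

end

context truncated_problem
begin

lemma measurable_marginal_expectation:
  fixes H :: "real \<times> 's \<Rightarrow> 'b::{banach, second_countable_topology}"
  assumes H: "H \<in> borel_measurable MT" and r: "r \<in> {0..T}"
  shows "(\<lambda>s. \<integral>\<omega>. H (s, X s \<omega>) \<partial>P r x) \<in> borel_measurable \<nu>"
proof -
  interpret prob_space "P r x" using r by (rule prob_space_P)
  have 1: "(\<lambda>q. (snd q, fst q)) \<in> \<nu> \<Otimes>\<^sub>M P r x \<rightarrow>\<^sub>M P r x \<Otimes>\<^sub>M \<nu>" by measurable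
  have 2: "(\<lambda>(\<omega>, s). H (s, X s \<omega>)) \<in> borel_measurable (P r x \<Otimes>\<^sub>M \<nu>)"
    using measurable_joint_path_\<Omega>[OF H] sets_P[OF r]
    by (subst measurable_cong_sets[OF sets_pair_measure_cong[OF sets_P[OF r] refl] refl])
  from measurable_compose[OF 1 2]
  have "(\<lambda>(s, \<omega>). H (s, X s \<omega>)) \<in> borel_measurable (\<nu> \<Otimes>\<^sub>M P r x)"
    by (simp add: case_prod_beta')
  then show ?thesis by (rule borel_measurable_lebesgue_integral)
qed

text \<open>The Feller property concerns one terminal time at once; with the expectation inside the
  time integral it can be used for each \<open>s\<close> separately.\<close>

lemma Psi_Fubini:
  assumes H: "H \<in> borel_measurable MT" and bd: "\<And>p. p \<in> {0..T} \<times> UNIV \<Longrightarrow> norm (H p) \<le> 1"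
    and p: "p \<in> {0..T} \<times> UNIV"
  shows "Psi H p = (\<integral>\<omega>. g (X T \<omega>) \<partial>P (fst p) (snd p))
    - (LINT s:{fst p..T}|\<nu>. \<integral>\<omega>. H (s, X s \<omega>) \<partial>P (fst p) (snd p))"
proof -
  have r: "fst p \<in> {0..T}" using p by auto
  have TT: "T \<in> {0..T}" using T_pos by simp
  interpret prob_space "P (fst p) (snd p)" using r by (rule prob_space_P)
  interpret pair_sigma_finite "P (fst p) (snd p)" \<nu> ..
  let ?f = "\<lambda>\<omega> s. indicator {fst p..T} s *\<^sub>R H (s, X s \<omega>)"
  have gX: "integrable (P (fst p) (snd p)) (\<lambda>\<omega>. g (X T \<omega>))"
    by (rule integrable_P_bounded[OF r measurable_compose[OF measurable_X[OF TT] g_measurable] g_bound])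
  have pi: "integrable (P (fst p) (snd p)) (path_integral H (fst p))"
    by (rule integrable_P_bounded[OF r measurable_G_\<Omega>[OF r measurable_path_integral[OF r H]]
      path_integral_bound_1[OF H _ _ bd]])
       (use r in auto)
  have "(\<lambda>(\<omega>, s). H (s, X s \<omega>)) \<in> borel_measurable (P (fst p) (snd p) \<Otimes>\<^sub>M \<nu>)"
    using measurable_joint_path_\<Omega>[OF H]
    by (subst measurable_cong_sets[OF sets_pair_measure_cong[OF sets_P[OF r] refl] refl])
  moreover have "(\<lambda>q. indicator {fst p..T} (snd q) :: real) \<in> borel_measurable (P (fst p) (snd p) \<Otimes>\<^sub>M \<nu>)"
  proof (rule measurable_compose[OF measurable_snd])
    show "(\<lambda>s. indicator {fst p..T} s :: real) \<in> borel_measurable \<nu>"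
      using tail_sets[OF r] by simp
  qed
  ultimately have m: "case_prod ?f \<in> borel_measurable (P (fst p) (snd p) \<Otimes>\<^sub>M \<nu>)"
    by (simp add: case_prod_beta')
  interpret PF: finite_measure "P (fst p) (snd p) \<Otimes>\<^sub>M \<nu>"
    by (rule finite_measure_pair_measure) unfold_locales
  have int: "integrable (P (fst p) (snd p) \<Otimes>\<^sub>M \<nu>) (case_prod ?f)"
  proof (rule PF.integrable_const_bound[OF _ m])
    show "AE q in P (fst p) (snd p) \<Otimes>\<^sub>M \<nu>. norm (case_prod ?f q) \<le> 1"
      by (rule AE_I2) (use bd in \<open>auto simp: space_pair_measure indicator_def\<close>)
  qed
  have "Psi H p = (\<integral>\<omega>. g (X T \<omega>) \<partial>P (fst p) (snd p)) - (\<integral>\<omega>. path_integral H (fst p) \<omega> \<partial>P (fst p) (snd p))"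
    unfolding Psi_def by (rule Bochner_Integration.integral_diff[OF gX pi])
  also have "(\<integral>\<omega>. path_integral H (fst p) \<omega> \<partial>P (fst p) (snd p)) = (\<integral>s. (\<integral>\<omega>. ?f \<omega> s \<partial>P (fst p) (snd p)) \<partial>\<nu>)"
    unfolding path_integral_def set_lebesgue_integral_def by (rule Fubini_integral[OF int, symmetric])
  also have "\<dots> = (LINT s:{fst p..T}|\<nu>. \<integral>\<omega>. H (s, X s \<omega>) \<partial>P (fst p) (snd p))"
    by (simp add: set_lebesgue_integral_def)
  finally show ?thesis .
qed

text \<open>After \<open>Psi_Fubini\<close>, dominated convergence in \<open>s\<close> applies. For
  \<open>s\<close> above the limiting starting time the Feller property with terminal time
  \<open>s\<close> gives convergence, for \<open>s\<close> below it the indicators eventually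
  vanish, and equality occurs on a null set.\<close>

lemma Psi_rel_continuous:
  assumes H: "H \<in> borel_measurable MT" and bd: "\<And>p. p \<in> {0..T} \<times> UNIV \<Longrightarrow> norm (H p) \<le> 1"
    and R: "rel_feller R" and g: "continuous_on UNIV g"
    and cont: "AE s in \<nu>. continuous_on UNIV (\<lambda>y. H (s, y))"
  shows "rel_continuous R d {0..T} (Psi H)"
  unfolding rel_continuous_def
proof (intro ballI allI impI)
  fix p q assume p: "p \<in> {0..T} \<times> UNIV" and q: "\<forall>n::nat. q n \<in> {0..T} \<times> UNIV \<and> R (fst p) (fst (q n))"
    and lim: "(\<lambda>n. d (q n) p) \<longlonglongrightarrow> 0"
  have r: "fst p \<in> {0..T}" and rn: "fst (q n) \<in> {0..T}" for n using p q by (auto simp: mem_Times_iff)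
  have TT: "T \<in> {0..T}" using T_pos by simp
  have fl: "(\<lambda>n. fst (q n)) \<longlonglongrightarrow> fst p" using fst_tendsto p q lim by blast
  have 1: "(\<lambda>n. \<integral>\<omega>. g (X T \<omega>) \<partial>P (fst (q n)) (snd (q n))) \<longlonglongrightarrow> (\<integral>\<omega>. g (X T \<omega>) \<partial>P (fst p) (snd p))"
    by (rule rel_feller_tendsto[OF R TT g g_bound p _ _ lim]) (use q in auto)
  define E where "E p s = (\<integral>\<omega>. H (s, X s \<omega>) \<partial>P (fst p) (snd p))" for p s
  have Em: "E p \<in> borel_measurable \<nu>" if "fst p \<in> {0..T}" for p
    unfolding E_def using that by (rule measurable_marginal_expectation[OF H])
  have Eb: "norm (E p s) \<le> 1" if "fst p \<in> {0..T}" "s \<in> {0..T}" for p s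
    unfolding E_def by (rule expectation_bound[OF that(1)]) (use bd that in auto)
  have 2: "(\<lambda>n. LINT s:{fst (q n)..T}|\<nu>. E (q n) s) \<longlonglongrightarrow> (LINT s:{fst p..T}|\<nu>. E p s)"
    unfolding set_lebesgue_integral_def
  proof (rule integral_dominated_convergence[where w = "\<lambda>_. 1"])
    have "{fst p} \<in> null_sets \<nu>"
      using r null_points sets_\<nu>_Int[of "{fst p}"] by (auto simp: null_sets_def)
    then have "AE s in \<nu>. s \<notin> {fst p}" by (rule AE_not_in)
    with cont AE_space show "AE s in \<nu>. (\<lambda>n. indicator {fst (q n)..T} s *\<^sub>R E (q n) s)
      \<longlonglongrightarrow> indicator {fst p..T} s *\<^sub>R E p s"
    proof eventually_elim
      case (elim s)
      then have s: "s \<in> {0..T}" "s \<noteq> fst p" by auto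
      show ?case
      proof (cases "fst p < s")
        case True
        with fl have "\<forall>\<^sub>F n in sequentially. fst (q n) < s" by (intro order_tendstoD)
        \<comment> \<open>At terminal time \<open>s\<close> the Feller property covers starting
          times up to \<open>s\<close> only, so finitely many members of the sequence are
          dropped.\<close>
        then obtain M where M: "\<And>n. M \<le> n \<Longrightarrow> fst (q n) < s" by (auto simp: eventually_sequentially)
        have "(\<lambda>n. E (q (n + M)) s) \<longlonglongrightarrow> E p s"
          unfolding E_def
        proof (rule rel_feller_tendsto[OF R s(1) elim(1), where c = 1])
          show "norm (H (s, y)) \<le> 1" for y using bd s by auto
          show "p \<in> {0..s} \<times> UNIV" using True r by (auto simp: mem_Times_iff)
          show "q (n + M) \<in> {0..s} \<times> UNIV" for n using M[of "n + M"] rn[of "n + M"]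
            by (auto simp: mem_Times_iff)
          show "R (fst p) (fst (q (n + M)))" for n using q by blast
          show "(\<lambda>n. d (q (n + M)) p) \<longlonglongrightarrow> 0" using lim by (rule LIMSEQ_ignore_initial_segment)
        qed
        then have "(\<lambda>n. indicator {fst (q (n + M))..T} s *\<^sub>R E (q (n + M)) s)
          \<longlonglongrightarrow> indicator {fst p..T} s *\<^sub>R E p s"
          using M s True by (simp add: indicator_def less_imp_le)
        then show ?thesis by (rule LIMSEQ_offset)
      next
        case False
        then have "s < fst p" using s by simp
        with fl have "\<forall>\<^sub>F n in sequentially. s < fst (q n)" by (intro order_tendstoD)
        then have "\<forall>\<^sub>F n in sequentially. indicator {fst (q n)..T} s *\<^sub>R E (q n) s
          = indicator {fst p..T} s *\<^sub>R E p s"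
          by eventually_elim (use \<open>s < fst p\<close> in \<open>auto simp: indicator_def\<close>)
        then show ?thesis by (rule tendsto_eventually)
      qed
    qed
    show "(\<lambda>s. indicator {fst p..T} s *\<^sub>R E p s) \<in> borel_measurable \<nu>"
      using Em[OF r] tail_sets[OF r] by measurable
    show "(\<lambda>s. indicator {fst (q n)..T} s *\<^sub>R E (q n) s) \<in> borel_measurable \<nu>" for n
      using Em[OF rn] tail_sets[OF rn[of n]] by measurable
    show "AE s in \<nu>. norm (indicator {fst (q n)..T} s *\<^sub>R E (q n) s) \<le> 1" for n
      by (rule AE_I2) (use Eb[OF rn] in \<open>auto simp: indicator_def\<close>)
  qed simp
  have Psi_E: "Psi H z = (\<integral>\<omega>. g (X T \<omega>) \<partial>P (fst z) (snd z)) - (LINT s:{fst z..T}|\<nu>. E z s)"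
    if "z \<in> {0..T} \<times> UNIV" for z
    unfolding E_def by (rule Psi_Fubini[OF H bd that])
  have qT: "q n \<in> {0..T} \<times> UNIV" for n using q by blast
  show "(\<lambda>n. Psi H (q n)) \<longlonglongrightarrow> Psi H p"
    unfolding Psi_E[OF p] Psi_E[OF qT] using 1 2 by (rule tendsto_diff)
qed

text \<open>Uniqueness identifies \<open>u\<close> with the uniform limit of the Picard iterates.
  Each iterate is continuous in the state at fixed times, which makes its composition with
  \<open>h\<close> eligible for \<open>Psi_rel_continuous\<close>.\<close>

lemma fixed_point_rel_continuous:
  assumes u: "u \<in> borel_measurable MT" and fu: "\<And>p. p \<in> {0..T} \<times> UNIV \<Longrightarrow> u p = Psi (gen u) p"
    and R: "rel_feller R" "\<And>s. R s s" and g: "continuous_on UNIV g"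
    and cont: "AE s in \<nu>. continuous_on UNIV (\<lambda>(x, w). h (s, x) w)"
  shows "rel_continuous R d {0..T} u"
proof -
  obtain v B where v: "v \<in> borel_measurable MT" "\<And>p. p \<in> {0..T} \<times> UNIV \<Longrightarrow> v p = Psi (gen v) p"
    and B: "B \<longlonglongrightarrow> 0" "\<And>n p. p \<in> {0..T} \<times> UNIV \<Longrightarrow> norm (picard n p - v p) \<le> B n"
    using Psi_fixed_point_exists by blast
  have uv: "u p = v p" if "p \<in> {0..T} \<times> UNIV" for p
    by (rule Psi_fixed_point_unique[OF u v(1) _ fu v(2) that]) (use T_pos in auto)
  have "rel_continuous R d {0..T} (picard n)" for n
  proof (induct n)
    case 0
    then show ?case by (simp add: rel_continuous_def)
  next
    case (Suc n)
    have "AE s in \<nu>. continuous_on UNIV (\<lambda>y. gen (picard n) (s, y))"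
      using cont AE_space
    proof eventually_elim
      case (elim s)
      then have "continuous_on UNIV (\<lambda>y. picard n (s, y))"
        using rel_continuous_section[OF Suc R(2)] by simp
      then have "continuous_on UNIV (\<lambda>y. (y, picard n (s, y)))" by (intro continuous_intros)
      from continuous_on_compose2[OF elim(1) this] show ?case by simp
    qed
    from Psi_rel_continuous[OF measurable_gen[OF measurable_picard] h_bound R(1) g this]
    show ?case by simp
  qed
  then show ?thesis
    by (rule rel_continuous_uniform_limit[OF pseudometric, of R picard u B]) (use B uv in auto)
qed

end

section \<open>Truncation of the generator\<close>

text \<open>If the mean were outside \<open>K\<close>, a separating linear functional would stay
  above \<open>b\<close> on all values of \<open>Y\<close> while being below \<open>b\<close> at
  their mean.\<close>

lemma (in prob_space) expectation_in_closed_convex: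
  fixes Y :: "'a \<Rightarrow> 'b::euclidean_space"
  assumes "closed K" "convex K" "integrable M Y" "\<And>\<omega>. \<omega> \<in> space M \<Longrightarrow> Y \<omega> \<in> K"
  shows "expectation Y \<in> K"
proof (rule ccontr)
  assume "expectation Y \<notin> K"
  then obtain a b where ab: "inner a (expectation Y) < b" "\<forall>x\<in>K. b < inner a x"
    using separating_hyperplane_closed_point[OF assms(2,1)] by blast
  have "b \<le> expectation (\<lambda>\<omega>. inner a (Y \<omega>))"
  proof (rule integral_ge_const)
    show "integrable M (\<lambda>\<omega>. inner a (Y \<omega>))" using assms(3) by simp
    show "AE \<omega> in M. b \<le> inner a (Y \<omega>)"
      by (rule AE_I2) (use ab assms(4) in \<open>auto intro: less_imp_le\<close>)
  qed
  also have "\<dots> = inner a (expectation Y)" using assms(3) by (intro integral_inner_right) simp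
  finally show False using ab(1) by simp
qed

text \<open>Convex hulls of compact sets are compact in finite dimension. Convexity of
  \<open>D\<close> keeps the hull inside the interior, so every compact set met later can be taken
  convex.\<close>

lemma convex_hull_subset_interior:
  fixes C :: "'a::euclidean_space set"
  assumes "compact C" "C \<subseteq> interior D" "convex D"
  shows "compact (convex hull C)" "convex hull C \<subseteq> interior D" "C \<subseteq> convex hull C"
  by (intro compact_convex_hull assms(1)) (intro hull_minimal assms(2) convex_interior assms(3),
    rule hull_subset)

locale terminal_value_problem = markov_setting T d \<Omega> F X P
  for T :: real
    and d :: "real \<times> 's::{metric_space, second_countable_topology} \<Rightarrow> real \<times> 's \<Rightarrow> real"
    and \<Omega> :: "'w measure" and F X P +
  fixes \<mu> :: "real measure" and D :: "(real^'k) set"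
    and f :: "real \<times> 's \<Rightarrow> real^'k \<Rightarrow> real^'k" and g :: "'s \<Rightarrow> real^'k" and Bg :: real
  assumes sets_\<mu>: "sets \<mu> = sets (restrict_space borel {0..T})"
    and atomless_\<mu>: "atomless \<mu>"
    and D_convex: "convex D"
    and f_BC1m: "f \<in> BC1m T d \<mu> D"
    and g_measurable [measurable]: "g \<in> borel_measurable borel"
    and g_bound: "norm (g x) \<le> Bg"
    and g_consistent: "consistent_terminal T d g"
begin

section \<open>Null times and integrable bounds of the generator\<close>

lemma space_\<mu> [simp]: "space \<mu> = {0..T}"
  using sets_eq_imp_space_eq[OF sets_\<mu>] by (simp add: space_restrict_space)

lemma sets_\<mu>_Int: "A \<in> sets borel \<Longrightarrow> A \<inter> {0..T} \<in> sets \<mu>"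
  by (auto simp: sets_\<mu> sets_restrict_space)

lemma sets_\<mu>_borel: "A \<in> sets \<mu> \<Longrightarrow> A \<in> sets borel"
  by (auto simp: sets_\<mu> sets_restrict_space)

text \<open>Atomlessness would split a singleton of positive mass into two parts of positive mass,
  but one part is empty.\<close>

lemma null_point_\<mu>: "s \<in> {0..T} \<Longrightarrow> {s} \<in> null_sets \<mu>"
proof (rule ccontr)
  assume s: "s \<in> {0..T}" and n: "{s} \<notin> null_sets \<mu>"
  have ss: "{s} \<in> sets \<mu>" using sets_\<mu>_Int[of "{s}"] s by simp
  then have "0 < emeasure \<mu> {s}" using n by (auto simp: null_sets_def zero_less_iff_neq_zero)
  with ss atomless_\<mu> obtain B where "B \<subseteq> {s}" "0 < emeasure \<mu> B" "0 < emeasure \<mu> ({s} - B)"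
    unfolding atomless_def by blast
  then show False by (metis Diff_cancel emeasure_empty less_irrefl subset_singletonD)
qed

lemma measurable_fst_\<mu>: "fst \<in> MT \<rightarrow>\<^sub>M \<mu>"
proof -
  have "fst \<in> MT \<rightarrow>\<^sub>M restrict_space borel {0..T}"
    by (rule measurable_restrict_space2) auto
  then show ?thesis by (subst measurable_cong_sets[OF refl sets_\<mu>])
qed

text \<open>One function is both size bound and Lipschitz constant, since a single density has to
  absorb both. The exceptional null set of times does not depend on \<open>y\<close> or
  \<open>w\<close>.\<close>

definition bound_on :: "(real^'k) set \<Rightarrow> (real \<Rightarrow> real) \<Rightarrow> bool" where
  "bound_on K b \<longleftrightarrow> integrable \<mu> b \<and> (\<forall>s\<in>{0..T}. 0 \<le> b s) \<and>
    (AE s in \<mu>. \<forall>y. \<forall>w\<in>K. norm (f (s, y) w) \<le> b s \<and>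
       (\<forall>w'\<in>K. norm (f (s, y) w - f (s, y) w') \<le> b s * norm (w - w')))"

lemma local_bound:
  assumes w: "w \<in> D"
  shows "\<exists>U b. open U \<and> w \<in> U \<and> bound_on (U \<inter> D) b"
proof -
  have nbhd: "\<exists>V. open V \<and> w \<in> V \<and> V \<inter> D \<subseteq> W" if "nbhd_in (closure D) w W" for W
  proof -
    obtain U where U: "openin (top_of_set (closure D)) U" "w \<in> U" "U \<subseteq> W"
      using \<open>nbhd_in (closure D) w W\<close> unfolding nbhd_in_def by blast
    then obtain V where V: "open V" "U = closure D \<inter> V" unfolding openin_open by blast
    moreover have "V \<inter> D \<subseteq> W" using U V closure_subset by blast
    ultimately show ?thesis using U by blast
  qed
  have "locally_bounded T d \<mu> D f" "locally_Lipschitz T d \<mu> D f" using f_BC1m unfolding BC1m_def by auto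
  from this(1)[unfolded locally_bounded_def, rule_format, OF w] obtain W1 \<Lambda>1 where
    1: "nbhd_in (closure D) w W1" "dominated T d \<mu> \<Lambda>1"
       "\<forall>p\<in>{0..T} \<times> UNIV. \<forall>w\<in>W1 \<inter> D. norm (f p w) \<le> \<Lambda>1 p" by blast
  from \<open>locally_Lipschitz T d \<mu> D f\<close>[unfolded locally_Lipschitz_def, rule_format, OF w] obtain W2 \<Lambda>2 where
    2: "nbhd_in (closure D) w W2" "dominated T d \<mu> \<Lambda>2"
       "\<forall>p\<in>{0..T} \<times> UNIV. \<forall>w\<in>W2 \<inter> D. \<forall>w'\<in>W2 \<inter> D. norm (f p w - f p w') \<le> \<Lambda>2 p * norm (w - w')" by blast
  from nbhd[OF 1(1)] nbhd[OF 2(1)]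
  obtain V1 V2 where V: "open V1" "w \<in> V1" "V1 \<inter> D \<subseteq> W1" "open V2" "w \<in> V2" "V2 \<inter> D \<subseteq> W2"
    by auto
  obtain b1 where b1: "integrable \<mu> b1" "\<forall>s\<in>{0..T}. 0 \<le> b1 s" "AE s in \<mu>. \<forall>y. norm (\<Lambda>1 (s, y)) \<le> b1 s"
    using 1(2) unfolding dominated_def by blast
  obtain b2 where b2: "integrable \<mu> b2" "\<forall>s\<in>{0..T}. 0 \<le> b2 s" "AE s in \<mu>. \<forall>y. norm (\<Lambda>2 (s, y)) \<le> b2 s"
    using 2(2) unfolding dominated_def by blast
  have "bound_on (V1 \<inter> V2 \<inter> D) (\<lambda>s. b1 s + b2 s)"
    unfolding bound_on_def
  proof (intro conjI)
    show "AE s in \<mu>. \<forall>y. \<forall>w\<in>V1 \<inter> V2 \<inter> D. norm (f (s, y) w) \<le> b1 s + b2 s \<and>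
      (\<forall>w'\<in>V1 \<inter> V2 \<inter> D. norm (f (s, y) w - f (s, y) w') \<le> (b1 s + b2 s) * norm (w - w'))"
      using b1(3) b2(3) AE_space
    proof eventually_elim
      case (elim s)
      then have s: "s \<in> {0..T}" by simp
      show ?case
      proof (intro allI ballI conjI)
        fix y :: 's and w assume w: "w \<in> V1 \<inter> V2 \<inter> D"
        have p: "(s, y) \<in> {0..T} \<times> UNIV" using s by simp
        have l1: "\<Lambda>1 (s, y) \<le> b1 s" and l2: "\<Lambda>2 (s, y) \<le> b2 s"
          using elim(1,2)[rule_format, of y] by auto
        have b: "0 \<le> b1 s" "0 \<le> b2 s" using b1(2) b2(2) s by auto
        have "norm (f (s, y) w) \<le> \<Lambda>1 (s, y)" using 1(3)[rule_format, OF p] w V by blast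
        then show "norm (f (s, y) w) \<le> b1 s + b2 s" using l1 b by linarith
        fix w' assume w': "w' \<in> V1 \<inter> V2 \<inter> D"
        have "norm (f (s, y) w - f (s, y) w') \<le> \<Lambda>2 (s, y) * norm (w - w')"
          by (rule 2(3)[rule_format, OF p]) (use w w' V in blast)+
        also have "\<dots> \<le> (b1 s + b2 s) * norm (w - w')" using l2 b by (intro mult_right_mono) auto
        finally show "norm (f (s, y) w - f (s, y) w') \<le> (b1 s + b2 s) * norm (w - w')" .
      qed
    qed
  qed (use b1 b2 in auto)
  moreover have "open (V1 \<inter> V2)" "w \<in> V1 \<inter> V2" using V by auto
  ultimately show ?thesis by blast
qed

text \<open>Close points of \<open>K\<close> lie in a common member of a finite cover, where a local
  Lipschitz bound holds; for distant points the size bound gives a Lipschitz estimate.\<close>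

lemma compact_bound:
  assumes K: "compact K" "K \<subseteq> D"
  shows "\<exists>b. bound_on K b"
proof -
  have "\<forall>w\<in>K. \<exists>U b. open U \<and> w \<in> U \<and> bound_on (U \<inter> D) b" using local_bound K by blast
  then obtain U b where U: "\<And>w. w \<in> K \<Longrightarrow> open (U w)" "\<And>w. w \<in> K \<Longrightarrow> w \<in> U w"
    and b: "\<And>w. w \<in> K \<Longrightarrow> bound_on (U w \<inter> D) (b w)" by metis
  obtain C where C: "C \<subseteq> K" "finite C" "K \<subseteq> (\<Union>c\<in>C. U c)"
    by (rule compactE_image[OF K(1), of K U]) (use U in auto)
  \<comment> \<open>\<open>e\<close> is a Lebesgue number of the cover.\<close>
  obtain e where e: "0 < e" "\<And>w. w \<in> K \<Longrightarrow> \<exists>G\<in>U ` C. ball w e \<subseteq> G"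
    by (rule Heine_Borel_lemma[OF K(1), of "U ` C"]) (use C U in auto)
  define S where "S s = (\<Sum>c\<in>C. b c s)" for s
  have bc: "0 \<le> b c s" if "c \<in> C" "s \<in> {0..T}" for c s
    using b[of c] that C unfolding bound_on_def by blast
  have bS: "b c s \<le> S s" if "c \<in> C" "s \<in> {0..T}" for c s
    unfolding S_def by (rule member_le_sum) (use that bc C in auto)
  have S0: "0 \<le> S s" if "s \<in> {0..T}" for s unfolding S_def using bc that by (intro sum_nonneg) auto
  \<comment> \<open>The summand 1 serves the size bound and pairs closer than \<open>e\<close>; for
    the other pairs a difference of at most \<open>2 * S s\<close> is at most
    \<open>S s * (2 / e)\<close> times the distance.\<close>
  have "bound_on K (\<lambda>s. S s * (1 + 2 / e))"
    unfolding bound_on_def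
  proof (intro conjI ballI)
    show "integrable \<mu> (\<lambda>s. S s * (1 + 2 / e))"
      unfolding S_def using b C by (intro integrable_mult_left Bochner_Integration.integrable_sum)
        (auto simp: bound_on_def)
    show "0 \<le> S s * (1 + 2 / e)" if "s \<in> {0..T}" for s using S0[OF that] e by simp
    have "AE s in \<mu>. \<forall>c\<in>C. \<forall>y. \<forall>w\<in>U c \<inter> D. norm (f (s, y) w) \<le> b c s \<and>
       (\<forall>w'\<in>U c \<inter> D. norm (f (s, y) w - f (s, y) w') \<le> b c s * norm (w - w'))"
      by (rule AE_finite_allI[OF C(2)]) (use b C in \<open>auto simp: bound_on_def\<close>)
    then show "AE s in \<mu>. \<forall>y. \<forall>w\<in>K. norm (f (s, y) w) \<le> S s * (1 + 2 / e) \<and>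
       (\<forall>w'\<in>K. norm (f (s, y) w - f (s, y) w') \<le> S s * (1 + 2 / e) * norm (w - w'))"
      using AE_space
    proof eventually_elim
      case (elim s)
      then have s: "s \<in> {0..T}" by simp
      have le: "norm (f (s, y) w) \<le> S s" if wK: "w \<in> K" for y w
      proof -
        obtain c where "c \<in> C" "w \<in> U c" using C wK by blast
        then have "norm (f (s, y) w) \<le> b c s" using elim(1) wK K by blast
        then show ?thesis using bS[OF \<open>c \<in> C\<close> s] by simp
      qed
      have S1: "S s \<le> S s * (1 + 2 / e)" using S0[OF s] e by (simp add: distrib_left)
      show ?case
      proof (intro allI ballI conjI)
        fix y w assume w: "w \<in> K"
        show "norm (f (s, y) w) \<le> S s * (1 + 2 / e)" using le[OF w] S1 by (rule order_trans)
        fix w' assume w': "w' \<in> K"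
        show "norm (f (s, y) w - f (s, y) w') \<le> S s * (1 + 2 / e) * norm (w - w')"
        proof (cases "norm (w - w') < e")
          case True
          obtain c where c: "c \<in> C" "ball w e \<subseteq> U c" using e(2)[OF w] by blast
          then have "w \<in> U c \<inter> D" "w' \<in> U c \<inter> D" using w w' K True e(1) by (auto simp: dist_norm subset_eq)
          then have "norm (f (s, y) w - f (s, y) w') \<le> b c s * norm (w - w')" using elim(1) c by blast
          also have "\<dots> \<le> S s * (1 + 2 / e) * norm (w - w')"
            using bS[OF c(1) s] S1 by (intro mult_right_mono) auto
          finally show ?thesis .
        next
          case False
          have "norm (f (s, y) w - f (s, y) w') \<le> 2 * S s"
            using norm_triangle_ineq4[of "f (s, y) w" "f (s, y) w'"] le[OF w] le[OF w'] by (smt (verit))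
          also have "2 * S s = S s * (2 / e) * e" using e by simp
          also have "\<dots> \<le> S s * (2 / e) * norm (w - w')" using False S0[OF s] e by (intro mult_left_mono) auto
          also have "\<dots> \<le> S s * (1 + 2 / e) * norm (w - w')"
            using S0[OF s] by (intro mult_right_mono) (auto simp: distrib_left)
          finally show ?thesis .
        qed
      qed
    qed
  qed
  then show ?thesis by blast
qed

text \<open>By the Markov property, the equation of Problem (M) between two times follows from the one
  between the first of them and \<open>T\<close>.\<close>

definition partial_solution :: "real \<Rightarrow> (real \<times> 's \<Rightarrow> real^'k) \<Rightarrow> bool" where
  "partial_solution t u \<longleftrightarrow> t \<in> {0..T} \<and> u \<in> borel_measurable MT \<and>
    (\<exists>K. compact K \<and> convex K \<and> K \<subseteq> interior D \<and> (\<forall>s\<in>{t..T}. \<forall>y. u (s, y) \<in> K)) \<and>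
    (\<forall>r\<in>{t..T}. \<forall>x. u (r, x) = (\<integral>\<omega>. g (X T \<omega>) - (LINT s:{r..T}|\<mu>. f (s, X s \<omega>) (u (s, X s \<omega>))) \<partial>P r x))"

lemma partial_solutionD:
  assumes "partial_solution t u"
  shows "t \<in> {0..T}" "u \<in> borel_measurable MT"
    "\<And>r x. r \<in> {t..T} \<Longrightarrow> u (r, x) = (\<integral>\<omega>. g (X T \<omega>) - (LINT s:{r..T}|\<mu>. f (s, X s \<omega>) (u (s, X s \<omega>))) \<partial>P r x)"
  using assms unfolding partial_solution_def by auto

lemma partial_solution_range:
  assumes "partial_solution t u"
  obtains K where "compact K" "convex K" "K \<noteq> {}" "K \<subseteq> interior D" "K \<subseteq> D"
    "\<And>s y. s \<in> {t..T} \<Longrightarrow> u (s, y) \<in> K"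
proof -
  from assms obtain K where K: "compact K" "convex K" "K \<subseteq> interior D" "\<forall>s\<in>{t..T}. \<forall>y. u (s, y) \<in> K"
    and t: "t \<in> {0..T}" unfolding partial_solution_def by blast
  have "T \<in> {t..T}" using t by simp
  then have "K \<noteq> {}" using K(4) by blast
  moreover have "K \<subseteq> D" using K(3) interior_subset by (rule order_trans)
  ultimately show ?thesis using that[OF K(1,2) _ K(3)] K(4) by blast
qed

end

text \<open>The generator is composed with the nearest-point projection onto a compact convex set, which
  is \<open>K1\<close> before the time \<open>t0\<close> and \<open>K2\<close> from then on, and divided by its bound \<open>b\<close>; in exchange
  \<open>b\<close> becomes the density of the measure on the time interval.\<close>

locale truncation = terminal_value_problem T d \<Omega> F X P \<mu> D f g Bg
  for T :: real
    and d :: "real \<times> 's::{metric_space, second_countable_topology} \<Rightarrow> real \<times> 's \<Rightarrow> real"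
    and \<Omega> :: "'w measure" and F X P \<mu> and D :: "(real^'k) set" and f g Bg +
  fixes K1 K2 :: "(real^'k) set" and t0 :: real and b1 b2 :: "real \<Rightarrow> real"
  assumes K1: "compact K1" "convex K1" "K1 \<noteq> {}" "K1 \<subseteq> D"
    and K2: "compact K2" "convex K2" "K2 \<noteq> {}" "K2 \<subseteq> D"
    and b1: "bound_on K1 b1" and b2: "bound_on K2 b2"
begin

definition cut :: "real \<Rightarrow> (real^'k) set" where "cut s = (if s < t0 then K1 else K2)"
definition b :: "real \<Rightarrow> real" where "b s = b1 s + b2 s"
text \<open>The size bound is the one belonging to the current set and not the sum \<open>b\<close>:
  before \<open>t0\<close> the drift has to be estimated by \<open>b1\<close> alone, independently
  of the solution after \<open>t0\<close>.\<close>

definition regular_time :: "real \<Rightarrow> bool" where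
  "regular_time s \<longleftrightarrow> (\<forall>y. \<forall>w\<in>cut s. norm (f (s, y) w) \<le> (if s < t0 then b1 s else b2 s) \<and>
     (\<forall>w'\<in>cut s. norm (f (s, y) w - f (s, y) w') \<le> b s * norm (w - w')))"
text \<open>The set of irregular times is defined by possibly uncountably many conditions and need
  not be measurable; a measurable null set covering it is selected so that \<open>h\<close> stays
  measurable.\<close>

definition bad :: "real set" where
  "bad = (SOME N. {s \<in> space \<mu>. \<not> regular_time s} \<subseteq> N \<and> N \<in> null_sets \<mu>)"
text \<open>The value 0 at bad times makes the bounds hold at every point, as
  \<open>truncated_problem\<close> demands. Where \<open>b\<close> vanishes at a regular time
  nothing is lost, because \<open>f\<close> vanishes on the truncation set as well.\<close>

definition h :: "real \<times> 's \<Rightarrow> real^'k \<Rightarrow> real^'k" where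
  "h p w = (if fst p \<in> bad \<or> b (fst p) = 0 then 0
     else (1 / b (fst p)) *\<^sub>R f p (closest_point (cut (fst p)) w))"
definition \<nu> :: "real measure" where "\<nu> = density \<mu> (\<lambda>s. ennreal (b s))"

lemma b_nonneg: "s \<in> {0..T} \<Longrightarrow> 0 \<le> b1 s" "s \<in> {0..T} \<Longrightarrow> 0 \<le> b2 s" "s \<in> {0..T} \<Longrightarrow> 0 \<le> b s"
  using b1 b2 unfolding bound_on_def b_def by auto

lemma integrable_b: "integrable \<mu> b1" "integrable \<mu> b"
  using b1 b2 unfolding bound_on_def b_def by auto

lemma measurable_b [measurable]: "b \<in> borel_measurable \<mu>"
  using integrable_b(2) by (rule borel_measurable_integrable)

lemma cut: "closed (cut s)" "convex (cut s)" "cut s \<noteq> {}" "cut s \<subseteq> D"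
  using K1 K2 by (auto simp: cut_def compact_imp_closed)

lemma AE_regular_time: "AE s in \<mu>. regular_time s"
proof -
  have "AE s in \<mu>. \<forall>y. \<forall>w\<in>K1. norm (f (s, y) w) \<le> b1 s \<and>
       (\<forall>w'\<in>K1. norm (f (s, y) w - f (s, y) w') \<le> b1 s * norm (w - w'))"
    "AE s in \<mu>. \<forall>y. \<forall>w\<in>K2. norm (f (s, y) w) \<le> b2 s \<and>
       (\<forall>w'\<in>K2. norm (f (s, y) w - f (s, y) w') \<le> b2 s * norm (w - w'))"
    using b1 b2 unfolding bound_on_def by auto
  then show ?thesis using AE_space
  proof eventually_elim
    case (elim s)
    then have s: "s \<in> {0..T}" by simp
    have m: "b1 s * norm w \<le> b s * norm w" "b2 s * norm w \<le> b s * norm w" for w :: "real^'k"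
      using b_nonneg[OF s] by (auto simp: b_def intro!: mult_right_mono)
    show ?case
    proof (cases "s < t0")
      case True
      then show ?thesis using elim(1) order_trans[OF _ m(1)] unfolding regular_time_def cut_def by simp
    next
      case False
      then show ?thesis using elim(2) order_trans[OF _ m(2)] unfolding regular_time_def cut_def by simp
    qed
  qed
qed

lemma bad_null: "bad \<in> null_sets \<mu>" and regular_time: "s \<in> {0..T} \<Longrightarrow> s \<notin> bad \<Longrightarrow> regular_time s"
proof -
  have "\<exists>N. {s \<in> space \<mu>. \<not> regular_time s} \<subseteq> N \<and> N \<in> null_sets \<mu>"
    using AE_regular_time unfolding eventually_ae_filter by auto
  then have "{s \<in> space \<mu>. \<not> regular_time s} \<subseteq> bad \<and> bad \<in> null_sets \<mu>"
    unfolding bad_def by (rule someI_ex)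
  then show "bad \<in> null_sets \<mu>" "s \<in> {0..T} \<Longrightarrow> s \<notin> bad \<Longrightarrow> regular_time s" by auto
qed

lemma regular_bound: "regular_time s \<Longrightarrow> w \<in> cut s \<Longrightarrow> norm (f (s, y) w) \<le> (if s < t0 then b1 s else b2 s)"
  and regular_Lipschitz: "regular_time s \<Longrightarrow> w \<in> cut s \<Longrightarrow> w' \<in> cut s \<Longrightarrow>
    norm (f (s, y) w - f (s, y) w') \<le> b s * norm (w - w')"
  unfolding regular_time_def by auto

lemma f_eq_h:
  assumes s: "s \<in> {0..T}" "s \<notin> bad" and w: "w \<in> cut s"
  shows "f (s, y) w = b s *\<^sub>R h (s, y) w"
proof (cases "b s = 0")
  case True
  have "norm (f (s, y) w) \<le> b s"
    using regular_bound[OF regular_time[OF s] w, of y] b_nonneg[OF s(1)]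
      by (auto simp: b_def split: if_splits)
  then show ?thesis using True by simp
next
  case False
  then show ?thesis using s w by (simp add: h_def closest_point_self)
qed

lemma scaled_h_bound:
  assumes s: "s \<in> {0..T}"
  shows "b s * norm (h (s, y) w) \<le> (if s < t0 then b1 s else b2 s)"
proof (cases "s \<in> bad \<or> b s = 0")
  case True
  then show ?thesis using b_nonneg[OF s] by (auto simp: h_def)
next
  case False
  then have "b s * norm (h (s, y) w) = norm (f (s, y) (closest_point (cut s) w))"
    using b_nonneg[OF s] by (simp add: h_def)
  also have "\<dots> \<le> (if s < t0 then b1 s else b2 s)"
    by (rule regular_bound[OF regular_time]) (use False s cut in \<open>auto intro: closest_point_in_set\<close>)
  finally show ?thesis .
qed

lemma sets_\<nu>_\<mu>: "sets \<nu> = sets \<mu>" by (simp add: \<nu>_def)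

text \<open>\<open>f\<close> is measurable on \<open>D\<close> only; the projection is measurable,
  being continuous before and after \<open>t0\<close>, and takes its values in
  \<open>D\<close>.\<close>

lemma measurable_f_cut:
  "(\<lambda>q. f (fst q) (closest_point (cut (fst (fst q))) (snd q))) \<in> borel_measurable (MT \<Otimes>\<^sub>M borel)"
proof -
  have fm: "(\<lambda>(p, w). f p w) \<in> borel_measurable (MT \<Otimes>\<^sub>M restrict_space borel D)"
    using f_BC1m unfolding BC1m_def by auto
  have ff': "(\<lambda>q. fst (fst q)) \<in> borel_measurable (MT \<Otimes>\<^sub>M (borel :: (real^'k) measure))"
    by (rule measurable_compose[OF measurable_fst measurable_fst_MT])
  have cp: "(\<lambda>q. closest_point K (snd q)) \<in> borel_measurable (MT \<Otimes>\<^sub>M (borel :: (real^'k) measure))"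
    if "compact K" "convex K" "K \<noteq> {}" for K
    by (rule measurable_compose[OF measurable_snd borel_measurable_continuous_onI[OF
      continuous_on_closest_point]])
       (use that compact_imp_closed in auto)
  have "(\<lambda>q. if fst (fst q) < t0 then closest_point K1 (snd q) else closest_point K2 (snd q))
      \<in> borel_measurable (MT \<Otimes>\<^sub>M (borel :: (real^'k) measure))"
    using cp[OF K1(1-3)] cp[OF K2(1-3)] ff' by measurable
  then have "(\<lambda>q. closest_point (cut (fst (fst q))) (snd q))
    \<in> borel_measurable (MT \<Otimes>\<^sub>M (borel :: (real^'k) measure))"
    by (rule measurable_cong[THEN iffD1, rotated]) (auto simp: cut_def)
  then have "(\<lambda>q. closest_point (cut (fst (fst q))) (snd q))
    \<in> MT \<Otimes>\<^sub>M (borel :: (real^'k) measure) \<rightarrow>\<^sub>M restrict_space borel D"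
  proof (rule measurable_restrict_space2[rotated], intro funcsetI)
    show "closest_point (cut (fst (fst q))) (snd q) \<in> D" for q
      using closest_point_in_set[OF cut(1,3)] cut(4) by blast
  qed
  then have "(\<lambda>q. (fst q, closest_point (cut (fst (fst q))) (snd q)))
    \<in> MT \<Otimes>\<^sub>M (borel :: (real^'k) measure) \<rightarrow>\<^sub>M MT \<Otimes>\<^sub>M restrict_space borel D"
    by (intro measurable_Pair measurable_fst)
  from measurable_compose[OF this fm] show ?thesis by simp
qed

lemma measurable_h: "(\<lambda>(p, w). h p w) \<in> borel_measurable (MT \<Otimes>\<^sub>M borel)"
proof -
  have ff: "(\<lambda>q. fst (fst q)) \<in> MT \<Otimes>\<^sub>M (borel :: (real^'k) measure) \<rightarrow>\<^sub>M \<mu>"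
    by (rule measurable_compose[OF measurable_fst measurable_fst_\<mu>])
  have ff': "(\<lambda>q. fst (fst q)) \<in> borel_measurable (MT \<Otimes>\<^sub>M (borel :: (real^'k) measure))"
    by (rule measurable_compose[OF measurable_fst measurable_fst_MT])
  have bb[measurable]: "(\<lambda>q. b (fst (fst q))) \<in> borel_measurable (MT \<Otimes>\<^sub>M (borel :: (real^'k) measure))"
    by (rule measurable_compose[OF ff measurable_b])
  have "bad \<in> sets borel" using bad_null sets_\<mu>_borel by (auto simp: null_sets_def)
  then have bd[measurable]: "Measurable.pred (MT \<Otimes>\<^sub>M (borel :: (real^'k) measure)) (\<lambda>q. fst (fst q) \<in> bad)"
    using ff' by measurable
  note measurable_f_cut[measurable]
  have "(\<lambda>q. if fst (fst q) \<in> bad \<or> b (fst (fst q)) = 0 then 0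
     else (1 / b (fst (fst q))) *\<^sub>R f (fst q) (closest_point (cut (fst (fst q))) (snd q)))
    \<in> borel_measurable (MT \<Otimes>\<^sub>M (borel :: (real^'k) measure))"
    by measurable
  then show ?thesis by (simp add: h_def case_prod_beta')
qed

sublocale truncated_problem T d \<Omega> F X P \<nu> g Bg h
proof (rule truncated_problem.intro[OF markov_setting_axioms truncated_problem_axioms.intro])
  show "sets \<nu> = sets (restrict_space borel {0..T})" using sets_\<nu>_\<mu> sets_\<mu> by simp
  show "finite_measure \<nu>"
  proof (rule finite_measureI)
    have "emeasure \<nu> (space \<nu>) = (\<integral>\<^sup>+s. ennreal (b s) \<partial>\<mu>)"
    proof -
      have "emeasure \<nu> (space \<nu>) = (\<integral>\<^sup>+s. ennreal (b s) * indicator {0..T} s \<partial>\<mu>)"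
        unfolding \<nu>_def using sets_\<mu>_Int[of UNIV] by (subst emeasure_density) auto
      also have "\<dots> = (\<integral>\<^sup>+s. ennreal (b s) \<partial>\<mu>)"
        by (rule nn_integral_cong) auto
      finally show ?thesis .
    qed
    also have "\<dots> = ennreal (\<integral>s. b s \<partial>\<mu>)"
      by (rule nn_integral_eq_integral[OF integrable_b(2)], rule AE_I2) (use b_nonneg in auto)
    finally show "emeasure \<nu> (space \<nu>) \<noteq> \<infinity>" by simp
  qed
  show "emeasure \<nu> {s} = 0" if "s \<in> {0..T}" for s
  proof -
    have "{s} \<in> null_sets \<nu>"
      unfolding \<nu>_def
    proof (subst null_sets_density_iff, safe)
      show "{s} \<in> sets \<mu>" using null_point_\<mu>[OF that] by (simp add: null_sets_def)
      show "AE x in \<mu>. x \<in> {s} \<longrightarrow> ennreal (b x) = 0"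
        using AE_not_in[OF null_point_\<mu>[OF that]] by eventually_elim simp
    qed measurable
    then show ?thesis by (simp add: null_sets_def)
  qed
  show "norm (g x) \<le> Bg" for x by (rule g_bound)
  show "(\<lambda>(p, w). h p w) \<in> borel_measurable (MT \<Otimes>\<^sub>M borel)" by (rule measurable_h)
  fix p :: "real \<times> 's" and w w' :: "real^'k" assume "p \<in> {0..T} \<times> UNIV"
  then obtain s y where p: "p = (s, y)" and s: "s \<in> {0..T}" by auto
  have "b s * norm (h p w) \<le> b s"
    using scaled_h_bound[OF s, of y w] b_nonneg[OF s] unfolding p by (auto simp: b_def split: if_splits)
  then show "norm (h p w) \<le> 1"
    using b_nonneg(3)[OF s] by (cases "b s = 0") (auto simp: p h_def mult_le_cancel_left1)
  show "norm (h p w - h p w') \<le> norm (w - w')"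
  proof (cases "s \<in> bad \<or> b s = 0")
    case True
    then show ?thesis by (auto simp: h_def p)
  next
    case False
    let ?c = "closest_point (cut s)"
    have bs: "0 < b s" using False b_nonneg(3)[OF s] by auto
    have "norm (f p (?c w) - f p (?c w')) \<le> b s * norm (?c w - ?c w')"
      unfolding p by (rule regular_Lipschitz[OF regular_time]) (use False s cut in \<open>auto intro:
        closest_point_in_set\<close>)
    \<comment> \<open>The nearest-point projection onto a closed convex set does not increase
      distances; this is why the truncation sets are convex.\<close>
    also have "\<dots> \<le> b s * norm (w - w')"
      using closest_point_lipschitz[OF cut(2)[of s] cut(1)[of s] cut(3)[of s], of w w'] bs
        by (simp add: dist_norm)
    finally have "norm (f p (?c w) - f p (?c w')) / b s \<le> norm (w - w')"
      using bs by (simp add: field_simps)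
    moreover have "h p w - h p w' = (1 / b s) *\<^sub>R (f p (?c w) - f p (?c w'))"
      using False by (simp add: h_def p scaleR_diff_right)
    ultimately show ?thesis using bs by simp
  qed
qed (rule g_measurable)

end

section \<open>Transfer between the original and the truncated equation\<close>

context truncation
begin

lemma AE_not_bad: "AE s in \<mu>. s \<in> {0..T} \<and> s \<notin> bad"
  using AE_not_in[OF bad_null] AE_space by eventually_elim simp

lemma measurable_\<nu>_\<mu>: "borel_measurable \<nu> = borel_measurable \<mu>"
  by (rule measurable_cong_sets) (simp_all add: sets_\<nu>_\<mu>)

text \<open>As long as \<open>u\<close> stays in the truncation set, the projection is the identity
  and \<open>f = b h\<close> off the null set \<open>bad\<close>; the rest is the change of density
  from \<open>\<mu>\<close> to \<open>\<nu>\<close>.\<close>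

lemma
  assumes u: "u \<in> borel_measurable MT" and A: "A \<in> sets borel"
    and cutA: "\<And>s y. s \<in> A \<Longrightarrow> s \<in> {0..T} \<Longrightarrow> u (s, y) \<in> cut s" and \<omega>: "\<omega> \<in> space \<Omega>"
  shows set_integrable_generator: "set_integrable \<mu> A (\<lambda>s. f (s, X s \<omega>) (u (s, X s \<omega>)))"
    and set_integral_generator:
      "(LINT s:A|\<mu>. f (s, X s \<omega>) (u (s, X s \<omega>))) = (LINT s:A|\<nu>. gen u (s, X s \<omega>))"
    and set_integral_norm_generator:
      "(LINT s:A|\<mu>. norm (f (s, X s \<omega>) (u (s, X s \<omega>)))) = (LINT s:A|\<nu>. norm (gen u (s, X s \<omega>)))"
proof -
  let ?f = "\<lambda>s. f (s, X s \<omega>) (u (s, X s \<omega>))" and ?h = "\<lambda>s. gen u (s, X s \<omega>)"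
  have b0: "AE s in \<mu>. 0 \<le> b s" using b_nonneg(3) by (intro AE_I2) simp
  have "integrable \<nu> ?h"
    by (rule integrable_bounded[of _ 1]) (use measurable_path[OF measurable_gen[OF u] \<omega>] h_bound in auto)
  from set_integrable_sub[OF this A] have int: "integrable \<nu> (\<lambda>s. indicator A s *\<^sub>R ?h s)"
    by (simp add: set_integrable_def)
  then have hm: "(\<lambda>s. indicator A s *\<^sub>R ?h s) \<in> borel_measurable \<mu>"
    unfolding measurable_\<nu>_\<mu>[symmetric] by (rule borel_measurable_integrable)
  \<comment> \<open>Since \<open>f\<close> is measurable on \<open>D\<close> only, measurability
    along the path is first obtained for the projected argument, which agrees with \<open>u\<close>
    over \<open>A\<close>.\<close>
  have "(\<lambda>p. (p, u p)) \<in> MT \<rightarrow>\<^sub>M MT \<Otimes>\<^sub>M borel" using u by measurable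
  from measurable_path[OF measurable_compose[OF this measurable_f_cut] \<omega>]
  have fc: "(\<lambda>s. f (s, X s \<omega>) (closest_point (cut s) (u (s, X s \<omega>)))) \<in> borel_measurable \<mu>"
    by (simp add: measurable_\<nu>_\<mu>)
  have Am: "A \<inter> space \<mu> \<in> sets \<mu>" using sets_\<mu>_Int[OF A] by simp
  have "(\<lambda>s. indicator A s *\<^sub>R f (s, X s \<omega>) (closest_point (cut s) (u (s, X s \<omega>)))) \<in> borel_measurable \<mu>"
    using fc by (intro borel_measurable_scaleR borel_measurable_indicator' ) (use Am in \<open>auto simp:
      Int_def conj_commute\<close>)
  then have fm: "(\<lambda>s. indicator A s *\<^sub>R ?f s) \<in> borel_measurable \<mu>"
    by (rule measurable_cong[THEN iffD1, rotated]) (use cutA in \<open>auto simp: indicator_def closest_point_self\<close>)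
  have ae: "AE s in \<mu>. b s *\<^sub>R (indicator A s *\<^sub>R ?h s) = indicator A s *\<^sub>R ?f s"
    using AE_not_bad
  proof eventually_elim
    case (elim s)
    show ?case
    proof (cases "s \<in> A")
      case True
      then show ?thesis using f_eq_h[OF _ _ cutA[OF True], of "X s \<omega>" "X s \<omega>"] elim by simp
    qed simp
  qed
  have "integrable \<mu> (\<lambda>s. b s *\<^sub>R (indicator A s *\<^sub>R ?h s))"
    using int unfolding \<nu>_def by (subst (asm) integrable_density[OF hm measurable_b b0])
  then show "set_integrable \<mu> A ?f"
    unfolding set_integrable_def
    by (rule integrable_cong_AE_imp[OF _ fm]) (use ae in \<open>auto elim: eventually_mono\<close>)
  show "(LINT s:A|\<mu>. ?f s) = (LINT s:A|\<nu>. ?h s)"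
    unfolding set_lebesgue_integral_def \<nu>_def
  proof (subst integral_density[OF hm measurable_b b0], rule integral_cong_AE[OF fm])
    show "(\<lambda>s. b s *\<^sub>R (indicator A s *\<^sub>R ?h s)) \<in> borel_measurable \<mu>" using hm by measurable
    show "AE s in \<mu>. indicator A s *\<^sub>R ?f s = b s *\<^sub>R (indicator A s *\<^sub>R ?h s)"
      using ae by eventually_elim simp
  qed
  have ind: "indicator A s *\<^sub>R norm v = norm (indicator A s *\<^sub>R v)" for s and v :: "real^'k"
    by (simp add: indicator_def)
  have "(\<integral>s. norm (indicator A s *\<^sub>R ?f s) \<partial>\<mu>) = (\<integral>s. norm (indicator A s *\<^sub>R ?h s) \<partial>\<nu>)"
    unfolding \<nu>_def
  proof (subst integral_density[OF _ measurable_b b0])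
    show "(\<lambda>s. norm (indicator A s *\<^sub>R ?h s)) \<in> borel_measurable \<mu>" using hm by measurable
    show "(\<integral>s. norm (indicator A s *\<^sub>R ?f s) \<partial>\<mu>) = (\<integral>s. b s *\<^sub>R norm (indicator A s *\<^sub>R ?h s) \<partial>\<mu>)"
    proof (rule integral_cong_AE)
      show "AE s in \<mu>. norm (indicator A s *\<^sub>R ?f s) = b s *\<^sub>R norm (indicator A s *\<^sub>R ?h s)"
        using ae b0
      proof eventually_elim
        case (elim s)
        show ?case unfolding elim(1)[symmetric] using elim(2) by simp
      qed
      show "(\<lambda>s. norm (indicator A s *\<^sub>R ?f s)) \<in> borel_measurable \<mu>" using fm by measurable
      show "(\<lambda>s. b s *\<^sub>R norm (indicator A s *\<^sub>R ?h s)) \<in> borel_measurable \<mu>" using hm by measurable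
    qed
  qed
  then show "(LINT s:A|\<mu>. norm (?f s)) = (LINT s:A|\<nu>. norm (?h s))"
    unfolding set_lebesgue_integral_def ind .
qed

lemma path_integral_eq:
  assumes "u \<in> borel_measurable MT" "r \<in> {0..T}" "\<And>s y. s \<in> {r..T} \<Longrightarrow> u (s, y) \<in> cut s" "\<omega> \<in> space \<Omega>"
  shows "(LINT s:{r..T}|\<mu>. f (s, X s \<omega>) (u (s, X s \<omega>))) = path_integral (gen u) r \<omega>"
  unfolding path_integral_def by (rule set_integral_generator) (use assms in auto)

lemma Psi_eq:
  assumes "u \<in> borel_measurable MT" "r \<in> {0..T}" "\<And>s y. s \<in> {r..T} \<Longrightarrow> u (s, y) \<in> cut s"
  shows "(\<integral>\<omega>. g (X T \<omega>) - (LINT s:{r..T}|\<mu>. f (s, X s \<omega>) (u (s, X s \<omega>))) \<partial>P r x) = Psi (gen u) (r, x)"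
  unfolding Psi_def fst_conv snd_conv
  by (rule Bochner_Integration.integral_cong) (use path_integral_eq[OF assms] assms(2) in \<open>auto
    simp: space_P\<close>)

lemma partial_solution_fixed_point:
  assumes u: "partial_solution t u" and cut: "\<And>s y. s \<in> {t..T} \<Longrightarrow> u (s, y) \<in> cut s"
    and p: "p \<in> {t..T} \<times> UNIV"
  shows "u p = Psi (gen u) p"
proof -
  obtain r x where rx: "p = (r, x)" "r \<in> {t..T}" using p by auto
  have "(\<integral>\<omega>. g (X T \<omega>) - (LINT s:{r..T}|\<mu>. f (s, X s \<omega>) (u (s, X s \<omega>))) \<partial>P r x) = Psi (gen u) (r, x)"
    by (rule Psi_eq) (use rx cut partial_solutionD[OF u] in auto)
  then show ?thesis using partial_solutionD(3)[OF u rx(2), of x] rx by simp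
qed

text \<open>Written with respect to \<open>\<mu>\<close>, the integrand has size
  \<open>b * norm h\<close>, which before \<open>t0\<close> is at most \<open>b1\<close>. The
  estimate involves neither \<open>b2\<close> nor the values of \<open>u\<close>.\<close>

lemma short_time_bound:
  assumes u: "u \<in> borel_measurable MT" and r: "0 \<le> r" and t: "t0 \<in> {0..T}" and \<omega>: "\<omega> \<in> space \<Omega>"
  shows "norm (LINT s:{r..t0}|\<nu>. gen u (s, X s \<omega>)) \<le> (LINT s:{r..t0}|\<mu>. b1 s)"
proof -
  let ?h = "\<lambda>s. gen u (s, X s \<omega>)"
  have b0: "AE s in \<mu>. 0 \<le> b s" using b_nonneg(3) by (intro AE_I2) simp
  have "integrable \<nu> ?h"
    by (rule integrable_bounded[of _ 1]) (use measurable_path[OF measurable_gen[OF u] \<omega>] h_bound in auto)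
  from set_integrable_sub[OF this, of "{r..t0}"] have int: "integrable \<nu> (\<lambda>s. indicator {r..t0} s *\<^sub>R ?h s)"
    by (simp add: set_integrable_def)
  then have hm: "(\<lambda>s. indicator {r..t0} s *\<^sub>R ?h s) \<in> borel_measurable \<mu>"
    unfolding measurable_\<nu>_\<mu>[symmetric] by (rule borel_measurable_integrable)
  have "{r..t0} \<in> sets \<mu>" using sets_\<mu>_Int[of "{r..t0}"] r t by (auto simp: Int_absorb2)
  then have ib: "integrable \<mu> (\<lambda>s. indicator {r..t0} s *\<^sub>R b1 s)"
    using integrable_b(1) by (rule integrable_mult_indicator)
  have "norm (LINT s:{r..t0}|\<nu>. ?h s) = norm (\<integral>s. b s *\<^sub>R (indicator {r..t0} s *\<^sub>R ?h s) \<partial>\<mu>)"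
    unfolding set_lebesgue_integral_def \<nu>_def by (subst integral_density[OF hm measurable_b b0]) simp
  also have "\<dots> \<le> (\<integral>s. norm (b s *\<^sub>R (indicator {r..t0} s *\<^sub>R ?h s)) \<partial>\<mu>)" by (rule integral_norm_bound)
  also have "\<dots> \<le> (\<integral>s. indicator {r..t0} s *\<^sub>R b1 s \<partial>\<mu>)"
  proof (rule integral_mono_AE'[OF ib])
    show "AE s in \<mu>. norm (b s *\<^sub>R (indicator {r..t0} s *\<^sub>R ?h s)) \<le> indicator {r..t0} s *\<^sub>R b1 s"
      \<comment> \<open>At \<open>s = t0\<close> the second set is already in force, so this null
        point has to be removed.\<close>
      using AE_not_in[OF null_point_\<mu>[OF t]] AE_space
    proof eventually_elim
      case (elim s)
      then show ?case
        using scaled_h_bound[of s "X s \<omega>" "u (s, X s \<omega>)"] b_nonneg[of s] by (auto simp: indicator_def)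
    qed
    show "AE s in \<mu>. 0 \<le> indicator {r..t0} s *\<^sub>R b1 s"
      by (rule AE_I2) (use b_nonneg in \<open>auto simp: indicator_def\<close>)
  qed
  finally show ?thesis by (simp add: set_lebesgue_integral_def)
qed

lemma AE_continuous_h:
  assumes "AE s in \<mu>. continuous_on (UNIV \<times> D) (\<lambda>(x, w). f (s, x) w)"
  shows "AE s in \<nu>. continuous_on UNIV (\<lambda>(x, w). h (s, x) w)"
  unfolding \<nu>_def
proof (subst AE_density)
  show "AE s in \<mu>. 0 < ennreal (b s) \<longrightarrow> continuous_on UNIV (\<lambda>(x, w). h (s, x) w)"
    using assms
  proof eventually_elim
    case (elim s)
    show ?case
    proof (cases "s \<in> bad \<or> b s = 0")
      case True
      then have "(\<lambda>(x, w). h (s, x) w) = (\<lambda>_. 0)" by (auto simp: h_def fun_eq_iff)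
      then show ?thesis by simp
    next
      case False
      have "continuous_on UNIV (\<lambda>q :: 's \<times> (real^'k). (fst q, closest_point (cut s) (snd q)))"
        by (intro continuous_intros continuous_on_compose2[OF continuous_on_closest_point[OF
          cut(2,1,3), of UNIV]]) auto
      moreover have "(\<lambda>q :: 's \<times> (real^'k). (fst q, closest_point (cut s) (snd q))) ` UNIV \<subseteq> UNIV \<times> D"
        using closest_point_in_set[OF cut(1,3)] cut(4) by auto
      ultimately have "continuous_on UNIV (\<lambda>q. (\<lambda>(x, w). f (s, x) w) (fst q, closest_point (cut s) (snd q)))"
        by (rule continuous_on_compose2[OF elim])
      then have "continuous_on UNIV (\<lambda>q. (1 / b s) *\<^sub>R f (s, fst q) (closest_point (cut s) (snd q)))"
        by (intro continuous_intros) simp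
      then show ?thesis using False by (simp add: h_def case_prod_beta')
    qed
  qed
qed (use measurable_b in measurable)

end

section \<open>Uniqueness, continuation and regularity of partial solutions\<close>

context terminal_value_problem
begin

lemma partial_solution_mono: "partial_solution t u \<Longrightarrow> t \<le> t' \<Longrightarrow> t' \<le> T \<Longrightarrow> partial_solution t' u"
  unfolding partial_solution_def by auto

lemma partial_solution_cong:
  assumes u: "partial_solution t u" and v: "v \<in> borel_measurable MT"
    and eq: "\<And>s y. s \<in> {t..T} \<Longrightarrow> v (s, y) = u (s, y)"
  shows "partial_solution t v"
  unfolding partial_solution_def
proof (intro conjI ballI allI)
  show "\<exists>K. compact K \<and> convex K \<and> K \<subseteq> interior D \<and> (\<forall>s\<in>{t..T}. \<forall>y. v (s, y) \<in> K)"
    using u eq unfolding partial_solution_def by auto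
  fix r x assume r: "r \<in> {t..T}"
  have "(LINT s:{r..T}|\<mu>. f (s, X s \<omega>) (u (s, X s \<omega>))) = (LINT s:{r..T}|\<mu>. f (s, X s \<omega>) (v (s, X s \<omega>)))" for \<omega>
    unfolding set_lebesgue_integral_def
    by (rule Bochner_Integration.integral_cong) (use r eq in \<open>auto simp: indicator_def\<close>)
  then show "v (r, x) = (\<integral>\<omega>. g (X T \<omega>) - (LINT s:{r..T}|\<mu>. f (s, X s \<omega>) (v (s, X s \<omega>))) \<partial>P r x)"
    using partial_solutionD(3)[OF u r, of x] eq[OF r] by simp
qed (use partial_solutionD[OF u] v in auto)

lemma truncationI:
  assumes "compact K1" "convex K1" "K1 \<noteq> {}" "K1 \<subseteq> D" "bound_on K1 b1"
    and "compact K2" "convex K2" "K2 \<noteq> {}" "K2 \<subseteq> D" "bound_on K2 b2"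
  shows "truncation T d \<Omega> F X P \<mu> D f g Bg K1 K2 b1 b2"
  using assms by unfold_locales

text \<open>Both ranges lie in one compact convex subset of the interior, the hull of their union.
  Truncated there, \<open>u\<close> and \<open>v\<close> are fixed points of the same contraction on
  \<open>[t,T]\<close>.\<close>

lemma partial_solution_unique:
  assumes u: "partial_solution t u" and v: "partial_solution t v" and s: "s \<in> {t..T}"
  shows "u (s, y) = v (s, y)"
proof -
  obtain Ku where Ku: "compact Ku" "convex Ku" "Ku \<noteq> {}" "Ku \<subseteq> interior D" "\<And>s y. s \<in> {t..T} \<Longrightarrow> u (s, y) \<in> Ku"
    by (rule partial_solution_range[OF u]) blast
  obtain Kv where Kv: "compact Kv" "convex Kv" "Kv \<noteq> {}" "Kv \<subseteq> interior D" "\<And>s y. s \<in> {t..T} \<Longrightarrow> v (s, y) \<in> Kv"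
    by (rule partial_solution_range[OF v]) blast
  define K where "K = convex hull (Ku \<union> Kv)"
  have "compact (Ku \<union> Kv)" "Ku \<union> Kv \<subseteq> interior D" using Ku Kv by auto
  note hull = convex_hull_subset_interior[OF this D_convex, folded K_def]
  have K: "compact K" "convex K" "Ku \<subseteq> K" "Kv \<subseteq> K"
    using hull by (auto simp: K_def)
  have KD: "K \<subseteq> D" using hull(2) interior_subset by (rule order_trans)
  obtain b where b: "bound_on K b" using compact_bound[OF K(1) KD] by blast
  \<comment> \<open>With equal sets the switching time is immaterial; any value such as 0 will
    do.\<close>
  interpret truncation T d \<Omega> F X P \<mu> D f g Bg K K 0 b b
    by (rule truncationI) (use K KD b Ku in auto)
  have t: "t \<in> {0..T}" using partial_solutionD[OF u] by simp
  have uK: "u (s, y) \<in> cut s" and vK: "v (s, y) \<in> cut s" if "s \<in> {t..T}" for s y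
    using Ku(5)[OF that, of y] Kv(5)[OF that, of y] K by (auto simp: cut_def)
  show ?thesis
  proof (rule Psi_fixed_point_unique[OF partial_solutionD(2)[OF u] partial_solutionD(2)[OF v] t])
    show "u p = Psi (gen u) p" if "p \<in> {t..T} \<times> UNIV" for p
      by (rule partial_solution_fixed_point[OF u uK that])
    show "v p = Psi (gen v) p" if "p \<in> {t..T} \<times> UNIV" for p
      by (rule partial_solution_fixed_point[OF v vK that])
    show "(s, y) \<in> {t..T} \<times> UNIV" using s by simp
  qed
qed

text \<open>The truncated equation is solvable on all of \<open>[0,T]\<close>, so the task is to see
  that truncation is inactive on \<open>[t1,T]\<close>. The quantities \<open>\<delta>\<close>,
  \<open>K'\<close> and \<open>\<beta>\<close> refer to the values at \<open>t0\<close> only through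
  \<open>K\<close>, which makes the step uniform over all solutions with values in \<open>K\<close>
  at their starting time.\<close>

lemma partial_solution_extend:
  assumes u: "partial_solution t0 u" and K: "compact K" "convex K" "\<And>y. u (t0, y) \<in> K"
    and K': "compact K'" "convex K'" "K' \<subseteq> interior D" and \<delta>: "0 \<le> \<delta>"
    and thick: "\<And>a e. a \<in> K \<Longrightarrow> norm e \<le> \<delta> \<Longrightarrow> a + e \<in> K'"
    and \<beta>: "bound_on K' \<beta>" and t1: "0 \<le> t1" "t1 \<le> t0" and small: "(LINT s:{t1..t0}|\<mu>. \<beta> s) \<le> \<delta>"
  shows "\<exists>v. partial_solution t1 v"
proof -
  obtain K2 where uK2: "compact K2" "convex K2" "K2 \<noteq> {}" "K2 \<subseteq> interior D" "K2 \<subseteq> D" "\<And>s y. s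
    \<in> {t0..T} \<Longrightarrow> u (s, y) \<in> K2"
    by (rule partial_solution_range[OF u]) blast
  have t0: "t0 \<in> {0..T}" and um: "u \<in> borel_measurable MT" using partial_solutionD[OF u] by auto
  obtain b2 where b2: "bound_on K2 b2" using compact_bound[OF uK2(1,5)] by blast
  have KK': "K \<subseteq> K'" using thick[of _ 0] \<delta> by auto
  have K'D: "K' \<subseteq> D" using K'(3) interior_subset by blast
  \<comment> \<open>After \<open>t0\<close> the range of \<open>u\<close> is kept as truncation set,
    so that the new solution reproduces \<open>u\<close> there.\<close>
  interpret truncation T d \<Omega> F X P \<mu> D f g Bg K' K2 t0 \<beta> b2
    by (rule truncationI) (use K K' KK' K'D uK2 \<beta> b2 in auto)
  obtain v where v: "v \<in> borel_measurable MT" "\<And>p. p \<in> {0..T} \<times> UNIV \<Longrightarrow> v p = Psi (gen v) p"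
    by (rule Psi_fixed_point_exists) blast
  have uv: "v p = u p" if p: "p \<in> {t0..T} \<times> UNIV" for p
  proof (rule Psi_fixed_point_unique[OF v(1) um t0 _ _ p])
    show "v q = Psi (gen v) q" if "q \<in> {t0..T} \<times> UNIV" for q using v(2) that t0 by auto
    show "u q = Psi (gen u) q" if "q \<in> {t0..T} \<times> UNIV" for q
      by (rule partial_solution_fixed_point[OF u _ that]) (use uK2(6) in \<open>simp add: cut_def\<close>)
  qed
  have before: "v (r, x) \<in> K'" if r: "r \<in> {t1..t0}" for r x
  proof -
    have rT: "r \<in> {0..T}" "0 \<le> r" "r \<le> t0" "t0 \<le> T" using r t1 t0 by auto
    interpret PP: prob_space "P r x" using rT(1) by (rule prob_space_P)
    let ?J = "\<lambda>\<omega>. LINT s:{r..t0}|\<nu>. gen v (s, X s \<omega>)"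
    note gv = measurable_gen[OF v(1)]
    have sp: "space (P r x) = space \<Omega>" using space_P rT by simp
    have i1: "integrable (P r x) (\<lambda>\<omega>. g (X T \<omega>) - path_integral (gen v) t0 \<omega>)"
      by (rule integrable_Psi_integrand[OF gv h_bound rT(1) t0])
    have i2: "integrable (P r x) (\<lambda>\<omega>. g (X T \<omega>) - path_integral (gen v) r \<omega>)"
      by (rule integrable_Psi_integrand[OF gv h_bound rT(1) rT(1)])
    have J: "?J \<omega> = (g (X T \<omega>) - path_integral (gen v) t0 \<omega>) - (g (X T \<omega>) - path_integral (gen v) r \<omega>)"
      if "\<omega> \<in> space \<Omega>" for \<omega>
      using path_integral_split[OF gv h_bound rT(2-4) that] by simp
    have "integrable (P r x) ?J"
      using Bochner_Integration.integrable_diff[OF i1 i2]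
      by (rule Bochner_Integration.integrable_cong[THEN iffD1, OF refl, rotated]) (use J sp in auto)
    have "(\<integral>\<omega>. ?J \<omega> \<partial>P r x) = (\<integral>\<omega>. (g (X T \<omega>) - path_integral (gen v) t0 \<omega>) - (g (X T \<omega>) -
      path_integral (gen v) r \<omega>) \<partial>P r x)"
      by (rule Bochner_Integration.integral_cong) (use J sp in auto)
    also have "\<dots> = (\<integral>\<omega>. g (X T \<omega>) - path_integral (gen v) t0 \<omega> \<partial>P r x) - Psi (gen v) (r, x)"
      using Bochner_Integration.integral_diff[OF i1 i2] by (simp add: Psi_def)
    also have "(\<integral>\<omega>. g (X T \<omega>) - path_integral (gen v) t0 \<omega> \<partial>P r x) = (\<integral>\<omega>. Psi (gen v) (t0, X t0 \<omega>) \<partial>P r x)"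
      by (rule Psi_markov[OF gv h_bound rT(2-4), symmetric])
    also have "\<dots> = (\<integral>\<omega>. u (t0, X t0 \<omega>) \<partial>P r x)"
      using v(2) uv t0 by (intro Bochner_Integration.integral_cong) (auto simp flip: v(2))
    \<comment> \<open>The value at \<open>r\<close> is the mean of the known solution at
      \<open>t0\<close> minus the mean drift in between. The first term lies in \<open>K\<close>,
      the second has norm at most \<open>\<delta>\<close>, so the sum lies in
      \<open>K'\<close>.\<close>
    finally have eq: "v (r, x) = (\<integral>\<omega>. u (t0, X t0 \<omega>) \<partial>P r x) + (- (\<integral>\<omega>. ?J \<omega> \<partial>P r x))"
      using v(2)[of "(r, x)"] rT by simp
    have "(\<integral>\<omega>. u (t0, X t0 \<omega>) \<partial>P r x) \<in> K"
    proof (rule PP.expectation_in_closed_convex)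
      obtain B where "\<forall>a\<in>K. norm a \<le> B" using compact_imp_bounded[OF K(1)] bounded_iff by blast
      then show "integrable (P r x) (\<lambda>\<omega>. u (t0, X t0 \<omega>))"
        by (intro integrable_P_bounded[OF rT(1), of _ B] measurable_compose[OF measurable_X[OF t0]
          measurable_compose[OF measurable_section[OF t0] um]])
           (use K(3) in auto)
    qed (use K compact_imp_closed in auto)
    moreover have "norm (- (\<integral>\<omega>. ?J \<omega> \<partial>P r x)) \<le> \<delta>"
      unfolding norm_minus_cancel
    proof (rule expectation_bound[OF rT(1) _ \<delta>])
      fix \<omega> assume "\<omega> \<in> space \<Omega>"
      then have "norm (?J \<omega>) \<le> (LINT s:{r..t0}|\<mu>. \<beta> s)" by (rule short_time_bound[OF v(1) rT(2) t0])
      also have "\<dots> \<le> (LINT s:{t1..t0}|\<mu>. \<beta> s)"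
        unfolding set_lebesgue_integral_def
      proof (rule integral_mono')
        show "integrable \<mu> (\<lambda>s. indicator {t1..t0} s *\<^sub>R \<beta> s)"
          using integrable_b(1) sets_\<mu>_Int[of "{t1..t0}"] t0 t1
            by (intro integrable_mult_indicator) (auto simp: Int_absorb2)
      qed (use b_nonneg(1) r t1 t0 in \<open>auto simp: indicator_def\<close>)
      finally show "norm (?J \<omega>) \<le> \<delta>" using small by simp
    qed
    ultimately show ?thesis unfolding eq by (rule thick)
  qed
  have vcut: "v (s, y) \<in> cut s" if "s \<in> {t1..T}" for s y
    using before[of s y] uv[of "(s, y)"] uK2(6)[of s y] that t0 by (auto simp: cut_def)
  \<comment> \<open>Before \<open>t0\<close> the values lie in \<open>K'\<close>, afterwards in
    \<open>K2\<close>; a partial solution asks for one compact convex set.\<close>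
  define L where "L = convex hull (K' \<union> K2)"
  have "compact (K' \<union> K2)" "K' \<union> K2 \<subseteq> interior D" using K' uK2 by auto
  note hull = convex_hull_subset_interior[OF this D_convex, folded L_def]
  have "convex L" by (simp add: L_def)
  have "v (s, y) \<in> L" if "s \<in> {t1..T}" for s y
    using vcut[OF that, of y] hull(3) by (auto simp: cut_def split: if_splits)
  with hull \<open>convex L\<close> have "\<exists>K. compact K \<and> convex K \<and> K \<subseteq> interior D \<and> (\<forall>s\<in>{t1..T}. \<forall>y. v (s, y)
    \<in> K)" by blast
  moreover have "v (r, x) = (\<integral>\<omega>. g (X T \<omega>) - (LINT s:{r..T}|\<mu>. f (s, X s \<omega>) (v (s, X s \<omega>))) \<partial>P r x)"
    if r: "r \<in> {t1..T}" for r x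
  proof -
    have "(\<integral>\<omega>. g (X T \<omega>) - (LINT s:{r..T}|\<mu>. f (s, X s \<omega>) (v (s, X s \<omega>))) \<partial>P r x) = Psi (gen v) (r, x)"
      by (rule Psi_eq) (use r t1 v(1) vcut in auto)
    then show ?thesis using v(2)[of "(r, x)"] r t1 by auto
  qed
  moreover have "t1 \<in> {0..T}" using t1 t0 by auto
  ultimately show ?thesis using v(1) unfolding partial_solution_def by blast
qed

text \<open>The global solution of the truncated problem is continuous on the whole strip. Before
  \<open>t\<close> it may have nothing to do with Problem (M), but being defined there avoids any
  discussion of the boundary time \<open>t\<close>.\<close>

lemma partial_solution_regular:
  assumes u: "partial_solution t u" and R: "rel_feller R" "\<And>s. R s s" and g: "continuous_on UNIV g"
    and cont: "AE s in \<mu>. continuous_on (UNIV \<times> D) (\<lambda>(x, w). f (s, x) w)"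
  shows "\<exists>v. rel_continuous R d {0..T} v \<and> (\<forall>p\<in>{t..T} \<times> UNIV. u p = v p)"
proof -
  obtain K where K: "compact K" "convex K" "K \<noteq> {}" "K \<subseteq> interior D" "K \<subseteq> D" "\<And>s y. s \<in> {t..T} \<Longrightarrow> u (s, y) \<in> K"
    by (rule partial_solution_range[OF u]) blast
  obtain b where b: "bound_on K b" using compact_bound[OF K(1,5)] by blast
  interpret truncation T d \<Omega> F X P \<mu> D f g Bg K K 0 b b
    by (rule truncationI) (use K b in auto)
  have t: "t \<in> {0..T}" and um: "u \<in> borel_measurable MT" using partial_solutionD[OF u] by auto
  obtain v where v: "v \<in> borel_measurable MT" "\<And>p. p \<in> {0..T} \<times> UNIV \<Longrightarrow> v p = Psi (gen v) p"
    by (rule Psi_fixed_point_exists) blast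
  have "u p = v p" if p: "p \<in> {t..T} \<times> UNIV" for p
  proof (rule Psi_fixed_point_unique[OF um v(1) t _ _ p])
    show "v q = Psi (gen v) q" if "q \<in> {t..T} \<times> UNIV" for q using v(2) that t by auto
    show "u q = Psi (gen u) q" if "q \<in> {t..T} \<times> UNIV" for q
      by (rule partial_solution_fixed_point[OF u _ that]) (use K in \<open>simp add: cut_def\<close>)
  qed
  moreover have "rel_continuous R d {0..T} v"
    by (rule fixed_point_rel_continuous[OF v R g AE_continuous_h[OF cont]])
  ultimately show ?thesis by blast
qed

end

section \<open>The maximal solution\<close>

text \<open>A limit point of \<open>A\<close> on the frontier would have points of \<open>A\<close>
  closer to it than \<open>\<eta>\<close>.\<close>

lemma closure_subset_interior:
  fixes A :: "'a::euclidean_space set"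
  assumes "A \<subseteq> D" "bounded A" "0 < \<eta>" "\<And>w. w \<in> A \<Longrightarrow> ereal \<eta> \<le> edist w (frontier D)"
  shows "compact (closure A)" "closure A \<subseteq> interior D"
proof -
  show "compact (closure A)" using assms(2) by (simp add: compact_eq_bounded_closed bounded_closure)
  show "closure A \<subseteq> interior D"
  proof
    fix w assume w: "w \<in> closure A"
    then obtain a where a: "a \<in> A" "dist a w < \<eta>" using assms(3) unfolding closure_approachable by blast
    have "w \<notin> frontier D"
    proof
      assume "w \<in> frontier D"
      then have "edist a (frontier D) \<le> ereal (dist a w)" unfolding edist_def by (rule INF_lower)
      also have "\<dots> < ereal \<eta>" using a(2) by simp
      finally show False using assms(4)[OF a(1)] by simp
    qed
    moreover have "w \<in> closure D" using w closure_mono[OF assms(1)] by blast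
    ultimately show "w \<in> interior D" by (simp add: frontier_def)
  qed
qed

lemma edist_nonneg: "0 \<le> edist w A"
  unfolding edist_def by (rule INF_greatest) simp

lemma admissible_intervalD:
  assumes "admissible_interval T J"
  shows "J \<in> sets borel" "J \<subseteq> {0..T}" "T \<in> J" "r \<in> J \<Longrightarrow> r \<le> s \<Longrightarrow> s \<le> T \<Longrightarrow> s \<in> J"
  using assms unfolding admissible_interval_def by auto

context terminal_value_problem
begin

lemma set_integral_endpoint: "(LINT s:{T}|\<mu>. \<phi> s) = (0 :: 'b::{banach, second_countable_topology})"
  unfolding set_lebesgue_integral_def
proof (rule integral_eq_zero_AE)
  have "{T} \<in> null_sets \<mu>" using T_pos by (intro null_point_\<mu>) simp
  from AE_not_in[OF this] show "AE s in \<mu>. indicator {T} s *\<^sub>R \<phi> s = 0"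
    by eventually_elim (auto simp: indicator_def)
qed

text \<open>Under \<open>P T x\<close> the position at \<open>T\<close> is known only up to distance
  0 from \<open>x\<close>; consistency of \<open>g\<close> identifies the values.\<close>

lemma terminal_expectation: "(\<integral>\<omega>. g (X T \<omega>) \<partial>P T x) = g x"
proof -
  have TT: "T \<in> {0..T}" using T_pos by simp
  interpret prob_space "P T x" using TT by (rule prob_space_P)
  have "(\<integral>\<omega>. g (X T \<omega>) \<partial>P T x) = (\<integral>\<omega>. g x \<partial>P T x)"
  proof (rule integral_cong_AE)
    show "AE \<omega> in P T x. g (X T \<omega>) = g x"
      using initial[OF TT, of x] g_consistent unfolding consistent_terminal_def by auto
    show "(\<lambda>\<omega>. g (X T \<omega>)) \<in> borel_measurable (P T x)"
      unfolding measurable_P[OF TT] by (rule measurable_compose[OF measurable_X[OF TT] g_measurable])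
  qed simp
  then show ?thesis by (simp add: prob_space)
qed

lemma partial_solution_terminal:
  assumes "partial_solution t u"
  shows "u (T, x) = g x"
proof -
  have "T \<in> {t..T}" using partial_solutionD[OF assms] by simp
  from partial_solutionD(3)[OF assms this, of x] show ?thesis
    by (simp add: set_integral_endpoint terminal_expectation)
qed

text \<open>The continuation starts from the degenerate interval consisting of \<open>T\<close>,
  where the equation reduces to the terminal condition.\<close>

lemma partial_solution_start:
  assumes "compact (closure (range g))" "closure (range g) \<subseteq> interior D"
  shows "\<exists>u. partial_solution T u"
proof -
  have TT: "T \<in> {0..T}" using T_pos by simp
  define u where "u p = (\<integral>\<omega>. g (X T \<omega>) \<partial>P (fst p) (snd p))" for p
  have "(\<lambda>\<omega>. g (X T \<omega>)) \<in> borel_measurable (G T)"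
    by (rule measurable_compose[OF measurable_X_G g_measurable]) (use TT in auto)
  from measurable_expectation_G[OF TT this]
  have "(\<lambda>p. indicator ({0..T} \<times> UNIV) p *\<^sub>R u p) \<in> borel_measurable MT"
    unfolding u_def by (subst (asm) borel_measurable_restrict_space_iff[OF slab_Int])
  then have u: "u \<in> borel_measurable MT"
    by (rule measurable_cong[THEN iffD1, rotated]) auto
  have uT: "u (T, x) = g x" for x by (simp add: u_def terminal_expectation)
  note hull = convex_hull_subset_interior[OF assms D_convex]
  have "g y \<in> convex hull (closure (range g))" for y
    by (intro hull_inc closure_subset[THEN subsetD]) simp
  then have "\<forall>s\<in>{T..T}. \<forall>y. u (s, y) \<in> convex hull (closure (range g))" using uT by simp
  with hull(1,2) convex_convex_hull
  have "\<exists>K. compact K \<and> convex K \<and> K \<subseteq> interior D \<and> (\<forall>s\<in>{T..T}. \<forall>y. u (s, y) \<in> K)" by blast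
  then have "partial_solution T u"
    unfolding partial_solution_def using u TT
    by (simp add: set_integral_endpoint terminal_expectation uT)
  then show ?thesis by blast
qed

section \<open>Partial solutions versus admissible solutions\<close>

text \<open>For fixed \<open>r\<close> all values from \<open>r\<close> on lie in one compact convex
  set. After truncation there, \<open>gen u\<close> is bounded by 1 under a finite measure, which
  settles every integrability requirement.\<close>

lemma partial_solutions_admissible:
  assumes J: "admissible_interval T J" and u: "\<And>t. t \<in> J \<Longrightarrow> partial_solution t u"
  shows "admissible_solution T d \<mu> \<Omega> X P D f g J u"
  unfolding admissible_solution_def solution_def
proof (intro conjI ballI allI impI)
  note Jd = admissible_intervalD[OF J]
  have um: "u \<in> borel_measurable MT" using partial_solutionD(2)[OF u[OF Jd(3)]] .
  have uD: "u (t, x) \<in> D" if t: "t \<in> J" for t x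
  proof -
    obtain K where "K \<subseteq> D" "\<And>s y. s \<in> {t..T} \<Longrightarrow> u (s, y) \<in> K"
      by (rule partial_solution_range[OF u[OF t]]) blast
    moreover have "t \<in> {t..T}" using Jd(2) t by auto
    ultimately show ?thesis by blast
  qed
  show "admissible_interval T J" by (rule J)
  have JT: "J \<times> UNIV \<subseteq> {0..T} \<times> (UNIV :: 's set)" using Jd(2) by auto
  show "pm_measurable d J u"
    unfolding pm_measurable_def measurable_pm_borel_subset[OF pseudometric JT]
    by (rule measurable_restrict_space1[OF um])
  show "u ` (J \<times> UNIV) \<subseteq> D" using uD by auto
  show "consistent_on d J u"
    unfolding consistent_on_def using consistent[OF um] JT by blast
  show "u (T, x) = g x" for x using partial_solution_terminal[OF u[OF Jd(3)]] .
  show "compact (closure (u ` ({r..T} \<times> UNIV)))" "closure (u ` ({r..T} \<times> UNIV)) \<subseteq> interior D"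
    if r: "r \<in> J" for r
  proof -
    obtain K where K: "compact K" "K \<subseteq> interior D" "\<And>s y. s \<in> {r..T} \<Longrightarrow> u (s, y) \<in> K"
      by (rule partial_solution_range[OF u[OF r]]) blast
    have sub: "closure (u ` ({r..T} \<times> UNIV)) \<subseteq> K"
      using K by (intro closure_minimal compact_imp_closed) auto
    then show "closure (u ` ({r..T} \<times> UNIV)) \<subseteq> interior D" using K(2) by (rule order_trans)
    show "compact (closure (u ` ({r..T} \<times> UNIV)))"
      using bounded_subset[OF compact_imp_bounded[OF K(1)] sub] by (simp add: compact_eq_bounded_closed)
  qed
  fix r t x assume r: "r \<in> J" and t: "t \<in> J" and rt: "r \<le> t"
  obtain K where K: "compact K" "convex K" "K \<noteq> {}" "K \<subseteq> D" "\<And>s y. s \<in> {r..T} \<Longrightarrow> u (s, y) \<in> K"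
    by (rule partial_solution_range[OF u[OF r]]) blast
  obtain b where b: "bound_on K b" using compact_bound[OF K(1,4)] by blast
  interpret truncation T d \<Omega> F X P \<mu> D f g Bg K K 0 b b
    by (rule truncationI) (use K b in auto)
  have rT: "r \<in> {0..T}" and tT: "t \<in> {0..T}" using r t Jd(2) by auto
  have rt': "0 \<le> r" "t \<le> T" using rT tT by auto
  have ucut: "u (s, y) \<in> cut s" if "s \<in> {r..T}" for s y using K(5)[OF that] by (simp add: cut_def)
  note gu = measurable_gen[OF um]
  have fp: "u (s, y) = Psi (gen u) (s, y)" if "s \<in> {r..T}" for s y
    by (rule partial_solution_fixed_point[OF u[OF r] ucut]) (use that in auto)
  have tr: "t \<in> {r..T}" "r \<in> {r..T}" using rt rt' rT by auto
  obtain B where B: "\<forall>a\<in>K. norm a \<le> B" using compact_imp_bounded[OF K(1)] bounded_iff by blast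
  have uX: "integrable (P r x) (\<lambda>\<omega>. u (t, X t \<omega>))"
    by (rule integrable_P_bounded[OF rT measurable_compose[OF measurable_X[OF tT]
      measurable_compose[OF measurable_section[OF tT] um]], of B])
       (use K(5)[OF tr(1)] B in auto)
  then show "integrable (P r x) (\<lambda>\<omega>. norm (u (t, X t \<omega>)))" by simp
  have cutI: "u (s, y) \<in> cut s" if "s \<in> {r..t}" "s \<in> {0..T}" for s y using ucut that by auto
  show "set_integrable \<mu> {r..t} (\<lambda>s. f (s, X s \<omega>) (u (s, X s \<omega>)))" if "\<omega> \<in> space \<Omega>" for \<omega>
    by (rule set_integrable_generator[OF um _ cutI that]) auto
  have spP: "space (P r x) = space \<Omega>" using space_P[OF rT] .
  have "integrable (P r x) (\<lambda>\<omega>. LINT s:{r..t}|\<nu>. norm (gen u (s, X s \<omega>)))"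
    unfolding set_lebesgue_integral_def
  proof (rule integrable_P_bounded[OF rT])
    have "(\<lambda>q. indicator {r..t} (snd q) :: real) \<in> borel_measurable (\<Omega> \<Otimes>\<^sub>M \<nu>)"
    proof (rule measurable_compose[OF measurable_snd])
      have "{r..t} \<in> sets \<nu>" using sets_\<nu>_Int[of "{r..t}"] rt' by (simp add: Int_absorb2)
      then show "(\<lambda>s. indicator {r..t} s :: real) \<in> borel_measurable \<nu>" by simp
    qed
    then have "(\<lambda>(\<omega>, s). indicator {r..t} s *\<^sub>R norm (gen u (s, X s \<omega>))) \<in> borel_measurable (\<Omega> \<Otimes>\<^sub>M \<nu>)"
      using measurable_joint_path_\<Omega>[OF gu] by (simp add: case_prod_beta')
    then show "(\<lambda>\<omega>. \<integral>s. indicator {r..t} s *\<^sub>R norm (gen u (s, X s \<omega>)) \<partial>\<nu>) \<in> borel_measurable \<Omega>"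
      by (rule N.borel_measurable_lebesgue_integral)
    fix \<omega> assume "\<omega> \<in> space \<Omega>"
    have "norm (\<integral>s. indicator {r..t} s *\<^sub>R norm (gen u (s, X s \<omega>)) \<partial>\<nu>)
      \<le> (\<integral>s. norm (indicator {r..t} s *\<^sub>R norm (gen u (s, X s \<omega>))) \<partial>\<nu>)"
      by (rule integral_norm_bound)
    also have "\<dots> \<le> (\<integral>s. 1 \<partial>\<nu>)"
    proof (rule integral_mono')
      show "norm (indicator {r..t} s *\<^sub>R norm (gen u (s, X s \<omega>))) \<le> 1" if "s \<in> space \<nu>" for s
        using h_bound[of "(s, X s \<omega>)"] that by (auto simp: indicator_def)
    qed simp_all
    finally show "norm (\<integral>s. indicator {r..t} s *\<^sub>R norm (gen u (s, X s \<omega>)) \<partial>\<nu>) \<le> (\<integral>s. 1 \<partial>\<nu>)" .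
  qed
  then show "integrable (P r x) (\<lambda>\<omega>. LINT s:{r..t}|\<mu>. norm (f (s, X s \<omega>) (u (s, X s \<omega>))))"
    by (rule Bochner_Integration.integrable_cong[THEN iffD1, OF refl, rotated])
       (use set_integral_norm_generator[OF um _ cutI, of "{r..t}"] spP in auto)
  \<comment> \<open>The integral between \<open>r\<close> and \<open>t\<close> is a difference of
    two terminal functionals; the one from \<open>t\<close> on becomes the mean of
    \<open>u (t, X t)\<close> by \<open>Psi_markov\<close>.\<close>
  have i1: "integrable (P r x) (\<lambda>\<omega>. g (X T \<omega>) - path_integral (gen u) t \<omega>)"
    by (rule integrable_Psi_integrand[OF gu h_bound rT tT])
  have i2: "integrable (P r x) (\<lambda>\<omega>. g (X T \<omega>) - path_integral (gen u) r \<omega>)"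
    by (rule integrable_Psi_integrand[OF gu h_bound rT rT])
  have "(\<integral>\<omega>. (LINT s:{r..t}|\<mu>. f (s, X s \<omega>) (u (s, X s \<omega>))) \<partial>P r x)
      = (\<integral>\<omega>. (g (X T \<omega>) - path_integral (gen u) t \<omega>) - (g (X T \<omega>) - path_integral (gen u) r \<omega>) \<partial>P r x)"
  proof (rule Bochner_Integration.integral_cong[OF refl])
    fix \<omega> assume "\<omega> \<in> space (P r x)"
    then have \<omega>: "\<omega> \<in> space \<Omega>" using spP by simp
    have "(LINT s:{r..t}|\<mu>. f (s, X s \<omega>) (u (s, X s \<omega>))) = (LINT s:{r..t}|\<nu>. gen u (s, X s \<omega>))"
      by (rule set_integral_generator[OF um _ cutI \<omega>]) auto
    then show "(LINT s:{r..t}|\<mu>. f (s, X s \<omega>) (u (s, X s \<omega>)))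
      = (g (X T \<omega>) - path_integral (gen u) t \<omega>) - (g (X T \<omega>) - path_integral (gen u) r \<omega>)"
      using path_integral_split[OF gu h_bound rt'(1) rt rt'(2) \<omega>] by simp
  qed
  also have "\<dots> = (\<integral>\<omega>. g (X T \<omega>) - path_integral (gen u) t \<omega> \<partial>P r x) - Psi (gen u) (r, x)"
    using Bochner_Integration.integral_diff[OF i1 i2] by (simp add: Psi_def)
  also have "(\<integral>\<omega>. g (X T \<omega>) - path_integral (gen u) t \<omega> \<partial>P r x) = (\<integral>\<omega>. Psi (gen u) (t, X t \<omega>) \<partial>P r x)"
    by (rule Psi_markov[OF gu h_bound rt'(1) rt rt'(2), symmetric])
  also have "\<dots> = (\<integral>\<omega>. u (t, X t \<omega>) \<partial>P r x)" by (simp flip: fp[OF tr(1)])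
  finally show "(\<integral>\<omega>. u (t, X t \<omega>) \<partial>P r x)
    = u (r, x) + (\<integral>\<omega>. (LINT s:{r..t}|\<mu>. f (s, X s \<omega>) (u (s, X s \<omega>))) \<partial>P r x)"
    using fp[OF tr(2), of x] by simp
qed

text \<open>A partial solution is measurable on the whole strip, while \<open>v\<close> is given on
  \<open>J \<times> UNIV\<close>; extension by 0 preserves measurability because that set is
  measurable. Inserting \<open>g\<close> into the equations that end at \<open>T\<close> gives the
  required identity.\<close>

lemma admissible_partial_solution:
  assumes v: "admissible_solution T d \<mu> \<Omega> X P D f g J v" and t: "t \<in> J"
  shows "partial_solution t (\<lambda>p. indicator (J \<times> UNIV) p *\<^sub>R v p)"
proof -
  have "solution T d \<mu> \<Omega> X P D f g J v"
    using v unfolding admissible_solution_def by (rule conjunct1)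
  note sol = this[unfolded solution_def]
  note J = sol[THEN conjunct1]
  note vm = sol[THEN conjunct2, THEN conjunct1]
  note Jd = admissible_intervalD[OF J]
  have vT: "v (T, x) = g x" for x
    using sol[THEN conjunct2, THEN conjunct2, THEN conjunct2, THEN conjunct2, THEN conjunct2] by (rule spec)
  note rT = sol[THEN conjunct2, THEN conjunct2, THEN conjunct2, THEN conjunct2, THEN conjunct1,
    rule_format, OF _ Jd(3)]
  have eq: "(\<integral>\<omega>. v (T, X T \<omega>) \<partial>P r x) =
      v (r, x) + (\<integral>\<omega>. (LINT s:{r..T}|\<mu>. f (s, X s \<omega>) (v (s, X s \<omega>))) \<partial>P r x)" if r: "r \<in> J" for r x
  proof -
    have "r \<le> T" using Jd(2) r by auto
    from rT[OF r this, of x] show ?thesis by (elim conjE)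
  qed
  define u where "u p = indicator (J \<times> UNIV) p *\<^sub>R v p" for p
  have JT: "J \<times> UNIV \<subseteq> {0..T} \<times> (UNIV :: 's set)" using Jd(2) by auto
  have JM: "J \<times> UNIV \<in> sets MT" by (rule slab_sets[OF Jd(1)]) (use Jd(2) in auto)
  have um: "u \<in> borel_measurable MT"
    unfolding u_def using vm unfolding pm_measurable_def measurable_pm_borel_subset[OF pseudometric JT]
    by (subst (asm) borel_measurable_restrict_space_iff[OF sets.Int[OF JM sets.top]])
  have uv: "u (s, y) = v (s, y)" if "s \<in> J" for s y using that by (simp add: u_def)
  define C where "C = closure (v ` ({t..T} \<times> UNIV))"
  have C: "compact C" "C \<subseteq> interior D"
    using v[unfolded admissible_solution_def, THEN conjunct2, THEN bspec, OF t] unfolding C_def by simp_all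
  define K where "K = convex hull C"
  have K: "compact K" "convex K" and KI: "K \<subseteq> interior D"
    unfolding K_def using convex_hull_subset_interior[OF C D_convex] by auto
  have KD: "K \<subseteq> D" using KI interior_subset by (rule order_trans)
  have tJ: "s \<in> J" if "s \<in> {t..T}" for s using Jd(4)[OF t] that by simp
  have uK: "u (s, y) \<in> K" if s: "s \<in> {t..T}" for s y
  proof -
    have "v (s, y) \<in> C" unfolding C_def by (rule closure_subset[THEN subsetD]) (use s in auto)
    then show ?thesis unfolding K_def uv[OF tJ[OF s]] by (rule hull_inc)
  qed
  have tT: "t \<in> {0..T}" "t \<in> {t..T}" using t Jd(2) by auto
  obtain b where b: "bound_on K b" using compact_bound[OF K(1) KD] by blast
  have "K \<noteq> {}" using uK[OF tT(2)] by blast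
  then interpret truncation T d \<Omega> F X P \<mu> D f g Bg K K 0 b b
    by (intro truncationI) (use K KD b in auto)
  have "u (r, x) = (\<integral>\<omega>. g (X T \<omega>) - (LINT s:{r..T}|\<mu>. f (s, X s \<omega>) (u (s, X s \<omega>))) \<partial>P r x)"
    if r: "r \<in> {t..T}" for r x
  proof -
    have rT: "r \<in> {0..T}" using r tT by auto
    have TT: "T \<in> {0..T}" using T_pos by simp
    have pe: "(LINT s:{r..T}|\<mu>. f (s, X s \<omega>) (u (s, X s \<omega>))) = path_integral (gen u) r \<omega>" if "\<omega>
      \<in> space \<Omega>" for \<omega>
      by (rule path_integral_eq[OF um rT _ that]) (use uK r in \<open>auto simp: cut_def\<close>)
    have lv: "(LINT s:{r..T}|\<mu>. f (s, X s \<omega>) (v (s, X s \<omega>)))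
      = (LINT s:{r..T}|\<mu>. f (s, X s \<omega>) (u (s, X s \<omega>)))" for \<omega>
      unfolding set_lebesgue_integral_def
      by (rule Bochner_Integration.integral_cong) (use r uv tJ in \<open>auto simp: indicator_def\<close>)
    have gX: "integrable (P r x) (\<lambda>\<omega>. g (X T \<omega>))"
      by (rule integrable_P_bounded[OF rT measurable_compose[OF measurable_X[OF TT] g_measurable] g_bound])
    have pi: "integrable (P r x) (path_integral (gen u) r)"
      by (rule integrable_P_bounded[OF rT measurable_G_\<Omega>[OF rT measurable_path_integral[OF rT
        measurable_gen[OF um]]]
            path_integral_bound_1[OF measurable_gen[OF um] _ _ h_bound]]) (use rT in auto)
    have "(\<integral>\<omega>. (LINT s:{r..T}|\<mu>. f (s, X s \<omega>) (v (s, X s \<omega>))) \<partial>P r x)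
      = (\<integral>\<omega>. path_integral (gen u) r \<omega> \<partial>P r x)"
      by (rule Bochner_Integration.integral_cong) (use lv pe space_P[OF rT] in auto)
    with eq[OF tJ[OF r], of x] have "u (r, x)
      = (\<integral>\<omega>. g (X T \<omega>) \<partial>P r x) - (\<integral>\<omega>. path_integral (gen u) r \<omega> \<partial>P r x)"
      by (simp add: vT uv[OF tJ[OF r]])
    also have "\<dots> = (\<integral>\<omega>. g (X T \<omega>) - path_integral (gen u) r \<omega> \<partial>P r x)"
      by (rule Bochner_Integration.integral_diff[OF gX pi, symmetric])
    also have "\<dots> = (\<integral>\<omega>. g (X T \<omega>) - (LINT s:{r..T}|\<mu>. f (s, X s \<omega>) (u (s, X s \<omega>))) \<partial>P r x)"
      by (rule Bochner_Integration.integral_cong) (use pe space_P[OF rT] in auto)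
    finally show ?thesis .
  qed
  then have "partial_solution t u"
    unfolding partial_solution_def using tT um K KI uK by blast
  then show ?thesis unfolding u_def .
qed

section \<open>The length of a continuation step\<close>

text \<open>\<open>K'\<close> is the sum of \<open>K\<close> and a closed ball, compact and convex
  as such a sum. Its radius is chosen so that it stays in the open set
  \<open>interior D\<close>.\<close>

lemma thickening:
  assumes K: "compact K" "convex K" "K \<subseteq> interior D"
  obtains \<delta> K' \<beta> where "0 < \<delta>" "compact K'" "convex K'" "K' \<subseteq> interior D"
    "\<And>a e. a \<in> K \<Longrightarrow> norm e \<le> \<delta> \<Longrightarrow> a + e \<in> K'" "bound_on K' \<beta>"
proof -
  obtain \<delta> where \<delta>: "0 < \<delta>" "(\<Union>x\<in>K. cball x \<delta>) \<subseteq> interior D"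
    by (rule compact_subset_open_imp_cball_epsilon_subset[OF K(1) open_interior K(3)])
  define K' where "K' = (\<Union>x\<in>K. \<Union>y\<in>cball 0 \<delta>. {x + y})"
  have c: "compact K'" "convex K'"
    unfolding K'_def using K by (auto intro!: compact_sums' convex_sums)
  have s: "K' \<subseteq> interior D"
  proof -
    have "x + y \<in> (\<Union>x\<in>K. cball x \<delta>)" if "x \<in> K" "norm y \<le> \<delta>" for x y :: "real^'k"
      using that by (auto simp: dist_norm intro!: bexI[of _ x])
    then show ?thesis using \<delta>(2) unfolding K'_def by auto
  qed
  then have "K' \<subseteq> D" using interior_subset by (rule order_trans)
  then obtain \<beta> where "bound_on K' \<beta>" using compact_bound[OF c(1)] by blast
  moreover have "a + e \<in> K'" if "a \<in> K" "norm e \<le> \<delta>" for a e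
    unfolding K'_def using that by (intro UN_I[of a] UN_I[of e]) auto
  ultimately show ?thesis using that \<delta>(1) c s by blast
qed

text \<open>Dominated convergence on intervals shrinking to the null point \<open>t\<close>. The
  bound holds for every interval inside the window, so a step may start anywhere near
  \<open>t\<close>.\<close>

lemma small_interval_integral:
  assumes \<beta>: "integrable \<mu> \<beta>" "\<And>s. s \<in> {0..T} \<Longrightarrow> 0 \<le> \<beta> s" and t: "t \<in> {0..T}" and \<delta>: "0 < \<delta>"
  obtains \<eta> where "0 < \<eta>" "\<And>a c. 0 \<le> a \<Longrightarrow> c \<le> T \<Longrightarrow> t - \<eta> \<le> a \<Longrightarrow> c \<le> t + \<eta> \<Longrightarrow> (LINT s:{a..c}|\<mu>. \<beta> s) \<le> (\<delta>::real)"
proof -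
  let ?I = "\<lambda>n. {t - 1 / real (Suc n)..t + 1 / real (Suc n)}"
  have set: "(\<lambda>s. indicator A s *\<^sub>R \<beta> s) \<in> borel_measurable \<mu>" if "A \<in> sets borel" for A
  proof -
    have "(\<lambda>s. indicator (A \<inter> {0..T}) s *\<^sub>R \<beta> s) \<in> borel_measurable \<mu>"
      using sets_\<mu>_Int[OF that] borel_measurable_integrable[OF \<beta>(1)] by measurable
    then show ?thesis by (rule measurable_cong[THEN iffD1, rotated]) (auto simp: indicator_def)
  qed
  have inv: "(\<lambda>n. 1 / real (Suc n)) \<longlonglongrightarrow> 0"
    using LIMSEQ_inverse_real_of_nat by (simp add: inverse_eq_divide)
  have "(\<lambda>n. \<integral>s. indicator (?I n) s *\<^sub>R \<beta> s \<partial>\<mu>) \<longlonglongrightarrow> (\<integral>s. 0 \<partial>\<mu>)"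
  proof (rule integral_dominated_convergence[where w = "\<lambda>s. norm (\<beta> s)"])
    show "AE s in \<mu>. (\<lambda>n. indicator (?I n) s *\<^sub>R \<beta> s) \<longlonglongrightarrow> 0"
      using AE_not_in[OF null_point_\<mu>[OF t]]
    proof eventually_elim
      case (elim s)
      then have "0 < \<bar>s - t\<bar>" by simp
      with inv have "\<forall>\<^sub>F n in sequentially. 1 / real (Suc n) < \<bar>s - t\<bar>" by (rule order_tendstoD)
      then have "\<forall>\<^sub>F n in sequentially. indicator (?I n) s *\<^sub>R \<beta> s = 0"
        by eventually_elim (auto simp: indicator_def abs_if split: if_splits)
      then show ?case by (rule tendsto_eventually)
    qed
    show "AE s in \<mu>. norm (indicator (?I n) s *\<^sub>R \<beta> s) \<le> norm (\<beta> s)" for n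
      by (rule AE_I2) (auto simp: indicator_def)
  qed (use \<beta>(1) set in auto)
  then have "(\<lambda>n. \<integral>s. indicator (?I n) s *\<^sub>R \<beta> s \<partial>\<mu>) \<longlonglongrightarrow> 0" by simp
  then have "\<forall>\<^sub>F n in sequentially. (\<integral>s. indicator (?I n) s *\<^sub>R \<beta> s \<partial>\<mu>) < \<delta>" using \<delta> by (rule order_tendstoD)
  then obtain n where n: "(\<integral>s. indicator (?I n) s *\<^sub>R \<beta> s \<partial>\<mu>) < \<delta>" by (auto simp: eventually_sequentially)
  have "(LINT s:{a..c}|\<mu>. \<beta> s) \<le> \<delta>" if "0 \<le> a" "c \<le> T" "t - 1 / real (Suc n) \<le> a" "c
    \<le> t + 1 / real (Suc n)" for a c
  proof -
    have "(LINT s:{a..c}|\<mu>. \<beta> s) \<le> (\<integral>s. indicator (?I n) s *\<^sub>R \<beta> s \<partial>\<mu>)"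
      unfolding set_lebesgue_integral_def
    proof (rule integral_mono')
      show "integrable \<mu> (\<lambda>s. indicator (?I n) s *\<^sub>R \<beta> s)"
        by (rule Bochner_Integration.integrable_bound[OF \<beta>(1) set]) (auto simp: indicator_def)
    qed (use \<beta>(2) that in \<open>auto simp: indicator_def\<close>)
    then show ?thesis using n by linarith
  qed
  then show ?thesis using that[of "1 / real (Suc n)"] by simp
qed

lemma partial_solution_step:
  assumes u: "partial_solution t u" and t: "0 < t"
  shows "\<exists>t'\<ge>0. t' < t \<and> (\<exists>v. partial_solution t' v)"
proof -
  have tT: "t \<in> {0..T}" "t \<in> {t..T}" using partial_solutionD[OF u] by auto
  obtain K where K: "compact K" "convex K" "K \<subseteq> interior D" "\<And>s y. s \<in> {t..T} \<Longrightarrow> u (s, y) \<in> K"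
    by (rule partial_solution_range[OF u]) blast
  obtain \<delta> K' \<beta> where \<delta>: "0 < \<delta>" and K': "compact K'" "convex K'" "K' \<subseteq> interior D"
    "\<And>a e. a \<in> K \<Longrightarrow> norm e \<le> \<delta> \<Longrightarrow> a + e \<in> K'" and \<beta>: "bound_on K' \<beta>"
    by (rule thickening[OF K(1-3)]) blast
  obtain \<eta> where \<eta>: "0 < \<eta>" "\<And>a c. 0 \<le> a \<Longrightarrow> c \<le> T \<Longrightarrow> t - \<eta> \<le> a \<Longrightarrow> c \<le> t + \<eta> \<Longrightarrow> (LINT s:{a..c}|\<mu>. \<beta> s) \<le> \<delta>"
    by (rule small_interval_integral[OF _ _ tT(1) \<delta>, of \<beta>]) (use \<beta> in \<open>auto simp: bound_on_def\<close>)
  define t' where "t' = max 0 (t - \<eta>)"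
  have t': "0 \<le> t'" "t' < t" "t - \<eta> \<le> t'" using t \<eta>(1) by (auto simp: t'_def)
  have "\<exists>v. partial_solution t' v"
    by (rule partial_solution_extend[OF u K(1,2) K(4)[OF tT(2)] K'(1-3) less_imp_le[OF \<delta>] K'(4) \<beta> t'(1)])
       (use t' \<eta> tT in auto)
  then show ?thesis using t' by blast
qed

text \<open>If the values at times \<open>t\<close> close to \<open>a\<close> stayed in one compact set, then the size of an extension
  step would not depend on \<open>t\<close>, and the solution could be continued to \<open>a\<close>.\<close>

lemma leaves_compact:
  assumes a: "0 \<le> a" "a < T" and no: "\<nexists>v. partial_solution a v"
    and u: "\<And>t. a < t \<Longrightarrow> t \<le> T \<Longrightarrow> partial_solution t u"
    and K: "compact K" "convex K" "K \<subseteq> interior D"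
  shows "\<forall>\<^sub>F t in at_right a. a < t \<and> t \<le> T \<and> (\<exists>y. u (t, y) \<notin> K)"
proof -
  obtain \<delta> K' \<beta> where \<delta>: "0 < \<delta>" and K': "compact K'" "convex K'" "K' \<subseteq> interior D"
    "\<And>a e. a \<in> K \<Longrightarrow> norm e \<le> \<delta> \<Longrightarrow> a + e \<in> K'" and \<beta>: "bound_on K' \<beta>"
    by (rule thickening[OF K]) blast
  have aT: "a \<in> {0..T}" using a by simp
  \<comment> \<open>The window is centred at \<open>a\<close> and not at the starting time
    \<open>t\<close>, so one \<open>\<eta>\<close> serves all \<open>t\<close> close to
    \<open>a\<close>.\<close>
  obtain \<eta> where \<eta>: "0 < \<eta>" "\<And>r c. 0 \<le> r \<Longrightarrow> c \<le> T \<Longrightarrow> a - \<eta> \<le> r \<Longrightarrow> c \<le> a + \<eta> \<Longrightarrow> (LINT s:{r..c}|\<mu>. \<beta> s) \<le> \<delta>"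
    by (rule small_interval_integral[OF _ _ aT \<delta>, of \<beta>]) (use \<beta> in \<open>auto simp: bound_on_def\<close>)
  have "a < t \<and> t \<le> T \<and> (\<exists>y. u (t, y) \<notin> K)" if t: "a < t" "t < min T (a + \<eta>)" for t
  proof (rule ccontr)
    assume "\<not> ?thesis"
    then have uK: "u (t, y) \<in> K" for y using t by auto
    have "\<exists>v. partial_solution a v"
      by (rule partial_solution_extend[OF u K(1,2) uK K'(1-3) less_imp_le[OF \<delta>] K'(4) \<beta> a(1)])
         (use t \<eta> a in auto)
    then show False using no by simp
  qed
  then show ?thesis
    unfolding eventually_at_right_field using a \<eta>(1) by (intro exI[of _ "min T (a + \<eta>)"]) auto
qed

section \<open>Gluing the partial solutions\<close>

definition existence_times :: "real set" where
  "existence_times = {t. \<exists>u. partial_solution t u}"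

text \<open>Every time selects its own partial solution; by uniqueness the selections agree. The
  value 0 elsewhere gives a function on the whole strip that can be measurable.\<close>

definition maximal_solution :: "real \<times> 's \<Rightarrow> real^'k" where
  "maximal_solution p = (if fst p \<in> existence_times then (SOME v. partial_solution (fst p) v) p else 0)"

lemma existence_times_subset: "existence_times \<subseteq> {0..T}"
  unfolding existence_times_def using partial_solutionD(1) by blast

lemma existence_times_mono: "t \<in> existence_times \<Longrightarrow> t \<le> s \<Longrightarrow> s \<le> T \<Longrightarrow> s \<in> existence_times"
  unfolding existence_times_def using partial_solution_mono by blast

lemma existence_times_step: "t \<in> existence_times \<Longrightarrow> 0 < t \<Longrightarrow> \<exists>t'<t. t' \<in> existence_times"
  unfolding existence_times_def using partial_solution_step by blast

lemma maximal_solution_eq: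
  assumes v: "partial_solution t v" and s: "s \<in> {t..T}"
  shows "maximal_solution (s, y) = v (s, y)"
proof -
  have vs: "partial_solution s v" using partial_solution_mono[OF v] s by simp
  then have "s \<in> existence_times" unfolding existence_times_def by blast
  moreover have "partial_solution s (SOME v. partial_solution s v)"
    by (rule someI[of "partial_solution s", OF vs])
  from partial_solution_unique[OF this vs, of s y]
  have "(SOME v. partial_solution s v) (s, y) = v (s, y)" using s by simp
  ultimately show ?thesis by (simp add: maximal_solution_def)
qed

text \<open>A positive infimum cannot be attained, since a partial solution that starts at a
  positive time can be continued below it.\<close>

lemma existence_times_cases:
  assumes T: "T \<in> existence_times"
  obtains (closed) "existence_times = {0..T}"
    | (half_open) "0 \<le> Inf existence_times" "Inf existence_times < T"
        "existence_times = {Inf existence_times<..T}"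
proof (cases "0 \<in> existence_times")
  case True
  have "existence_times = {0..T}"
  proof
    show "{0..T} \<subseteq> existence_times" using existence_times_mono[OF True] by auto
  qed (rule existence_times_subset)
  then show ?thesis by (rule closed)
next
  case False
  let ?a = "Inf existence_times"
  have ne: "existence_times \<noteq> {}" using T by blast
  have bdd: "bdd_below existence_times" using existence_times_subset by (intro bdd_belowI[of _ 0]) auto
  have a0: "0 \<le> ?a" using existence_times_subset by (intro cInf_greatest[OF ne]) auto
  have anot: "?a \<notin> existence_times"
  proof
    assume a: "?a \<in> existence_times"
    then have "0 < ?a" using a0 False by (cases "?a = 0") auto
    then obtain t where "t < ?a" "t \<in> existence_times" using existence_times_step[OF a] by blast
    then show False using cInf_lower[OF _ bdd, of t] by simp
  qed
  have "?a \<le> T" using cInf_lower[OF T bdd] .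
  then have aT: "?a < T" using anot T by (cases "?a = T") auto
  have "existence_times = {?a<..T}"
  proof
    show "existence_times \<subseteq> {?a<..T}"
    proof
      fix t assume t: "t \<in> existence_times"
      then have "?a \<le> t" using cInf_lower[OF _ bdd] by simp
      moreover have "t \<noteq> ?a" using t anot by blast
      ultimately show "t \<in> {?a<..T}" using t existence_times_subset by auto
    qed
    show "{?a<..T} \<subseteq> existence_times"
    proof
      fix t assume t: "t \<in> {?a<..T}"
      then have "?a < t" by simp
      then obtain s where "s \<in> existence_times" "s < t" using cInf_lessD[OF ne] by blast
      then show "t \<in> existence_times" using t existence_times_mono[of s t] by simp
    qed
  qed
  then show ?thesis by (rule half_open[OF a0 aT])
qed

text \<open>A choice made separately at each time carries no measurability. Starting times that
  eventually fall below every existence time provide countably many measurable partial solutions;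
  cut off to their intervals, they are eventually constant at each point.\<close>

lemma measurable_maximal_solution:
  assumes T: "T \<in> existence_times"
  shows "maximal_solution \<in> borel_measurable MT"
proof -
  have "\<exists>\<tau>. (\<forall>n::nat. \<tau> n \<in> existence_times) \<and> (\<forall>s\<in>existence_times. \<forall>\<^sub>F n in sequentially. \<tau> n \<le> s)"
    using T
  proof (cases rule: existence_times_cases)
    case closed
    then show ?thesis using T_pos by (intro exI[of _ "\<lambda>_. 0"]) auto
  next
    case half_open
    let ?a = "Inf existence_times"
    \<comment> \<open>The sequence starts at \<open>T\<close> and decreases to the infimum without
      reaching it.\<close>
    define \<tau> where "\<tau> n = ?a + (T - ?a) * (1 / real (Suc n))" for n
    have "\<tau> \<longlonglongrightarrow> ?a + (T - ?a) * 0"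
      unfolding \<tau>_def using LIMSEQ_inverse_real_of_nat
      by (intro tendsto_intros) (simp add: inverse_eq_divide)
    then have lim: "\<tau> \<longlonglongrightarrow> ?a" by simp
    have "\<forall>\<^sub>F n in sequentially. \<tau> n \<le> s" if "s \<in> existence_times" for s
    proof -
      have "?a < s" using that half_open(3) by auto
      with lim have "\<forall>\<^sub>F n in sequentially. \<tau> n < s" by (rule order_tendstoD)
      then show ?thesis by eventually_elim simp
    qed
    moreover have "\<tau> n \<in> existence_times" for n
    proof -
      have "(T - ?a) * (1 / real (Suc n)) \<le> (T - ?a) * 1"
        using half_open(2) by (intro mult_left_mono) auto
      then have "\<tau> n \<in> {?a<..T}" using half_open(2) by (auto simp: \<tau>_def)
      then show ?thesis using half_open(3) by blast
    qed
    ultimately show ?thesis by blast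
  qed
  then obtain \<tau> where \<tau>: "\<And>n::nat. \<tau> n \<in> existence_times"
    "\<And>s. s \<in> existence_times \<Longrightarrow> \<forall>\<^sub>F n in sequentially. \<tau> n \<le> s" by blast
  have "\<exists>v. partial_solution (\<tau> n) v" for n using \<tau>(1)[of n] by (simp add: existence_times_def)
  then obtain V where V: "\<And>n. partial_solution (\<tau> n) (V n)" by metis
  show ?thesis
  proof (rule borel_measurable_LIMSEQ_metric)
    show "(\<lambda>p. indicator ({\<tau> n..T} \<times> UNIV) p *\<^sub>R V n p) \<in> borel_measurable MT" for n
    proof -
      have "\<tau> n \<in> {0..T}" using \<tau>(1) existence_times_subset by blast
      then have "{\<tau> n..T} \<times> UNIV \<in> sets MT" by (intro slab_sets[of "{\<tau> n..T}"]) auto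
      then show ?thesis using partial_solutionD(2)[OF V] by measurable
    qed
    fix p assume "p \<in> space MT"
    then obtain s y where p: "p = (s, y)" "s \<in> {0..T}" by auto
    show "(\<lambda>n. indicator ({\<tau> n..T} \<times> UNIV) p *\<^sub>R V n p) \<longlonglongrightarrow> maximal_solution p"
    proof (cases "s \<in> existence_times")
      case True
      from \<tau>(2)[OF this] have "\<forall>\<^sub>F n in sequentially. indicator ({\<tau> n..T} \<times> UNIV) p *\<^sub>R V n p
        = maximal_solution p"
        by eventually_elim (use p maximal_solution_eq[OF V] in auto)
      then show ?thesis by (rule tendsto_eventually)
    next
      case False
      then have "\<not> \<tau> n \<le> s" for n using existence_times_mono[OF \<tau>(1)] p by auto
      then show ?thesis using False p by (simp add: maximal_solution_def)
    qed
  qed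
qed

lemma partial_solution_maximal:
  assumes "t \<in> existence_times"
  shows "partial_solution t maximal_solution"
proof -
  obtain v where v: "partial_solution t v" using assms unfolding existence_times_def by blast
  have "t \<in> {0..T}" using partial_solutionD[OF v] by simp
  then have "T \<in> existence_times" using existence_times_mono[OF assms] by simp
  then show ?thesis
    by (intro partial_solution_cong[OF v measurable_maximal_solution] maximal_solution_eq[OF v])
qed

lemma maximal_admissible_interval:
  assumes "T \<in> existence_times"
  shows "admissible_interval T existence_times"
  using assms by (cases rule: existence_times_cases) (use T_pos in \<open>auto simp: admissible_interval_def\<close>)

lemma maximal_solution_admissible:
  "T \<in> existence_times \<Longrightarrow> admissible_solution T d \<mu> \<Omega> X P D f g existence_times maximal_solution"
  by (intro partial_solutions_admissible maximal_admissible_interval partial_solution_maximal)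

text \<open>Each admissible solution yields a partial solution from every time of its interval, so
  it is a restriction of the maximal one. Non-extendibility and uniqueness both follow.\<close>

lemma admissible_solution_maximal:
  assumes v: "admissible_solution T d \<mu> \<Omega> X P D f g J v"
  shows "J \<subseteq> existence_times" "\<And>p. p \<in> J \<times> UNIV \<Longrightarrow> v p = maximal_solution p"
proof -
  show "J \<subseteq> existence_times"
    using admissible_partial_solution[OF v] unfolding existence_times_def by blast
  fix p assume "p \<in> J \<times> (UNIV :: 's set)"
  then obtain s y where p: "p = (s, y)" "s \<in> J" by auto
  have "s \<in> {s..T}"
    using v p(2) admissible_intervalD(2)[of T J] unfolding admissible_solution_def solution_def by auto
  from maximal_solution_eq[OF admissible_partial_solution[OF v p(2)] this, of y]
  show "v p = maximal_solution p" using p by simp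
qed

lemma maximal_solution_nonextendible:
  assumes "T \<in> existence_times"
  shows "nonextendible_solution T d \<mu> \<Omega> X P D f g existence_times maximal_solution"
  unfolding nonextendible_solution_def extendible_def
  using maximal_solution_admissible[OF assms] by (auto dest!: admissible_solution_maximal(1))

lemma nonextendible_solution_unique:
  assumes T: "T \<in> existence_times" and v: "nonextendible_solution T d \<mu> \<Omega> X P D f g J v"
  shows "J = existence_times" "\<And>p. p \<in> existence_times \<times> UNIV \<Longrightarrow> v p = maximal_solution p"
proof -
  have adm: "admissible_solution T d \<mu> \<Omega> X P D f g J v"
    and ext: "\<not> extendible T d \<mu> \<Omega> X P D f g J v"
    using v unfolding nonextendible_solution_def by auto
  note m = admissible_solution_maximal[OF adm]
  show J: "J = existence_times"
  proof (rule ccontr)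
    assume "J \<noteq> existence_times"
    then have "J \<subset> existence_times" using m(1) by blast
    then have "extendible T d \<mu> \<Omega> X P D f g J v"
      unfolding extendible_def using maximal_solution_admissible[OF T] m(2) by blast
    then show False using ext by simp
  qed
  show "v p = maximal_solution p" if "p \<in> existence_times \<times> UNIV" for p
    using m(2) that J by simp
qed

section \<open>Blow-up and regularity of the maximal solution\<close>

text \<open>Points that are neither close to the boundary nor large lie in a compact convex subset
  of the interior, which the solution leaves by \<open>leaves_compact\<close>. A value outside makes
  one of the two terms of the minimum small.\<close>

lemma maximal_solution_blow_up:
  assumes a: "0 \<le> a" "a < T" and I: "existence_times = {a<..T}"
  shows "((\<lambda>t. INF x. min (edist (maximal_solution (t, x)) (frontier D))
      (ereal (1 / (1 + norm (maximal_solution (t, x)))))) \<longlongrightarrow> 0) (at_right a)"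
    (is "(?G \<longlongrightarrow> 0) _")
proof (rule order_tendstoI)
  fix c :: ereal assume c: "c < 0"
  have nn: "0 \<le> ?G t" for t
    by (rule INF_greatest) (simp add: edist_nonneg)
  show "\<forall>\<^sub>F t in at_right a. c < ?G t"
    by (intro always_eventually allI less_le_trans[OF c nn])
next
  fix c :: ereal assume c: "0 < c"
  \<comment> \<open>\<open>c\<close> may be infinite; a positive real number strictly below it is
    what the estimates use.\<close>
  then obtain \<eta> where \<eta>: "0 < \<eta>" "ereal \<eta> < c"
    using ereal_dense2[OF c] by auto
  \<comment> \<open>The radius \<open>1 / \<eta>\<close> is such that a larger norm forces
    \<open>1 / (1 + norm w) < \<eta>\<close>.\<close>
  define A where "A = {w \<in> D. ereal \<eta> \<le> edist w (frontier D) \<and> norm w \<le> 1 / \<eta>}"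
  have A: "A \<subseteq> D" "bounded A" "\<And>w. w \<in> A \<Longrightarrow> ereal \<eta> \<le> edist w (frontier D)"
    by (auto simp: A_def intro!: boundedI[of _ "1 / \<eta>"])
  note cA = closure_subset_interior[OF A(1,2) \<eta>(1) A(3)]
  define K where "K = convex hull (closure A)"
  have "compact K" "convex K" "K \<subseteq> interior D"
    unfolding K_def using convex_hull_subset_interior[OF cA D_convex] by auto
  moreover have "\<nexists>v. partial_solution a v"
  proof
    assume "\<exists>v. partial_solution a v"
    then have "a \<in> existence_times" by (simp add: existence_times_def)
    then show False using I by simp
  qed
  moreover have sol: "partial_solution t maximal_solution" if "a < t" "t \<le> T" for t
    using partial_solution_maximal I that by simp
  ultimately have "\<forall>\<^sub>F t in at_right a. a < t \<and> t \<le> T \<and> (\<exists>y. maximal_solution (t, y) \<notin> K)"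
    using leaves_compact[OF a] by blast
  then show "\<forall>\<^sub>F t in at_right a. ?G t < c"
  proof eventually_elim
    case (elim t)
    then obtain y where y: "maximal_solution (t, y) \<notin> K" by blast
    let ?w = "maximal_solution (t, y)"
    have sol_t: "partial_solution t maximal_solution" using sol elim by simp
    have "t \<in> {t..T}" using elim by simp
    have "?w \<in> D"
    proof -
      obtain L where "L \<subseteq> D" "\<And>s y. s \<in> {t..T} \<Longrightarrow> maximal_solution (s, y) \<in> L"
        by (rule partial_solution_range[OF sol_t]) blast
      then show ?thesis using \<open>t \<in> {t..T}\<close> by blast
    qed
    moreover have "?w \<notin> A" using y closure_subset[of A] hull_subset[of "closure A" convex]
      by (auto simp: K_def)
    ultimately have or: "edist ?w (frontier D) < ereal \<eta> \<or> 1 / \<eta> < norm ?w" by (auto simp: A_def)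
    have "min (edist ?w (frontier D)) (ereal (1 / (1 + norm ?w))) < c"
      using or
    proof
      assume "edist ?w (frontier D) < ereal \<eta>"
      then have "edist ?w (frontier D) < c" using \<eta>(2) by (rule less_trans)
      then show ?thesis by (simp add: min_less_iff_disj)
    next
      assume "1 / \<eta> < norm ?w"
      then have "1 / \<eta> < 1 + norm ?w" by simp
      then have "1 / (1 + norm ?w) < \<eta>"
        using \<eta>(1) by (simp add: divide_less_eq less_divide_eq mult.commute add_pos_nonneg)
      then have "ereal (1 / (1 + norm ?w)) < ereal \<eta>" by simp
      then have "ereal (1 / (1 + norm ?w)) < c" using \<eta>(2) by (rule less_trans)
      then show ?thesis by (simp add: min_less_iff_disj)
    qed
    moreover have "?G t \<le> min (edist ?w (frontier D)) (ereal (1 / (1 + norm ?w)))"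
      by (rule INF_lower) simp
    ultimately show ?case by (rule le_less_trans[rotated])
  qed
qed

text \<open>Near \<open>p\<close> the maximal solution agrees with a function that is continuous on
  the whole strip, provided that one existence time lies below all nearby times.\<close>

lemma maximal_solution_rel_continuous:
  assumes R: "rel_feller R" "\<And>s. R s s" and g: "continuous_on UNIV g"
    and cont: "AE s in \<mu>. continuous_on (UNIV \<times> D) (\<lambda>(x, w). f (s, x) w)"
  shows "rel_continuous R d existence_times maximal_solution"
  unfolding rel_continuous_def
proof (intro ballI allI impI)
  fix p q assume p: "p \<in> existence_times \<times> (UNIV :: 's set)"
    and q: "\<forall>n::nat. q n \<in> existence_times \<times> UNIV \<and> R (fst p) (fst (q n))"
    and lim: "(\<lambda>n. d (q n) p) \<longlonglongrightarrow> 0"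
  have pT: "p \<in> {0..T} \<times> UNIV" and qT: "q n \<in> {0..T} \<times> UNIV" for n
    using p q existence_times_subset by (auto simp: mem_Times_iff)
  have fl: "(\<lambda>n. fst (q n)) \<longlonglongrightarrow> fst p" by (rule fst_tendsto[OF pT qT lim])
  \<comment> \<open>If the time of \<open>p\<close> is positive, an existence time strictly below it
    is eventually passed by the sequence; if it is 0, then 0 itself works.\<close>
  have "\<exists>t\<in>existence_times. t \<le> fst p \<and> (\<forall>\<^sub>F n in sequentially. t \<le> fst (q n))"
  proof (cases "0 < fst p")
    case True
    moreover have "fst p \<in> existence_times" using p by auto
    ultimately obtain t where t: "t < fst p" "t \<in> existence_times" using existence_times_step by blast
    have "\<forall>\<^sub>F n in sequentially. t < fst (q n)" using fl t(1) by (rule order_tendstoD)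
    then have "\<forall>\<^sub>F n in sequentially. t \<le> fst (q n)" by eventually_elim simp
    then show ?thesis using t by (intro bexI[of _ t]) auto
  next
    case False
    then have "fst p = 0" using pT by (auto simp: mem_Times_iff)
    moreover have "fst p \<in> existence_times" using p by auto
    moreover have "0 \<le> fst (q n)" for n using qT[of n] by (auto simp: mem_Times_iff)
    ultimately show ?thesis by (intro bexI[of _ 0]) auto
  qed
  then obtain t where t: "t \<in> existence_times" "t \<le> fst p" "\<forall>\<^sub>F n in sequentially. t \<le> fst (q n)" by blast
  obtain v where v: "rel_continuous R d {0..T} v" "\<And>p. p \<in> {t..T} \<times> UNIV \<Longrightarrow> maximal_solution p = v p"
    using partial_solution_regular[OF partial_solution_maximal[OF t(1)] R g cont] by blast
  have "(\<lambda>n. v (q n)) \<longlonglongrightarrow> v p"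
    using v(1)[unfolded rel_continuous_def, THEN bspec, OF pT, THEN spec, of q] qT q lim by blast
  moreover have "v p = maximal_solution p" using v(2)[of p] t(2) pT by (auto simp: mem_Times_iff)
  moreover have "\<forall>\<^sub>F n in sequentially. v (q n) = maximal_solution (q n)"
    using t(3)
  proof eventually_elim
    case (elim n)
    then have "q n \<in> {t..T} \<times> UNIV" using qT[of n] by (auto simp: mem_Times_iff)
    then show ?case using v(2) by simp
  qed
  ultimately show "(\<lambda>n. maximal_solution (q n)) \<longlonglongrightarrow> maximal_solution p"
    using Lim_transform_eventually by metis
qed

end

theorem theorem2p9:
  fixes T :: real
    and d :: "real \<times> 's::{metric_space, second_countable_topology} \<Rightarrow> real \<times> 's \<Rightarrow> real"
    and \<mu> :: "real measure"
    and \<Omega> :: "'w measure" and F :: "real \<Rightarrow> 'w measure"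
    and X :: "real \<Rightarrow> 'w \<Rightarrow> 's" and P :: "real \<Rightarrow> 's \<Rightarrow> 'w measure"
    and D :: "(real^'k) set"
    and f :: "real \<times> 's \<Rightarrow> real^'k \<Rightarrow> real^'k"
    and g :: "'s \<Rightarrow> real^'k"
    and \<epsilon> :: real
  assumes "0 < T"
    and "sets \<mu> = sets (restrict_space borel {0..T})" and "atomless \<mu>"
    and "pseudometric_on ({0..T} \<times> UNIV) d"
    and "coarser_than_product T d"
    and "time_continuous T d"
    and "markov_process T d \<Omega> F X P"
    and "D \<in> sets borel" and "interior D \<noteq> {}" and "convex D"
    and "f \<in> BC1m T d \<mu> D"
    and "g \<in> borel_measurable borel" and "range g \<subseteq> D" and "bounded (range g)"
    and "consistent_terminal T d g"
    and "0 < \<epsilon>" and "\<And>x. ereal \<epsilon> \<le> edist (g x) (frontier D)"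
  shows "\<exists>I u.
      nonextendible_solution T d \<mu> \<Omega> X P D f g I u
    \<and> (\<forall>J v. nonextendible_solution T d \<mu> \<Omega> X P D f g J v \<longrightarrow>
          J = I \<and> (\<forall>p\<in>I \<times> UNIV. v p = u p))
    \<and> openin (top_of_set {0..T}) I
    \<and> (I = {0..T} \<or>
       ((\<lambda>t. INF x. min (edist (u (t, x)) (frontier D)) (ereal (1 / (1 + norm (u (t, x))))))
          \<longlongrightarrow> 0) (at_right (Inf I)))
    \<and> ((AE s in \<mu>. continuous_on (UNIV \<times> D) (\<lambda>(x, w). f (s, x) w)) \<and> continuous_on UNIV g \<longrightarrow>
         (feller T d X P \<longrightarrow> pm_continuous d I u)
       \<and> (right_feller T d X P \<longrightarrow> right_continuous d I u))"
proof -
  obtain Bg where Bg: "\<And>x. norm (g x) \<le> Bg"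
    using assms(14) unfolding bounded_iff by blast
  interpret terminal_value_problem T d \<Omega> F X P \<mu> D f g Bg
    by unfold_locales (use assms Bg in auto)
  \<comment> \<open>Boundedness and the distance \<open>\<epsilon>\<close> from the frontier place
    the closure of the range of \<open>g\<close> compactly inside the interior, where the
    continuation starts.\<close>
  have "ereal \<epsilon> \<le> edist w (frontier D)" if "w \<in> range g" for w
    using assms(17) that by auto
  note cl = closure_subset_interior[OF assms(13,14,16) this]
  have T: "T \<in> existence_times"
    using partial_solution_start[OF cl] unfolding existence_times_def by blast
  have op: "openin (top_of_set {0..T}) existence_times"
    using T
  proof (cases rule: existence_times_cases)
    case closed
    then show ?thesis by simp
  next
    case half_open
    have *: "{a<..T} = {0..T} \<inter> {a<..}" if "0 \<le> a" for a using that by auto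
    have eq: "existence_times = {0..T} \<inter> {Inf existence_times<..}"
      using half_open(3) *[OF half_open(1)] by (rule trans)
    have "openin (top_of_set {0..T}) ({0..T} \<inter> {Inf existence_times<..})"
      by (rule openin_open_Int) simp
    then show ?thesis by (rule ssubst[OF eq])
  qed
  have bl: "existence_times = {0..T} \<or>
      ((\<lambda>t. INF x. min (edist (maximal_solution (t, x)) (frontier D))
          (ereal (1 / (1 + norm (maximal_solution (t, x)))))) \<longlongrightarrow> 0) (at_right (Inf existence_times))"
    using T
  proof (cases rule: existence_times_cases)
    case half_open
    show ?thesis using maximal_solution_blow_up[OF half_open] by (rule disjI2)
  qed simp
  have ct: "(feller T d X P \<longrightarrow> pm_continuous d existence_times maximal_solution)
       \<and> (right_feller T d X P \<longrightarrow> right_continuous d existence_times maximal_solution)"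
    if cont: "(AE s in \<mu>. continuous_on (UNIV \<times> D) (\<lambda>(x, w). f (s, x) w)) \<and> continuous_on UNIV g"
  proof (intro conjI impI)
    note slab = pseudometric_slab[OF existence_times_subset]
    show "pm_continuous d existence_times maximal_solution" if "feller T d X P"
      unfolding rel_continuous_True[OF slab, symmetric]
      by (rule maximal_solution_rel_continuous[OF rel_feller_True[OF that]]) (use cont in auto)
    show "right_continuous d existence_times maximal_solution" if "right_feller T d X P"
      unfolding rel_continuous_le[OF slab, symmetric]
      by (rule maximal_solution_rel_continuous[OF rel_feller_le[OF that]]) (use cont in auto)
  qed
  have un: "J = existence_times \<and> (\<forall>p\<in>existence_times \<times> UNIV. v p = maximal_solution p)"
    if "nonextendible_solution T d \<mu> \<Omega> X P D f g J v" for J v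
    using nonextendible_solution_unique[OF T that] by blast
  show ?thesis
  proof (rule exI[of _ existence_times], rule exI[of _ maximal_solution], intro conjI)
    show "nonextendible_solution T d \<mu> \<Omega> X P D f g existence_times maximal_solution"
      by (rule maximal_solution_nonextendible[OF T])
    show "\<forall>J v. nonextendible_solution T d \<mu> \<Omega> X P D f g J v \<longrightarrow>
        J = existence_times \<and> (\<forall>p\<in>existence_times \<times> UNIV. v p = maximal_solution p)"
      by (intro allI impI un)
  qed (rule op bl impI ct | assumption)+
qed

end
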